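(* Let $X$ be a compact complex algebraic manifold of general type of complex dimension $n$. Let $e^{-\varphi}$ be the metric of $K_X$ of minimum singularity and let $\Theta_\varphi$ be its curvature current. Let $M$ be a nonsingular hypersurface in $X$ such that the stable vanishing order $\eta$ for $M$ is a positive rational number. Let $$\left.\left(\Theta_\varphi-\eta M\right)\right|_M=\sum_{j=1}^J\gamma_jY_j$$ be the canonical decomposition of the closed positive $(1,1)$-current $\left.\left(\Theta_\varphi-\eta M\right)\right|_M$ on $M$, with $J<\infty$ and each $\gamma_j$ rational. Then the stable vanishing order $\eta$ for $M$ is precisely achieved.
   Context: $K_X$ is the canonical line bundle of $X$; line bundles are written additively. A possibly singular metric of a line bundle is written $e^{-\varphi}$ with $\varphi$ given by local plurisubharmonic weights, and its curvature current is $\Theta_\varphi=\frac{\sqrt{-1}}{2\pi}\partial\bar\partial\varphi$. A hypersurface appearing in an equation of currents denotes its current of integration. The metric of minimum singularity of $K_X$ is the metric constructed from all pluricanonical sections: $$e^{-\varphi}=\frac{1}{\sum_{m=1}^\infty\varepsilon_m\sum_{j=1}^{q_m}|s^{(m)}_j|^{2/m}},$$ where $s^{(m)}_1,\dots,s^{(m)}_{q_m}$ is a $\mathbb{C}$-basis of $\Gamma(X,mK_X)$ and $\varepsilon_m>0$ is a sequence decreasing to $0$ fast enough that the series converges locally uniformly in local trivializations of $K_X$. The stable vanishing order for $M$ is the generic Lelong number of $\Theta_\varphi$ along $M$, i.e. the coefficient of $M$ in the canonical decomposition of $\Theta_\varphi$. It is precisely achieved if there exist a positive integer $m$ and a section $s\in\Gamma(X,mK_X)$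 whose vanishing order across $M$ (at a generic point of $M$) is exactly $m\eta$. The restriction $(\Theta_\varphi-\eta M)|_M$ is the closed positive $(1,1)$-current on $M$ obtained by restricting to $M$ the local plurisubharmonic potentials of the closed positive $(1,1)$-current $\Theta_\varphi-\eta M$; that this restriction is defined is part of the hypothesis. Canonical decomposition: every closed positive $(1,1)$-current on $M$ is uniquely $\sum_{j=1}^J\gamma_j[Y_j]+R$ with distinct irreducible hypersurfaces $Y_j$ of $M$, $\gamma_j>0$, $J\in\mathbb{N}\cup\{0,\infty\}$, and $R$ a closed positive $(1,1)$-current whose Lelong number is zero outside a countable union of subvarieties of codimension at least two in $M$. The hypothesis here is that $J<\infty$ and $R=0$. *)

theory Defs
  imports
    "HOL-Analysis.Analysis"
    "HOL-Library.Function_Algebras"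
    "Jordan_Normal_Form.Determinant"
begin

section \<open>Several complex variables on \<open>\<complex>\<^sup>n\<close>\<close>

text \<open>
  The dimension has to be a term, since a manifold and a hypersurface in it occur together
  (possibly of dimensions 1 and 0). So \<open>\<complex>\<^sup>n\<close> is the set of functions
  \<open>nat \<Rightarrow> complex\<close> that are \<open>undefined\<close> outside \<open>{..<n}\<close>; this is
  the space of the library's finite product measure.
\<close>

definition Cn :: "nat \<Rightarrow> (nat \<Rightarrow> complex) topology" where
  "Cn n = product_topology (\<lambda>_. euclidean) {..<n}"

definition vol :: "nat set \<Rightarrow> (nat \<Rightarrow> complex) measure" where
  "vol I = Pi\<^sub>M I (\<lambda>_. lborel)"

definition Cn_ball :: "nat \<Rightarrow> (nat \<Rightarrow> complex) \<Rightarrow> real \<Rightarrow> (nat \<Rightarrow> complex) set" where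
  "Cn_ball n w r = {v \<in> topspace (Cn n). L2_set (\<lambda>j. cmod (v j - w j)) {..<n} < r}"

definition holo :: "nat \<Rightarrow> (nat \<Rightarrow> complex) set \<Rightarrow> ((nat \<Rightarrow> complex) \<Rightarrow> complex) \<Rightarrow> bool" where
  "holo n W f \<longleftrightarrow> openin (Cn n) W \<and> continuous_map (subtopology (Cn n) W) euclidean f \<and>
     (\<forall>w\<in>W. \<forall>j<n. (\<lambda>t. f (w(j := t))) field_differentiable (at (w j)))"

definition cderiv :: "nat \<Rightarrow> ((nat \<Rightarrow> complex) \<Rightarrow> complex) \<Rightarrow> (nat \<Rightarrow> complex) \<Rightarrow> complex" where
  "cderiv j f w = deriv (\<lambda>t. f (w(j := t))) (w j)"

text \<open>Real partial derivatives: \<open>u = 1\<close> gives \<open>\<partial>/\<partial>x\<^sub>j\<close> and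
  \<open>u = \<i>\<close> gives \<open>\<partial>/\<partial>y\<^sub>j\<close>.\<close>

definition rderiv ::
  "nat \<Rightarrow> complex \<Rightarrow> ((nat \<Rightarrow> complex) \<Rightarrow> complex) \<Rightarrow> (nat \<Rightarrow> complex) \<Rightarrow> complex" where
  "rderiv j u f w = vector_derivative (\<lambda>t::real. f (w(j := w j + of_real t * u))) (at 0)"

definition d_z :: "nat \<Rightarrow> ((nat \<Rightarrow> complex) \<Rightarrow> complex) \<Rightarrow> (nat \<Rightarrow> complex) \<Rightarrow> complex" where
  "d_z j f w = (rderiv j 1 f w - \<i> * rderiv j \<i> f w) / 2"

definition d_zbar :: "nat \<Rightarrow> ((nat \<Rightarrow> complex) \<Rightarrow> complex) \<Rightarrow> (nat \<Rightarrow> complex) \<Rightarrow> complex" where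
  "d_zbar j f w = (rderiv j 1 f w + \<i> * rderiv j \<i> f w) / 2"

primrec Ck :: "nat \<Rightarrow> nat \<Rightarrow> ((nat \<Rightarrow> complex) \<Rightarrow> complex) \<Rightarrow> bool" where
  "Ck n 0 f \<longleftrightarrow> continuous_map (Cn n) euclidean f"
| "Ck n (Suc k) f \<longleftrightarrow> continuous_map (Cn n) euclidean f \<and>
     (\<forall>j<n. \<forall>u\<in>{1, \<i>}.
        (\<forall>w\<in>topspace (Cn n).
           (\<lambda>t::real. f (w(j := w j + of_real t * u))) differentiable (at 0)) \<and>
        Ck n k (rderiv j u f))"

definition test_functions :: "nat \<Rightarrow> (nat \<Rightarrow> complex) set \<Rightarrow> ((nat \<Rightarrow> complex) \<Rightarrow> complex) set" where
  "test_functions n V = {f. (\<forall>k. Ck n k f) \<and>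
     (\<exists>K. compactin (Cn n) K \<and> K \<subseteq> V \<and> (\<forall>w\<in>topspace (Cn n) - K. f w = 0))}"

text \<open>
  Plurisubharmonic functions: upper semicontinuous, not identically \<open>-\<infinity>\<close> on any component
  (equivalently, for functions with the other properties, on any nonempty open subset), and with
  the submean value inequality on every closed complex disc. The circle mean of a function
  bounded above by \<open>C\<close> is written \<open>C\<close> minus the mean of \<open>C - \<phi> \<ge> 0\<close>, so that it
  may be \<open>-\<infinity>\<close>.
\<close>

definition psh :: "nat \<Rightarrow> (nat \<Rightarrow> complex) set \<Rightarrow> ((nat \<Rightarrow> complex) \<Rightarrow> ereal) \<Rightarrow> bool" where
  "psh n U \<phi> \<longleftrightarrow> openin (Cn n) U \<and>
     (\<forall>w\<in>U. \<phi> w < \<infinity>) \<and>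
     (\<forall>a. openin (Cn n) {w\<in>U. \<phi> w < a}) \<and>
     (\<forall>V. openin (Cn n) V \<and> V \<subseteq> U \<and> V \<noteq> {} \<longrightarrow> (\<exists>w\<in>V. \<phi> w \<noteq> -\<infinity>)) \<and>
     (\<forall>w\<in>U. \<forall>v. (\<forall>t\<in>cball 0 1. (\<lambda>i\<in>{..<n}. w i + t * v i) \<in> U) \<longrightarrow>
        (\<forall>C::real. (\<forall>\<theta>. \<phi> (\<lambda>i\<in>{..<n}. w i + cis \<theta> * v i) \<le> ereal C) \<longrightarrow>
           \<phi> w \<le> ereal C - enn2ereal (\<integral>\<^sup>+\<theta>\<in>{0..2*pi}.
              e2ennreal (ereal C - \<phi> (\<lambda>i\<in>{..<n}. w i + cis \<theta> * v i)) \<partial>lborel) / ereal (2*pi)))"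

section \<open>Currents of bidegree (1,1) in coordinates\<close>

text \<open>
  A (1,1)-current \<open>T = \<i> \<Sum> T\<^sub>j\<^sub>k dz\<^sub>j \<and> dzbar\<^sub>k\<close> on an open set of
  \<open>\<complex>\<^sup>n\<close> is given by its coefficients, the distributions \<open>T\<^sub>j\<^sub>k\<close>
  (a locally integrable function being the distribution \<open>f \<mapsto> \<integral> f \<cdot> -\<close> with respect to
  Lebesgue measure).
\<close>

type_synonym current = "nat \<Rightarrow> nat \<Rightarrow> ((nat \<Rightarrow> complex) \<Rightarrow> complex) \<Rightarrow> complex"

definition current_eq :: "nat \<Rightarrow> (nat \<Rightarrow> complex) set \<Rightarrow> current \<Rightarrow> current \<Rightarrow> bool" where
  "current_eq n V S T \<longleftrightarrow> (\<forall>f\<in>test_functions n V. \<forall>j<n. \<forall>k<n. S j k f = T j k f)"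

text \<open>\<open>\<i>/(2\<pi>) \<partial>dbar \<phi>\<close>, in the sense of distributions.\<close>

definition ddc :: "nat \<Rightarrow> ((nat \<Rightarrow> complex) \<Rightarrow> ereal) \<Rightarrow> current" where
  "ddc n \<phi> j k f =
     (LINT w|vol {..<n}. of_real (real_of_ereal (\<phi> w)) * d_z j (d_zbar k f) w) / of_real (2*pi)"

text \<open>\<open>F\<close> is a local equation of \<open>Z\<close> at the point \<open>w\<close> of \<open>Z\<close>, with nonzero differential there.\<close>

definition smooth_equation ::
  "nat \<Rightarrow> (nat \<Rightarrow> complex) set \<Rightarrow> (nat \<Rightarrow> complex) \<Rightarrow> ((nat \<Rightarrow> complex) \<Rightarrow> complex) \<Rightarrow> bool" where
  "smooth_equation n Z w F \<longleftrightarrow> w \<in> Z \<and>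
     (\<exists>W. w \<in> W \<and> holo n W F \<and> Z \<inter> W = {v\<in>W. F v = 0}) \<and> (\<exists>j<n. cderiv j F w \<noteq> 0)"

definition regular_part :: "nat \<Rightarrow> (nat \<Rightarrow> complex) set \<Rightarrow> (nat \<Rightarrow> complex) set" where
  "regular_part n Z = {w. \<exists>F. smooth_equation n Z w F}"

text \<open>Well defined up to a nonzero complex factor, which cancels below.\<close>

definition conormal :: "nat \<Rightarrow> (nat \<Rightarrow> complex) set \<Rightarrow> (nat \<Rightarrow> complex) \<Rightarrow> nat \<Rightarrow> complex" where
  "conormal n Z w = (SOME \<nu>. \<exists>F. smooth_equation n Z w F \<and> \<nu> = (\<lambda>j. cderiv j F w))"

text \<open>
  Integral of \<open>g\<close> over the regular part of a hypersurface \<open>Z\<close> against the area form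
  \<open>\<omega>\<^sup>n\<^sup>-\<^sup>1/(n-1)!\<close>, where \<open>\<omega> = (\<i>/2) \<Sum> dz\<^sub>i \<and> dzbar\<^sub>i\<close>. This form is
  \<open>\<Sum>\<^sub>l \<Prod>\<^sub>i\<^sub>\<noteq>\<^sub>l (\<i>/2) dz\<^sub>i \<and> dzbar\<^sub>i\<close>, and the integral of the \<open>l\<close>-th summand is
  computed by projecting along the \<open>l\<close>-th coordinate axis and summing over the fibres.
\<close>

definition hypersurface_integral ::
  "nat \<Rightarrow> (nat \<Rightarrow> complex) set \<Rightarrow> ((nat \<Rightarrow> complex) \<Rightarrow> complex) \<Rightarrow> complex" where
  "hypersurface_integral n Z g = (\<Sum>l<n. LINT w|vol ({..<n} - {l}).
     (\<Sum>\<^sub>\<infinity>t\<in>{t. w(l := t) \<in> regular_part n Z}. g (w(l := t))))"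

text \<open>
  The current of integration \<open>[Z]\<close> over the regular part of \<open>Z\<close>. For \<open>Z = {z\<^sub>0 = 0}\<close> it is
  \<open>\<delta>\<^sub>0(z\<^sub>0) (\<i>/2) dz\<^sub>0 \<and> dzbar\<^sub>0\<close>; in general it is
  \<open>(\<i>/2) \<nu> \<and> cnj \<nu> / \<bar>\<nu>\<bar>\<^sup>2\<close> times the area measure, with \<open>\<nu> = dF\<close> a conormal
  covector.
\<close>

definition integration_current :: "nat \<Rightarrow> (nat \<Rightarrow> complex) set \<Rightarrow> current" where
  "integration_current n Z j k f = hypersurface_integral n Z
     (\<lambda>w. f w * (conormal n Z w j * cnj (conormal n Z w k))
            / of_real (\<Sum>i<n. (cmod (conormal n Z w i))\<^sup>2)) / 2"

text \<open>
  Lelong number of a positive current \<open>T\<close>: the limit of the mass of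
  \<open>T \<and> \<omega>\<^sup>n\<^sup>-\<^sup>1/(n-1)! = 2 \<Sum>\<^sub>j T\<^sub>j\<^sub>j\<close> on the ball of radius \<open>r\<close>, divided by the volume of the ball
  of radius \<open>r\<close> in \<open>\<complex>\<^sup>n\<^sup>-\<^sup>1\<close>.
\<close>

definition trace_mass :: "nat \<Rightarrow> current \<Rightarrow> (nat \<Rightarrow> complex) set \<Rightarrow> real" where
  "trace_mass n T V =
     (SUP f \<in> {f \<in> test_functions n V. \<forall>w\<in>topspace (Cn n). f w \<in> \<real> \<and> 0 \<le> Re (f w) \<and> Re (f w) \<le> 1}.
        Re (2 * (\<Sum>j<n. T j j f)))"

definition lelong :: "nat \<Rightarrow> current \<Rightarrow> (nat \<Rightarrow> complex) \<Rightarrow> real" where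
  "lelong n T w = Lim (at_right 0)
     (\<lambda>r. trace_mass n T (Cn_ball n w r) / (unit_ball_vol (2 * real (n - 1)) * r ^ (2 * (n - 1))))"

section \<open>Complex manifolds\<close>

type_synonym 'a chart = "'a set \<times> ('a \<Rightarrow> nat \<Rightarrow> complex)"

abbreviation img :: "'a chart \<Rightarrow> (nat \<Rightarrow> complex) set" where
  "img c \<equiv> snd c ` fst c"

definition is_chart :: "nat \<Rightarrow> 'a topology \<Rightarrow> 'a chart \<Rightarrow> bool" where
  "is_chart n X c \<longleftrightarrow> openin X (fst c) \<and> openin (Cn n) (img c) \<and> snd c \<in> extensional (fst c) \<and>
     homeomorphic_map (subtopology X (fst c)) (subtopology (Cn n) (img c)) (snd c)"

definition transition :: "'a chart \<Rightarrow> 'a chart \<Rightarrow> (nat \<Rightarrow> complex) \<Rightarrow> nat \<Rightarrow> complex" where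
  "transition c d w = snd d (inv_into (fst c) (snd c) w)"

definition compatible :: "nat \<Rightarrow> 'a chart \<Rightarrow> 'a chart \<Rightarrow> bool" where
  "compatible n c d \<longleftrightarrow>
     (\<forall>i<n. holo n (snd c ` (fst c \<inter> fst d)) (\<lambda>w. transition c d w i) \<and>
            holo n (snd d ` (fst c \<inter> fst d)) (\<lambda>w. transition d c w i))"

text \<open>A complex manifold of dimension \<open>n\<close>, given by its topology and its maximal holomorphic atlas.\<close>

definition complex_manifold :: "nat \<Rightarrow> 'a topology \<Rightarrow> 'a chart set \<Rightarrow> bool" where
  "complex_manifold n X A \<longleftrightarrow> Hausdorff_space X \<and>
     (\<exists>B. countable B \<and> (\<forall>V\<in>B. openin X V) \<and>
          (\<forall>U x. openin X U \<and> x \<in> U \<longrightarrow> (\<exists>V\<in>B. x \<in> V \<and> V \<subseteq> U))) \<and>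
     (\<Union>c\<in>A. fst c) = topspace X \<and>
     A = {c. is_chart n X c \<and> (\<forall>d\<in>A. compatible n c d)}"

text \<open>
  Projective algebraic: there is an injective holomorphic immersion into some \<open>\<P>\<^sup>N\<close>, which is an
  embedding if the manifold is compact. The point of \<open>\<P>\<^sup>N\<close> with homogeneous coordinates \<open>v\<close> is
  the set of all homogeneous coordinate vectors of it, and holomorphic maps to \<open>\<P>\<^sup>N\<close> are those
  with local holomorphic lifts \<open>F\<close> to \<open>\<complex>\<^sup>N\<^sup>+\<^sup>1 - {0}\<close>; such a map is an immersion iff
  \<open>F, \<partial>\<^sub>1F, \<dots>, \<partial>\<^sub>nF\<close> are linearly independent.
\<close>

definition proj_point :: "nat \<Rightarrow> (nat \<Rightarrow> complex) \<Rightarrow> (nat \<Rightarrow> complex) set" where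
  "proj_point N v = {\<lambda>k\<in>{..N}. a * v k |a. a \<noteq> 0}"

definition projective_algebraic :: "nat \<Rightarrow> 'a topology \<Rightarrow> 'a chart set \<Rightarrow> bool" where
  "projective_algebraic n X A \<longleftrightarrow> (\<exists>N. \<exists>\<Phi> :: 'a \<Rightarrow> (nat \<Rightarrow> complex) set. inj_on \<Phi> (topspace X) \<and>
     (\<forall>x\<in>topspace X. \<exists>c\<in>A. x \<in> fst c \<and> (\<exists>W F. snd c x \<in> W \<and> W \<subseteq> img c \<and>
        (\<forall>k\<le>N. holo n W (F k)) \<and>
        (\<forall>y\<in>fst c. snd c y \<in> W \<longrightarrow>
           (\<exists>k\<le>N. F k (snd c y) \<noteq> 0) \<and> \<Phi> y = proj_point N (\<lambda>k. F k (snd c y))) \<and>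
        (\<forall>a b. (\<forall>k\<le>N. a * F k (snd c x) + (\<Sum>j<n. b j * cderiv j (F k) (snd c x)) = 0) \<longrightarrow>
           a = 0 \<and> (\<forall>j<n. b j = (0::complex))))))"

definition analytic_subset :: "nat \<Rightarrow> 'a topology \<Rightarrow> 'a chart set \<Rightarrow> 'a set \<Rightarrow> bool" where
  "analytic_subset n X A Y \<longleftrightarrow> Y \<subseteq> topspace X \<and>
     (\<forall>x\<in>topspace X. \<exists>c\<in>A. x \<in> fst c \<and> (\<exists>W Fs. openin (Cn n) W \<and> snd c x \<in> W \<and> W \<subseteq> img c \<and>
        finite Fs \<and> (\<forall>F\<in>Fs. holo n W F) \<and>
        snd c ` (Y \<inter> fst c) \<inter> W = {w\<in>W. \<forall>F\<in>Fs. F w = 0}))"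

definition analytic_hypersurface :: "nat \<Rightarrow> 'a topology \<Rightarrow> 'a chart set \<Rightarrow> 'a set \<Rightarrow> bool" where
  "analytic_hypersurface n X A Y \<longleftrightarrow> Y \<subseteq> topspace X \<and>
     (\<forall>x\<in>topspace X. \<exists>c\<in>A. x \<in> fst c \<and> (\<exists>W F. snd c x \<in> W \<and> W \<subseteq> img c \<and> holo n W F \<and>
        (\<forall>V. openin (Cn n) V \<and> V \<subseteq> W \<and> V \<noteq> {} \<longrightarrow> (\<exists>w\<in>V. F w \<noteq> 0)) \<and>
        snd c ` (Y \<inter> fst c) \<inter> W = {w\<in>W. F w = 0}))"

definition irreducible_hypersurface :: "nat \<Rightarrow> 'a topology \<Rightarrow> 'a chart set \<Rightarrow> 'a set \<Rightarrow> bool" where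
  "irreducible_hypersurface n X A Y \<longleftrightarrow> Y \<noteq> {} \<and> analytic_hypersurface n X A Y \<and>
     (\<forall>Y1 Y2. analytic_subset n X A Y1 \<and> analytic_subset n X A Y2 \<and> Y = Y1 \<union> Y2 \<longrightarrow>
        Y1 = Y \<or> Y2 = Y)"

text \<open>Charts in which \<open>M\<close> is the hyperplane where the last coordinate vanishes.\<close>

definition adapted_charts :: "nat \<Rightarrow> 'a chart set \<Rightarrow> 'a set \<Rightarrow> 'a chart set" where
  "adapted_charts n A M = {c\<in>A. \<forall>x\<in>fst c. x \<in> M \<longleftrightarrow> snd c x (n - 1) = 0}"

definition nonsingular_hypersurface :: "nat \<Rightarrow> 'a topology \<Rightarrow> 'a chart set \<Rightarrow> 'a set \<Rightarrow> bool" where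
  "nonsingular_hypersurface n X A M \<longleftrightarrow> 1 \<le> n \<and> M \<noteq> {} \<and> closedin X M \<and> connectedin X M \<and>
     M \<subseteq> (\<Union>c\<in>adapted_charts n A M. fst c)"

definition restrict_chart :: "nat \<Rightarrow> 'a set \<Rightarrow> 'a chart \<Rightarrow> 'a chart" where
  "restrict_chart n M c = (fst c \<inter> M, \<lambda>x\<in>fst c \<inter> M. restrict (snd c x) {..<n - 1})"

text \<open>An atlas (not maximal) of \<open>M\<close> as an \<open>(n-1)\<close>-dimensional manifold.\<close>

definition induced_atlas :: "nat \<Rightarrow> 'a chart set \<Rightarrow> 'a set \<Rightarrow> 'a chart set" where
  "induced_atlas n A M = restrict_chart n M ` adapted_charts n A M"

section \<open>Pluricanonical sections and the metric of minimum singularity\<close>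

definition jacobian :: "nat \<Rightarrow> 'a chart \<Rightarrow> 'a chart \<Rightarrow> (nat \<Rightarrow> complex) \<Rightarrow> complex" where
  "jacobian n c d w =
     Determinant.det (Matrix.mat n n (\<lambda>(i, j). cderiv j (\<lambda>v. transition c d v i) w))"

text \<open>
  A section \<open>s\<close> of \<open>mK\<^sub>X\<close> is the family of its local expressions
  \<open>s c (dz\<^sub>1 \<and> \<dots> \<and> dz\<^sub>n)\<^sup>m\<close>, where \<open>z = snd c\<close>. The local expressions are set
  to zero where they are meaningless, so that families and sections correspond bijectively.
\<close>

type_synonym 'a section_family = "'a chart \<Rightarrow> (nat \<Rightarrow> complex) \<Rightarrow> complex"

definition plurican :: "nat \<Rightarrow> 'a chart set \<Rightarrow> nat \<Rightarrow> 'a section_family set" where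
  "plurican n A m = {s.
     (\<forall>c\<in>A. holo n (img c) (s c)) \<and>
     (\<forall>c w. c \<notin> A \<or> w \<notin> img c \<longrightarrow> s c w = 0) \<and>
     (\<forall>c\<in>A. \<forall>d\<in>A. \<forall>w\<in>snd c ` (fst c \<inter> fst d).
        s c w = s d (transition c d w) * jacobian n c d w ^ m)}"

definition section_scale :: "complex \<Rightarrow> 'a section_family \<Rightarrow> 'a section_family" where
  "section_scale a s = (\<lambda>c w. a * s c w)"

definition general_type :: "nat \<Rightarrow> 'a chart set \<Rightarrow> bool" where
  "general_type n A \<longleftrightarrow> (\<exists>a>0. \<exists>\<^sub>F m in sequentially.
     a * real m ^ n \<le> real (vector_space.dim section_scale (plurican n A m)))"

definition metric_term :: "(nat \<Rightarrow> real) \<Rightarrow> (nat \<Rightarrow> nat) \<Rightarrow> (nat \<Rightarrow> nat \<Rightarrow> 'a section_family) \<Rightarrow>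
    nat \<Rightarrow> 'a chart \<Rightarrow> (nat \<Rightarrow> complex) \<Rightarrow> real" where
  "metric_term \<epsilon> q s m c w = \<epsilon> m * (\<Sum>j<q m. cmod (s m j c w) powr (2 / real m))"

text \<open>Only indices \<open>m \<ge> 1\<close> matter; \<open>s m 0, \<dots>, s m (q m - 1)\<close> is the chosen basis.\<close>

definition min_singularity_data :: "nat \<Rightarrow> 'a chart set \<Rightarrow>
    (nat \<Rightarrow> real) \<Rightarrow> (nat \<Rightarrow> nat) \<Rightarrow> (nat \<Rightarrow> nat \<Rightarrow> 'a section_family) \<Rightarrow> bool" where
  "min_singularity_data n A \<epsilon> q s \<longleftrightarrow>
     (\<forall>m\<ge>1. 0 < \<epsilon> m \<and> \<epsilon> (Suc m) \<le> \<epsilon> m) \<and> \<epsilon> \<longlonglongrightarrow> 0 \<and>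
     (\<forall>m\<ge>1. inj_on (s m) {..<q m} \<and>
        \<not> module.dependent section_scale (s m ` {..<q m}) \<and>
        module.span section_scale (s m ` {..<q m}) = plurican n A m) \<and>
     (\<forall>c\<in>A. \<forall>K. compactin (Cn n) K \<and> K \<subseteq> img c \<longrightarrow>
        uniformly_convergent_on K (\<lambda>N w. \<Sum>m=1..N. metric_term \<epsilon> q s m c w))"

text \<open>The local weights \<open>\<phi>\<close> of the metric, with \<open>log 0 = -\<infinity>\<close>.\<close>

definition min_singularity_weight :: "(nat \<Rightarrow> real) \<Rightarrow> (nat \<Rightarrow> nat) \<Rightarrow> (nat \<Rightarrow> nat \<Rightarrow> 'a section_family) \<Rightarrow>
    'a chart \<Rightarrow> (nat \<Rightarrow> complex) \<Rightarrow> ereal" where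
  "min_singularity_weight \<epsilon> q s c w =
     (let S = (\<Sum>m. metric_term \<epsilon> q s (Suc m) c w) in if S = 0 then -\<infinity> else ereal (ln S))"

section \<open>Currents on manifolds\<close>

text \<open>A (1,1)-current on a manifold is given by its expressions in the charts of an atlas.\<close>

definition curvature_current ::
  "nat \<Rightarrow> ('a chart \<Rightarrow> (nat \<Rightarrow> complex) \<Rightarrow> ereal) \<Rightarrow> 'a chart \<Rightarrow> current" where
  "curvature_current n \<phi> c = ddc n (\<phi> c)"

definition hypersurface_current :: "nat \<Rightarrow> 'a set \<Rightarrow> 'a chart \<Rightarrow> current" where
  "hypersurface_current n Y c = integration_current n (snd c ` (Y \<inter> fst c))"

definition generic_lelong :: "nat \<Rightarrow> 'a chart set \<Rightarrow> ('a chart \<Rightarrow> current) \<Rightarrow> 'a set \<Rightarrow> real" where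
  "generic_lelong n A T M = Inf {lelong n (T c) (snd c x) |c x. c \<in> A \<and> x \<in> fst c \<inter> M}"

text \<open>
  \<open>S\<close> is the restriction of \<open>T\<close> to \<open>M\<close>: near every point of \<open>M\<close> there is a plurisubharmonic
  potential of \<open>T\<close> whose restriction to \<open>M\<close> is plurisubharmonic (in particular not identically
  \<open>-\<infinity>\<close>) and is a potential of \<open>S\<close>.
\<close>

definition is_restriction ::
  "nat \<Rightarrow> 'a chart set \<Rightarrow> 'a set \<Rightarrow> ('a chart \<Rightarrow> current) \<Rightarrow> ('a chart \<Rightarrow> current) \<Rightarrow> bool" where
  "is_restriction n A M T S \<longleftrightarrow> (\<forall>x\<in>M. \<exists>c\<in>adapted_charts n A M. x \<in> fst c \<and> (\<exists>\<psi>.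
     psh n (img c) \<psi> \<and> current_eq n (img c) (T c) (ddc n \<psi>) \<and>
     (let c' = restrict_chart n M c; \<psi>' = (\<lambda>v. \<psi> (v(n - 1 := 0))) in
        psh (n - 1) (img c') \<psi>' \<and> current_eq (n - 1) (img c') (S c') (ddc (n - 1) \<psi>'))))"

section \<open>Vanishing orders\<close>

definition vanishing_order_at ::
  "nat \<Rightarrow> 'a chart set \<Rightarrow> 'a set \<Rightarrow> 'a section_family \<Rightarrow> nat \<Rightarrow> 'a \<Rightarrow> bool" where
  "vanishing_order_at n A M s k x \<longleftrightarrow> (\<exists>c\<in>adapted_charts n A M. x \<in> fst c \<and>
     (\<exists>W g. snd c x \<in> W \<and> W \<subseteq> img c \<and> holo n W g \<and>
        (\<forall>w\<in>W. s c w = w (n - 1) ^ k * g w) \<and> g (snd c x) \<noteq> 0))"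

text \<open>\<open>s\<close> vanishes to order exactly \<open>k\<close> at a generic point of \<open>M\<close>, i.e. off a proper analytic subset.\<close>

definition vanishing_order_across ::
  "nat \<Rightarrow> 'a topology \<Rightarrow> 'a chart set \<Rightarrow> 'a set \<Rightarrow> 'a section_family \<Rightarrow> nat \<Rightarrow> bool" where
  "vanishing_order_across n X A M s k \<longleftrightarrow>
     (\<exists>Z. analytic_subset (n - 1) (subtopology X M) (induced_atlas n A M) Z \<and> Z \<noteq> M \<and>
        (\<forall>x\<in>M - Z. vanishing_order_at n A M s k x))"

definition precisely_achieved ::
  "nat \<Rightarrow> 'a topology \<Rightarrow> 'a chart set \<Rightarrow> 'a set \<Rightarrow> real \<Rightarrow> bool" where
  "precisely_achieved n X A M \<eta> \<longleftrightarrow> (\<exists>m\<ge>1. \<exists>s\<in>plurican n A m. \<exists>k.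
     vanishing_order_across n X A M s k \<and> real k = real m * \<eta>)"

end

theory Submission
  imports Defs "HOL-Complex_Analysis.Complex_Analysis"
begin

text \<open>
  Since \<open>\<Theta> - \<eta>M\<close> has plurisubharmonic local potentials \<open>\<psi>\<close> with \<open>\<psi>|M \<noteq> -\<infinity>\<close>, no extension theorem is
  needed. In coordinates with \<open>M = {z\<^sub>n = 0}\<close>, the weight \<open>\<phi>\<close> equals \<open>\<psi> + \<eta> ln \<bar>z\<^sub>n\<bar>\<^sup>2\<close> up to a bounded
  function; this is extracted from the equation of currents by testing it with products of radial
  functions, which compares averages of \<open>\<phi> - \<psi>\<close> against smooth kernels at different scales.
  As \<open>\<psi>\<close> is bounded above, every term of the series \<open>exp \<phi>\<close> is \<open>O(\<bar>z\<^sub>n\<bar>\<^sup>2\<^sup>\<eta>)\<close>, so that a section of \<open>mK\<close>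
  vanishes along \<open>M\<close> to order at least \<open>m\<eta>\<close>. If \<open>m\<eta>\<close> were never attained, each term of
  \<open>exp \<phi> / \<bar>z\<^sub>n\<bar>\<^sup>2\<^sup>\<eta>\<close> would tend to zero at \<open>M\<close>; by the maximum principle in the normal direction the
  series converges uniformly up to \<open>M\<close>, so its sum would tend to zero too, forcing \<open>\<psi> = -\<infinity>\<close> on \<open>M\<close>.
\<close>

section \<open>Smooth kernels on the real line\<close>

text \<open>The equation of currents is tested on products of functions of the squared distances
  \<bar>z_j - \<zeta>_j\<bar>^2: for these, the diagonal coefficients of
  \<open>\<partial>dbar\<close> are ordinary derivatives in one real variable. The obstacle is that
  \<phi> cannot be evaluated pointwise. It is handled as the logarithm of a series, its averages are
  finite because Jensen's inequality integrates the logarithm of one section, and its lower bounds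
  are used on whole neighbourhoods; submean inequalities are applied to \<psi>. The exponent 2\<eta>
  need not be an even integer, and the terms of the series are fractional powers. Their quotient by
  \<bar>z_n\<bar>^(2\<eta>) is therefore not the modulus of a holomorphic function, and its maximum
  principle is obtained from local branches. Attaining the order is a statement about generic points
  of M, while the contradiction is local. The bridge is that the points where a section of mK misses
  the order m\<eta> form an analytic subset of M; if the order is not attained across M, this subset
  is M itself, and one chart around any point of M is enough.\<close>

primrec smooth_upto :: "nat \<Rightarrow> (real \<Rightarrow> real) \<Rightarrow> bool" where
  "smooth_upto 0 f \<longleftrightarrow> True"
| "smooth_upto (Suc k) f \<longleftrightarrow>
     (\<exists>f'. (\<forall>x. (f has_real_derivative f' x) (at x)) \<and> smooth_upto k f')"

definition smooth :: "(real \<Rightarrow> real) \<Rightarrow> bool" where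
  "smooth f \<longleftrightarrow> (\<forall>k. smooth_upto k f)"

lemma smooth_upto_Suc_D: "smooth_upto (Suc k) f \<Longrightarrow> smooth_upto k f"
  by (induction k arbitrary: f) auto

lemma smooth_upto_const: "smooth_upto k (\<lambda>x. c)"
  by (induction k arbitrary: c) (auto intro!: exI[of _ "\<lambda>x. 0"] derivative_eq_intros)

lemma smooth_upto_add: "smooth_upto k f \<Longrightarrow> smooth_upto k g \<Longrightarrow> smooth_upto k (\<lambda>x. f x + g x)"
proof (induction k arbitrary: f g)
  case (Suc k)
  then obtain f' g' where "\<forall>x. (f has_real_derivative f' x) (at x)" "smooth_upto k f'"
    "\<forall>x. (g has_real_derivative g' x) (at x)" "smooth_upto k g'" by auto
  then show ?case
    using Suc.IH by (auto intro!: exI[of _ "\<lambda>x. f' x + g' x"] derivative_intros)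
qed simp

lemma smooth_upto_mult: "smooth_upto k f \<Longrightarrow> smooth_upto k g \<Longrightarrow> smooth_upto k (\<lambda>x. f x * g x)"
proof (induction k arbitrary: f g)
  case (Suc k)
  then obtain f' g' where *: "\<forall>x. (f has_real_derivative f' x) (at x)" "smooth_upto k f'"
    "\<forall>x. (g has_real_derivative g' x) (at x)" "smooth_upto k g'" by auto
  moreover have "smooth_upto k f" "smooth_upto k g"
    using Suc.prems by (auto intro: smooth_upto_Suc_D simp del: smooth_upto.simps)
  ultimately have "smooth_upto k (\<lambda>x. f' x * g x + f x * g' x)"
    by (intro smooth_upto_add Suc.IH)
  with * show ?case
    by (auto intro!: exI[of _ "\<lambda>x. f' x * g x + f x * g' x"] derivative_eq_intros)
qed simp

lemma smooth_upto_affine: "smooth_upto k f \<Longrightarrow> smooth_upto k (\<lambda>x. f (a * x + b))"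
proof (induction k arbitrary: f)
  case (Suc k)
  then obtain f' where *: "\<And>x. (f has_real_derivative f' x) (at x)" "smooth_upto k f'" by auto
  have "((\<lambda>x. f (a * x + b)) has_real_derivative a * f' (a * x + b)) (at x)" for x
    by (rule DERIV_chain_s[of UNIV f f' "\<lambda>x. a * x + b", THEN DERIV_cong])
       (auto intro!: * derivative_eq_intros)
  then show ?case
    using Suc.IH[OF *(2)] by (auto intro!: exI[of _ "\<lambda>x. a * f' (a * x + b)"] smooth_upto_mult smooth_upto_const)
qed simp

text \<open>Vanishing to the left of a positive c hides the singularity of 1 / x^m at 0. The
  exponent is general because differentiation produces f / x^(m+1); the case m = 1 makes the
  derivative of the regularized logarithm smooth.\<close>

lemma smooth_upto_div_power:
  assumes "smooth_upto k f" "c > 0" "\<And>x. x < c \<Longrightarrow> f x = 0"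
  shows "smooth_upto k (\<lambda>x. f x / x ^ m)"
  using assms
proof (induction k arbitrary: f m)
  case (Suc k)
  then obtain f' where f': "\<And>x. (f has_real_derivative f' x) (at x)" "smooth_upto k f'" by auto
  have f'0: "f' x = 0" if "x < c" for x
  proof -
    have "eventually (\<lambda>y. y \<in> {..<c}) (nhds x)"
      using that by (intro eventually_nhds_in_open) auto
    then have "eventually (\<lambda>y. f y = 0) (nhds x)"
      by eventually_elim (use Suc.prems in auto)
    then have "(f has_real_derivative 0) (at x)"
      by (subst DERIV_cong_ev[of x x f "\<lambda>_. 0" 0 0]) auto
    then show ?thesis using f'(1)[of x] DERIV_unique by blast
  qed
  have "((\<lambda>x. f x / x ^ m) has_real_derivative (f' x / x ^ m + (- real m) * (f x / x ^ Suc m))) (at x)" for x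
  proof (cases "x < c")
    case True
    have "eventually (\<lambda>y. y \<in> {..<c}) (nhds x)"
      using True by (intro eventually_nhds_in_open) auto
    then have "eventually (\<lambda>y. f y / y ^ m = 0) (nhds x)"
      by eventually_elim (use Suc.prems in auto)
    then have "((\<lambda>x. f x / x ^ m) has_real_derivative 0) (at x)"
      by (subst DERIV_cong_ev[of x x _ "\<lambda>_. 0" 0 0]) auto
    then show ?thesis using True f'0 Suc.prems by simp
  next
    case False
    then have x: "x > 0" using Suc.prems by simp
    have d2: "((\<lambda>y. y ^ m) has_real_derivative real m * x ^ (m - 1)) (at x)"
      by (auto intro!: derivative_eq_intros)
    have eq: "(f' x * x ^ m - f x * (real m * x ^ (m - 1))) / (x ^ m * x ^ m)
        = f' x / x ^ m + (- real m) * (f x / x ^ Suc m)"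
      using x by (cases m) (simp_all add: divide_simps, simp_all add: algebra_simps)
    show ?thesis using DERIV_divide[OF f'(1)[of x] d2] x unfolding eq by simp
  qed
  moreover have "smooth_upto k (\<lambda>x. f' x / x ^ m + (- real m) * (f x / x ^ Suc m))"
    using Suc.prems Suc.IH[OF f'(2), of m] Suc.IH[of f "Suc m"] f'0
    by (intro smooth_upto_add smooth_upto_mult smooth_upto_const)
       (auto intro: smooth_upto_Suc_D simp del: smooth_upto.simps)
  ultimately show ?case unfolding smooth_upto.simps
    by (intro exI[of _ "\<lambda>x. f' x / x ^ m + (- real m) * (f x / x ^ Suc m)"]) blast
qed simp

text \<open>Each order k supplies its own derivative; uniqueness of derivatives identifies them all,
  so that one f' serves every order.\<close>

lemma smoothE:
  assumes "smooth f"
  obtains f' where "\<And>x. (f has_real_derivative f' x) (at x)" "smooth f'"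
proof -
  from assms have 1: "smooth_upto (Suc k) f" for k by (auto simp: smooth_def)
  have "\<exists>f'. \<forall>x. (f has_real_derivative f' x) (at x)" using 1[of 0] by auto
  then obtain f' where f': "\<And>x. (f has_real_derivative f' x) (at x)" by blast
  have "smooth_upto k f'" for k
  proof -
    from 1[of k] obtain f'' where "\<And>x. (f has_real_derivative f'' x) (at x)" "smooth_upto k f''" by auto
    moreover from this have "f'' = f'" using f' DERIV_unique by blast
    ultimately show ?thesis by simp
  qed
  then show ?thesis using that f' by (auto simp: smooth_def)
qed

lemma smooth_if_derivative:
  "(\<And>x. (f has_real_derivative f' x) (at x)) \<Longrightarrow> smooth f' \<Longrightarrow> smooth f"
  unfolding smooth_def by (metis smooth_upto.simps not0_implies_Suc)

lemma smooth_continuous: "smooth f \<Longrightarrow> continuous_on S f"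
  by (metis DERIV_continuous continuous_at_imp_continuous_on smoothE)

lemma smooth_intros:
  "smooth (\<lambda>x. c)"
  "smooth f \<Longrightarrow> smooth g \<Longrightarrow> smooth (\<lambda>x. f x + g x)"
  "smooth f \<Longrightarrow> smooth g \<Longrightarrow> smooth (\<lambda>x. f x * g x)"
  "smooth f \<Longrightarrow> smooth (\<lambda>x. f (a * x + b))"
  by (auto simp: smooth_def smooth_upto_const smooth_upto_add smooth_upto_mult smooth_upto_affine)

lemma smooth_uminus_diff:
  "smooth f \<Longrightarrow> smooth (\<lambda>x. - f x)"
  "smooth f \<Longrightarrow> smooth g \<Longrightarrow> smooth (\<lambda>x. f x - g x)"
  "smooth f \<Longrightarrow> smooth (\<lambda>x. f (x / c))"
  using smooth_intros(3)[OF smooth_intros(1)[of "-1"], of f]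
    smooth_intros(2)[of f, OF _ smooth_intros(3)[OF smooth_intros(1)[of "-1"], of g]]
    smooth_intros(4)[of f "1/c" 0] by auto

text \<open>The denominators x^m make the family closed under differentiation up to linear
  combinations, which reduces smoothness at 0 to an induction over the order.\<close>

definition flat_exp :: "nat \<Rightarrow> real \<Rightarrow> real" where
  "flat_exp m x = (if x > 0 then exp (- (1 / x)) / x ^ m else 0)"

lemma flat_exp_tendsto_0: "(flat_exp m \<longlongrightarrow> 0) (at 0)"
proof -
  have "((\<lambda>x::real. exp (- (1 / x)) / x ^ m) \<longlongrightarrow> 0) (at_right 0)"
  proof -
    have "((\<lambda>y::real. y ^ m / exp y) \<longlongrightarrow> 0) at_top" by (rule tendsto_power_div_exp_0)
    then have "((\<lambda>x::real. (inverse x) ^ m / exp (inverse x)) \<longlongrightarrow> 0) (at_right 0)"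
      by (rule filterlim_compose[OF _ filterlim_inverse_at_top_right])
    then show ?thesis by (simp add: exp_minus field_simps)
  qed
  then have 1: "(flat_exp m \<longlongrightarrow> 0) (at_right 0)"
    by (rule Lim_transform_eventually) (auto simp: eventually_at_filter flat_exp_def)
  have 2: "(flat_exp m \<longlongrightarrow> 0) (at_left 0)"
    by (rule Lim_transform_eventually[of "\<lambda>_. 0"]) (auto simp: eventually_at_filter flat_exp_def)
  show ?thesis using 1 2 by (simp add: filterlim_at_split)
qed

lemma flat_exp_deriv:
  "(flat_exp m has_real_derivative flat_exp (m + 2) x + (- real m) * flat_exp (m + 1) x) (at x)"
proof -
  consider "x > 0" | "x < 0" | "x = 0" by linarith
  then show ?thesis
  proof cases
    case 1
    have "eventually (\<lambda>y. y \<in> {0<..}) (nhds x)"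
      using 1 by (intro eventually_nhds_in_open) auto
    then have ev: "eventually (\<lambda>y. flat_exp m y = exp (- (1 / y)) / y ^ m) (nhds x)"
      by eventually_elim (auto simp: flat_exp_def)
    have d1: "((\<lambda>y. exp (- (1 / y))) has_real_derivative exp (- (1 / x)) / x ^ 2) (at x)"
      using 1 by (auto intro!: derivative_eq_intros simp: power2_eq_square)
    have d2: "((\<lambda>y. y ^ m) has_real_derivative real m * x ^ (m - 1)) (at x)"
      by (auto intro!: derivative_eq_intros)
    have eq: "(exp (- (1 / x)) / x ^ 2 * x ^ m - exp (- (1 / x)) * (real m * x ^ (m - 1))) / (x ^ m * x ^ m)
       = flat_exp (m + 2) x + (- real m) * flat_exp (m + 1) x"
      using 1 by (cases m) (simp_all add: flat_exp_def divide_simps, simp_all add: algebra_simps power2_eq_square)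
    have "((\<lambda>y. exp (- (1 / y)) / y ^ m) has_real_derivative flat_exp (m + 2) x + (- real m) * flat_exp (m + 1) x) (at x)"
      using DERIV_divide[OF d1 d2] 1 unfolding eq by simp
    then show ?thesis using ev by (subst DERIV_cong_ev[OF refl _ refl]) auto
  next
    case 2
    have "eventually (\<lambda>y. y \<in> {..<0}) (nhds x)"
      using 2 by (intro eventually_nhds_in_open) auto
    then have "eventually (\<lambda>y. flat_exp m y = 0) (nhds x)"
      by eventually_elim (auto simp: flat_exp_def)
    then show ?thesis using 2 by (subst DERIV_cong_ev[of x x _ "\<lambda>_. 0" _ 0]) (auto simp: flat_exp_def)
  next
    case 3
    have "((\<lambda>y. (flat_exp m y - flat_exp m 0) / (y - 0)) \<longlongrightarrow> 0) (at 0)"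
      by (rule Lim_transform_eventually[OF flat_exp_tendsto_0[of "Suc m"]])
         (auto simp: eventually_at_filter flat_exp_def)
    then show ?thesis using 3 by (simp add: has_field_derivative_iff flat_exp_def)
  qed
qed

lemma smooth_flat_exp: "smooth (flat_exp m)"
proof -
  have "smooth_upto k (flat_exp m)" for k m
  proof (induction k arbitrary: m)
    case (Suc k)
    then have "smooth_upto k (\<lambda>x. flat_exp (m + 2) x + (- real m) * flat_exp (m + 1) x)"
      by (intro smooth_upto_add smooth_upto_mult smooth_upto_const Suc.IH)
    moreover have "\<forall>x. (flat_exp m has_real_derivative flat_exp (m + 2) x + (- real m) * flat_exp (m + 1) x) (at x)"
      using flat_exp_deriv by blast
    ultimately show ?case
      unfolding smooth_upto.simps
      by (intro exI[of _ "\<lambda>x. flat_exp (m + 2) x + (- real m) * flat_exp (m + 1) x"]) blast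
  qed simp
  then show ?thesis by (simp add: smooth_def)
qed

lemma continuous_has_antiderivative:
  fixes f :: "real \<Rightarrow> real"
  assumes "continuous_on UNIV f"
  obtains F where "\<And>x. (F has_real_derivative f x) (at x)"
proof -
  have "isCont f x" for x using assms by (simp add: continuous_on_eq_continuous_at)
  then have "\<exists>F. \<forall>x::real. (F has_vector_derivative f x) (at x)"
    using einterval_antiderivative[of "-\<infinity>" "\<infinity>" f] by simp
  then show ?thesis using that by (auto simp: has_real_derivative_iff_has_vector_derivative)
qed

text \<open>A smooth radial regularization of \<open>ln \<bar>z\<bar>\<^sup>2\<close>, written in \<open>t = \<bar>z\<bar>\<^sup>2\<close>: the function
  \<open>\<beta> = (t E')'\<close> is its \<open>\<partial>dbar\<close>, and is a nonnegative kernel of mass one.\<close>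

locale log_kernel =
  fixes E E1 E2 \<beta> :: "real \<Rightarrow> real"
  assumes smooth_E: "smooth E"
    and DERIV_E: "\<And>t. (E has_real_derivative E1 t) (at t)"
    and DERIV_E1: "\<And>t. (E1 has_real_derivative E2 t) (at t)"
    and \<beta>_eq: "\<And>t. \<beta> t = E1 t + t * E2 t"
    and E_eq_ln: "\<And>t. 1 \<le> t \<Longrightarrow> E t = ln t"
    and E_min: "\<And>t. 0 \<le> t \<Longrightarrow> E 0 \<le> E t"
    and \<beta>_nonneg: "\<And>t. 0 \<le> \<beta> t"
    and \<beta>_support: "\<And>t. t \<le> 0 \<or> 1 \<le> t \<Longrightarrow> \<beta> t = 0"
    and smooth_\<beta>: "smooth \<beta>"
    and \<beta>_mass: "(\<integral>\<^sup>+t. ennreal (\<beta> t) \<partial>lborel) = 1"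

text \<open>Built backwards from the kernel. Let b be a bump of mass C on [1/2, 1] and B the
  antiderivative of b / C vanishing at 0. Then E' = B / t satisfies (t E')' = b / C, and B = 1
  beyond 1 leaves E' = 1 / t there. Since B is 0 up to 1/2, the division by t is harmless.\<close>

lemma log_kernel_exists: "\<exists>E E1 E2 \<beta>. log_kernel E E1 E2 \<beta>"
proof -
  define b where "b t = flat_exp 0 (1 * t + (- 1/2)) * flat_exp 0 ((-1) * t + 1)" for t
  have smb: "smooth b" unfolding b_def by (intro smooth_intros smooth_flat_exp)
  have b0: "b t = 0" if "t \<le> 1/2 \<or> 1 \<le> t" for t using that by (auto simp: b_def flat_exp_def)
  have bpos: "b t > 0" if "1/2 < t" "t < 1" for t using that by (auto simp: b_def flat_exp_def)
  have bnn: "b t \<ge> 0" for t by (auto simp: b_def flat_exp_def)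
  obtain B0 where B0: "\<And>x. (B0 has_real_derivative b x) (at x)"
    using continuous_has_antiderivative smooth_continuous[OF smb] by blast
  have mono: "B0 x \<le> B0 y" if "x \<le> y" for x y
    by (rule DERIV_nonneg_imp_nondecreasing[OF that]) (use B0 bnn in blast)
  have B0c: "B0 x = B0 y" if "(x \<le> 1/2 \<and> y \<le> 1/2) \<or> (1 \<le> x \<and> 1 \<le> y)" for x y
  proof -
    have "B0 x = B0 y" if "x \<le> y" "y \<le> 1/2 \<or> 1 \<le> x" for x y
    proof -
      have "B0 y \<le> B0 x"
        by (rule DERIV_nonpos_imp_nonincreasing[OF that(1)]) (use B0 b0 that in \<open>metis order.trans order.refl\<close>)
      then show ?thesis using mono[OF that(1)] by simp
    qed
    then show ?thesis using that by (metis linorder_le_cases)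
  qed
  define C where "C = B0 1 - B0 0"
  have "continuous_on {1/2..1} B0"
    using B0 by (meson DERIV_continuous_on has_field_derivative_at_within)
  then have "B0 (1/2) < B0 1"
    by (rule DERIV_pos_imp_increasing_open[of "1/2" 1, rotated 2]) (use B0 bpos in \<open>auto\<close>)
  then have C: "C > 0" using B0c[of 0 "1/2"] by (simp add: C_def)
  define B where "B t = (1 / C) * (B0 t + - B0 0)" for t
  have B: "(B has_real_derivative b t / C) (at t)" for t
    using DERIV_cmult[OF DERIV_add[OF B0[of t] DERIV_const[of "- B0 0"]], of "1 / C"] by (simp add: B_def[abs_def])
  have smbC: "smooth (\<lambda>t. b t / C)" using smooth_intros(3)[OF smooth_intros(1)[of "1/C"] smb] by simp
  then have smB: "smooth B" by (rule smooth_if_derivative[OF B])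
  have B0': "B t = 0" if "t \<le> 1/2" for t using B0c[of t 0] that by (simp add: B_def)
  have B1: "B t = 1" if "1 \<le> t" for t using B0c[of t 1] that C by (simp add: B_def C_def)
  have Bnn: "B t \<ge> 0" if "t \<ge> 0" for t using mono[OF that] C by (simp add: B_def)
  define E1 where "E1 t = B t / t" for t
  have smE1: "smooth E1"
    unfolding smooth_def
  proof
    fix k
    show "smooth_upto k E1"
      using smooth_upto_div_power[of k B "1/2" 1] smB B0' unfolding E1_def smooth_def by simp
  qed
  then obtain E2 where E2: "\<And>x. (E1 has_real_derivative E2 x) (at x)" "smooth E2"
    using smoothE by blast
  obtain Ea where Ea: "\<And>x. (Ea has_real_derivative E1 x) (at x)"
    using continuous_has_antiderivative smooth_continuous[OF smE1] by blast
  \<comment> \<open>The constant of integration is fixed by E 1 = 0 = ln 1.\<close>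
  define E where "E t = Ea t - Ea 1" for t
  have E: "(E has_real_derivative E1 x) (at x)" for x
    using DERIV_diff[OF Ea[of x] DERIV_const[of "Ea 1"]] by (simp add: E_def[abs_def])
  have smE: "smooth E" by (rule smooth_if_derivative[OF E smE1])
  have Eln: "E t = ln t" if "1 \<le> t" for t
  proof -
    have d: "((\<lambda>t. E t - ln t) has_real_derivative 0) (at x)" if "1 \<le> x" for x
    proof -
      have "((\<lambda>t. E t - ln t) has_real_derivative (E1 x - 1 / x)) (at x)"
        using DERIV_diff[OF E[of x] DERIV_ln_divide[of x]] that by simp
      then show ?thesis using that by (simp add: E1_def B1)
    qed
    have "E t - ln t = E 1 - ln 1"
      using DERIV_isconst2[of 1 "t + 1" "\<lambda>t. E t - ln t" t] that d
        DERIV_continuous_on[of "{1..t+1}" "\<lambda>t. E t - ln t" "\<lambda>_. 0"] has_field_derivative_at_within[OF d] by simp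
    then show ?thesis by (simp add: E_def)
  qed
  have Emono: "E 0 \<le> E t" if "0 \<le> t" for t
  proof (rule DERIV_nonneg_imp_nondecreasing[OF that])
    fix x :: real assume "0 \<le> x"
    then have "0 \<le> E1 x" using Bnn by (simp add: E1_def)
    then show "\<exists>y. (E has_real_derivative y) (at x) \<and> 0 \<le> y" using E by blast
  qed
  define \<beta> where "\<beta> t = E1 t + t * E2 t" for t
  have \<beta>b: "\<beta> t = b t / C" for t
  proof -
    have 1: "((\<lambda>t. t * E1 t) has_real_derivative \<beta> t) (at t)"
      using DERIV_mult[OF DERIV_ident E2(1)[of t]] by (simp add: \<beta>_def add.commute mult.commute)
    have "(\<lambda>t. t * E1 t) = B" using B0'[of 0] by (auto simp: E1_def)
    then show ?thesis using 1 B DERIV_unique by metis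
  qed
  have "(\<integral>\<^sup>+t. ennreal (\<beta> t) \<partial>lborel) = (\<integral>\<^sup>+t. ennreal (b t / C) * indicator {0..1} t \<partial>lborel)"
    using b0 by (intro nn_integral_cong) (auto simp: \<beta>b indicator_def)
  also have "\<dots> = ennreal (B 1 - B 0)"
  proof (rule nn_integral_FTC_Icc)
    show "(\<lambda>t. b t / C) \<in> borel_measurable borel"
      using smooth_continuous[OF smb, of UNIV] by (intro borel_measurable_continuous_onI continuous_intros) (use C in auto)
    show "(B has_real_derivative b x / C) (at x)" for x
      using B by blast
  qed (use bnn C in auto)
  also have "\<dots> = 1" using B1[of 1] B0'[of 0] by simp
  finally have int: "(\<integral>\<^sup>+t. ennreal (\<beta> t) \<partial>lborel) = 1" .
  have sm\<beta>: "smooth \<beta>" using smbC by (simp add: \<beta>b[abs_def])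
  have \<beta>0: "\<beta> t = 0" if "t \<le> 0 \<or> 1 \<le> t" for t
    using b0[of t] that by (auto simp: \<beta>b)
  have \<beta>nn: "0 \<le> \<beta> t" for t
    using bnn[of t] C by (simp add: \<beta>b)
  have "log_kernel E E1 E2 \<beta>"
    by (rule log_kernel.intro[OF smE E E2(1) \<beta>_def Eln Emono \<beta>nn \<beta>0 sm\<beta> int])
  then show ?thesis by blast
qed

section \<open>Circle means and averages over polydiscs\<close>

text \<open>Checked on boxes, which determine Lebesgue measure. It opens both iterated integrals, in
  which a shear is a translation of one real variable.\<close>

lemma lborel_complex_eq:
  "(lborel :: complex measure) = distr (lborel \<Otimes>\<^sub>M lborel) borel (\<lambda>(x, y). Complex x y)"
proof (rule lborel_eqI)
  have meas: "(\<lambda>(x, y). Complex x y) \<in> borel_measurable (lborel \<Otimes>\<^sub>M lborel)"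
    unfolding lborel_prod by (simp add: case_prod_beta' borel_measurable_continuous_onI continuous_intros)
  fix l u :: complex assume le: "\<And>b. b \<in> Basis \<Longrightarrow> l \<bullet> b \<le> u \<bullet> b"
  have "(\<lambda>(x, y). Complex x y) -` box l u = {Re l<..<Re u} \<times> {Im l<..<Im u}"
    by (auto simp: in_box_complex_iff)
  then show "emeasure (distr (lborel \<Otimes>\<^sub>M lborel) borel (\<lambda>(x, y). Complex x y)) (box l u) = (\<Prod>b\<in>Basis. (u - l) \<bullet> b)"
    using le[of 1] le[of \<i>] meas
    by (simp add: emeasure_distr space_pair_measure lborel.emeasure_pair_measure_Times Basis_complex_def
        ennreal_mult inner_complex_def)
qed simp

lemma
  fixes f :: "complex \<Rightarrow> ennreal"
  assumes [measurable]: "f \<in> borel_measurable borel"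
  shows nn_integral_complex_xy: "(\<integral>\<^sup>+z. f z \<partial>lborel) = (\<integral>\<^sup>+x. \<integral>\<^sup>+y. f (Complex x y) \<partial>lborel \<partial>lborel)"
    and nn_integral_complex_yx: "(\<integral>\<^sup>+z. f z \<partial>lborel) = (\<integral>\<^sup>+y. \<integral>\<^sup>+x. f (Complex x y) \<partial>lborel \<partial>lborel)"
proof -
  have meas [measurable]: "(\<lambda>(x, y). Complex x y) \<in> borel_measurable (lborel \<Otimes>\<^sub>M lborel)"
    unfolding lborel_prod by (simp add: case_prod_beta' borel_measurable_continuous_onI continuous_intros)
  have meas2: "(\<lambda>p. f (case p of (x, y) \<Rightarrow> Complex x y)) \<in> borel_measurable (lborel \<Otimes>\<^sub>M lborel)"
    by measurable
  have *: "(\<integral>\<^sup>+z. f z \<partial>lborel) = (\<integral>\<^sup>+p. f (case p of (x, y) \<Rightarrow> Complex x y) \<partial>(lborel \<Otimes>\<^sub>M lborel))"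
    by (subst lborel_complex_eq, subst nn_integral_distr) auto
  show "(\<integral>\<^sup>+z. f z \<partial>lborel) = (\<integral>\<^sup>+x. \<integral>\<^sup>+y. f (Complex x y) \<partial>lborel \<partial>lborel)"
    unfolding * lborel.nn_integral_fst[OF meas2, symmetric] by simp
  show "(\<integral>\<^sup>+z. f z \<partial>lborel) = (\<integral>\<^sup>+y. \<integral>\<^sup>+x. f (Complex x y) \<partial>lborel \<partial>lborel)"
    unfolding * lborel_pair.nn_integral_snd[OF meas2, symmetric] by simp
qed

lemma measurable_Complex_affine [measurable]:
  fixes f :: "complex \<Rightarrow> ennreal"
  assumes [measurable]: "f \<in> borel_measurable borel"
  shows "(\<lambda>x. f (Complex x y)) \<in> borel_measurable borel" "(\<lambda>y. f (Complex x y)) \<in> borel_measurable borel"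
proof -
  have "(\<lambda>x. Complex x y) \<in> borel_measurable borel" "(\<lambda>y. Complex x y) \<in> borel_measurable borel"
    by (simp_all add: borel_measurable_continuous_onI continuous_intros)
  then show "(\<lambda>x. f (Complex x y)) \<in> borel_measurable borel" "(\<lambda>y. f (Complex x y)) \<in> borel_measurable borel"
    by measurable
qed

lemma nn_integral_shear_x:
  fixes f :: "complex \<Rightarrow> ennreal"
  assumes [measurable]: "f \<in> borel_measurable borel"
  shows "(\<integral>\<^sup>+z. f (Complex (Re z + a * Im z) (Im z)) \<partial>lborel) = (\<integral>\<^sup>+z. f z \<partial>lborel)"
proof -
  have [measurable]: "(\<lambda>z. Complex (Re z + a * Im z) (Im z)) \<in> borel_measurable borel"
    by (simp add: borel_measurable_continuous_onI continuous_intros)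
  have "(\<integral>\<^sup>+z. f (Complex (Re z + a * Im z) (Im z)) \<partial>lborel)
      = (\<integral>\<^sup>+y. \<integral>\<^sup>+x. f (Complex (a * y + 1 * x) y) \<partial>lborel \<partial>lborel)"
    by (subst nn_integral_complex_yx) (auto simp: add.commute)
  also have "\<dots> = (\<integral>\<^sup>+y. \<integral>\<^sup>+x. f (Complex x y) \<partial>lborel \<partial>lborel)"
    using nn_integral_real_affine[of "\<lambda>x. f (Complex x y)" 1 "a * y" for y] by simp
  also have "\<dots> = (\<integral>\<^sup>+z. f z \<partial>lborel)"
    by (rule nn_integral_complex_yx[symmetric]) simp
  finally show ?thesis .
qed

lemma nn_integral_shear_y:
  fixes f :: "complex \<Rightarrow> ennreal"
  assumes [measurable]: "f \<in> borel_measurable borel"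
  shows "(\<integral>\<^sup>+z. f (Complex (Re z) (Im z + a * Re z)) \<partial>lborel) = (\<integral>\<^sup>+z. f z \<partial>lborel)"
proof -
  have [measurable]: "(\<lambda>z. Complex (Re z) (Im z + a * Re z)) \<in> borel_measurable borel"
    by (simp add: borel_measurable_continuous_onI continuous_intros)
  have "(\<integral>\<^sup>+z. f (Complex (Re z) (Im z + a * Re z)) \<partial>lborel)
      = (\<integral>\<^sup>+x. \<integral>\<^sup>+y. f (Complex x (a * x + 1 * y)) \<partial>lborel \<partial>lborel)"
    by (subst nn_integral_complex_xy) (auto simp: add.commute)
  also have "\<dots> = (\<integral>\<^sup>+x. \<integral>\<^sup>+y. f (Complex x y) \<partial>lborel \<partial>lborel)"
    using nn_integral_real_affine[of "\<lambda>y. f (Complex x y)" 1 "a * x" for x] by simp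
  also have "\<dots> = (\<integral>\<^sup>+z. f z \<partial>lborel)"
    by (rule nn_integral_complex_xy[symmetric]) simp
  finally show ?thesis .
qed

text \<open>A rotation by an angle other than \<open>\<pi>\<close> is a product of three shears.\<close>

lemma nn_integral_rotation:
  fixes f :: "complex \<Rightarrow> ennreal"
  assumes f [measurable]: "f \<in> borel_measurable borel" and c: "cmod c = 1"
  shows "(\<integral>\<^sup>+z. f (c * z) \<partial>lborel) = (\<integral>\<^sup>+z. f z \<partial>lborel)"
proof -
  have rot: "(\<integral>\<^sup>+z. g (d * z) \<partial>lborel) = (\<integral>\<^sup>+z. g z \<partial>lborel)"
    if g [measurable]: "g \<in> borel_measurable borel" and d: "cmod d = 1" "Re d \<ge> 0" for g :: "complex \<Rightarrow> ennreal" and d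
  proof -
    \<comment> \<open>For d = cis a this is - tan (a / 2), the coefficient of the two outer shears;
      the middle one has coefficient sin a. The condition Re d \<ge> 0 keeps the denominator
      positive.\<close>
    define t where "t = - (Im d / (1 + Re d))"
    define S1 where "S1 z = Complex (Re z + t * Im z) (Im z)" for z
    define S2 where "S2 z = Complex (Re z) (Im z + Im d * Re z)" for z
    have [measurable]: "S1 \<in> borel_measurable borel" "S2 \<in> borel_measurable borel"
      unfolding S1_def S2_def by (simp_all add: borel_measurable_continuous_onI continuous_intros)
    have sq: "(Re d)\<^sup>2 + (Im d)\<^sup>2 = 1" using d by (simp add: cmod_def)
    have ne: "1 + Re d \<noteq> 0" using d by linarith
    have t1: "t * (1 + Re d) = - Im d" using ne by (simp add: t_def)
    have "t * Im d * (1 + Re d) = - (Im d)\<^sup>2" using t1 by (metis mult.assoc mult.commute mult_minus_left power2_eq_square)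
    also have "\<dots> = (Re d - 1) * (1 + Re d)" using sq by (simp add: algebra_simps power2_eq_square)
    finally have t2: "t * Im d = Re d - 1" using ne by simp
    have "S1 (S2 (S1 z)) = d * z" for z
    proof (rule complex_eqI)
      show im: "Im (S1 (S2 (S1 z))) = Im (d * z)"
      proof -
        have "Im (S1 (S2 (S1 z))) = Im d * Re z + (1 + t * Im d) * Im z"
          by (simp add: S1_def S2_def algebra_simps)
        then show ?thesis by (simp add: t2)
      qed
      have "Re (S1 (S2 (S1 z))) = (1 + t * Im d) * Re z + (t + t * (1 + t * Im d)) * Im z"
        by (simp add: S1_def S2_def algebra_simps)
      also have "\<dots> = Re d * Re z + (t * (1 + Re d)) * Im z" by (simp add: t2 algebra_simps)
      finally show "Re (S1 (S2 (S1 z))) = Re (d * z)" by (simp add: t1)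
    qed
    then have "(\<integral>\<^sup>+z. g (d * z) \<partial>lborel) = (\<integral>\<^sup>+z. g (S1 (S2 (S1 z))) \<partial>lborel)" by simp
    also have "\<dots> = (\<integral>\<^sup>+z. g (S1 (S2 z)) \<partial>lborel)"
      unfolding S1_def[of "_::complex"] by (rule nn_integral_shear_x[of "\<lambda>z. g (S1 (S2 z))", unfolded S1_def]) (simp add: S1_def[symmetric])
    also have "\<dots> = (\<integral>\<^sup>+z. g (S1 z) \<partial>lborel)"
      unfolding S2_def by (rule nn_integral_shear_y[of "\<lambda>z. g (S1 z)"]) measurable
    also have "\<dots> = (\<integral>\<^sup>+z. g z \<partial>lborel)"
      unfolding S1_def by (rule nn_integral_shear_x) measurable
    finally show ?thesis .
  qed
  \<comment> \<open>The principal square root has nonnegative real part, so rotation by c is two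
    admissible rotations by d, also for c = -1.\<close>
  define d where "d = csqrt c"
  have d: "d * d = c" by (simp add: d_def flip: power2_eq_square)
  have "cmod d ^ 2 = 1" using c d by (metis norm_mult power2_eq_square)
  then have dn: "cmod d = 1" by (metis norm_ge_zero one_power2 power2_eq_imp_eq zero_le_one)
  have dr: "Re d \<ge> 0" using Re_csqrt d_def by blast
  have "(\<integral>\<^sup>+z. f (c * z) \<partial>lborel) = (\<integral>\<^sup>+z. f (d * (d * z)) \<partial>lborel)"
    by (simp add: d[symmetric] mult.assoc)
  also have "\<dots> = (\<integral>\<^sup>+z. f (d * z) \<partial>lborel)"
    by (rule rot[of "\<lambda>z. f (d * z)"]) (use dn dr in auto)
  also have "\<dots> = (\<integral>\<^sup>+z. f z \<partial>lborel)" by (rule rot) (use dn dr in auto)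
  finally show ?thesis .
qed

text \<open>A disc of squared radius t has area \<pi> t, so the squared modulus is distributed with
  density \<pi> on the half line. The sign is reversed in the proof because measures are compared
  there on upper rays, which must have finite measure.\<close>

lemma nn_integral_radial:
  fixes \<kappa> :: "real \<Rightarrow> ennreal"
  assumes [measurable]: "\<kappa> \<in> borel_measurable borel"
  shows "(\<integral>\<^sup>+z. \<kappa> ((cmod z)\<^sup>2) \<partial>lborel) = ennreal pi * (\<integral>\<^sup>+t. \<kappa> t * indicator {0..} t \<partial>lborel)"
proof -
  let ?M = "distr lborel borel (\<lambda>z::complex. - (cmod z)\<^sup>2)"
  let ?N = "density lborel (\<lambda>t. ennreal pi * indicator {..(0::real)} t)"
  have "?M = ?N"
  proof (rule measure_eqI_lessThan)
    fix x :: real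
    have M: "emeasure ?M {x<..} = ennreal (pi * max 0 (- x))"
    proof (cases "x < 0")
      case True
      have "(\<lambda>z. - (cmod z)\<^sup>2) -` {x<..} = ball 0 (sqrt (- x))"
      proof -
        have "x < - (cmod z)\<^sup>2 \<longleftrightarrow> cmod z < sqrt (- x)" for z
          using real_less_rsqrt[of "cmod z" "-x"] real_sqrt_less_iff[of "(cmod z)\<^sup>2" "- x"] by auto
        then show ?thesis by auto
      qed
      then have "emeasure ?M {x<..} = emeasure lborel (ball (0::complex) (sqrt (- x)))"
        by (simp add: emeasure_distr)
      also have "\<dots> = ennreal (pi * (- x))"
        using True by (simp add: emeasure_ball DIM_complex unit_ball_vol_2)
      finally show ?thesis using True by simp
    next
      case False
      have "(\<lambda>z. - (cmod z)\<^sup>2) -` {x<..} = {}" using False by (auto dest: order.strict_trans2[where c = 0])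
      then show ?thesis using False by (simp add: emeasure_distr)
    qed
    have "emeasure ?N {x<..} = (\<integral>\<^sup>+t. ennreal pi * indicator {x<..0} t \<partial>lborel)"
      by (subst emeasure_density) (auto intro!: nn_integral_cong simp: indicator_def)
    also have "\<dots> = ennreal (pi * max 0 (- x))"
      by (cases "x < 0") (simp_all add: nn_integral_cmult ennreal_mult'[symmetric])
    finally have N: "emeasure ?N {x<..} = ennreal (pi * max 0 (- x))" .
    show "emeasure ?M {x<..} < \<infinity>" "emeasure ?M {x<..} = emeasure ?N {x<..}" using M N by auto
  qed auto
  have "(\<integral>\<^sup>+z. \<kappa> ((cmod z)\<^sup>2) \<partial>lborel) = (\<integral>\<^sup>+s. \<kappa> (- s) \<partial>?M)"
    by (simp add: nn_integral_distr)
  also have "\<dots> = (\<integral>\<^sup>+s. ennreal pi * indicator {..0} s * \<kappa> (- s) \<partial>lborel)"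
    unfolding \<open>?M = ?N\<close> by (simp add: nn_integral_density)
  also have "\<dots> = (\<integral>\<^sup>+s. ennreal pi * (indicator {..0} (0 + (-1) * s) * \<kappa> (- (0 + (-1) * s))) \<partial>lborel)"
    by (subst nn_integral_real_affine[where c = "-1" and t = 0]) (auto simp: mult.assoc)
  also have "\<dots> = ennreal pi * (\<integral>\<^sup>+t. \<kappa> t * indicator {0..} t \<partial>lborel)"
    by (subst nn_integral_cmult[symmetric]) (auto intro!: nn_integral_cong simp: indicator_def)
  finally show ?thesis .
qed

section \<open>Topology and measurable sets of the product space\<close>

lemma space_vol: "space (vol I) = extensional I"
  by (auto simp: vol_def space_PiM PiE_def)

lemma topspace_Cn: "topspace (Cn n) = extensional {..<n}"
  by (auto simp: Cn_def PiE_def)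

lemma sets_vol_cong: "sets (vol I) = sets (Pi\<^sub>M I (\<lambda>_. borel))"
  unfolding vol_def by (rule sets_PiM_cong) auto

interpretation vol: product_sigma_finite "\<lambda>_::nat. lborel :: complex measure"
  by standard

lemma openin_Cn_box:
  assumes "openin (Cn n) W" "w \<in> W"
  obtains U where "\<And>j. j < n \<Longrightarrow> open (U j)" "w \<in> PiE {..<n} U" "PiE {..<n} U \<subseteq> W"
proof -
  have "\<exists>U. (\<forall>j\<in>{..<n}. open (U j)) \<and> w \<in> PiE {..<n} U \<and> PiE {..<n} U \<subseteq> W"
    using assms unfolding Cn_def openin_product_topology_alt by (auto simp: open_openin[symmetric])
  then show ?thesis using that by (metis lessThan_iff)
qed

lemma openin_Cn_PiE: "(\<And>j. j < n \<Longrightarrow> open (U j)) \<Longrightarrow> openin (Cn n) (PiE {..<n} U)"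
  unfolding Cn_def by (subst openin_PiE_gen) (auto simp: open_openin[symmetric])

text \<open>The product sigma-algebra knows only finite products of Borel sets; an open set is a
  countable union of such boxes over a countable basis of the plane.\<close>

lemma openin_Cn_sets:
  assumes W: "openin (Cn n) W"
  shows "W \<in> sets (vol {..<n})"
proof -
  obtain B :: "complex set set" where B: "countable B" "topological_basis B"
    using ex_countable_basis by blast
  define \<B> where "\<B> = {PiE {..<n} b |b. b \<in> PiE {..<n} (\<lambda>_. B) \<and> PiE {..<n} b \<subseteq> W}"
  have "countable (PiE {..<n} (\<lambda>_. B))" using B by (intro countable_PiE) auto
  then have "countable (PiE {..<n} ` (PiE {..<n} (\<lambda>_. B)))" by blast
  then have cB: "countable \<B>" by (rule countable_subset[rotated]) (auto simp: \<B>_def)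
  have "W = \<Union>\<B>"
  proof
    show "W \<subseteq> \<Union>\<B>"
    proof
      fix w assume "w \<in> W"
      then obtain U where U: "\<And>j. j < n \<Longrightarrow> open (U j)" "w \<in> PiE {..<n} U" "PiE {..<n} U \<subseteq> W"
        using W openin_Cn_box by metis
      have "\<exists>b. b \<in> B \<and> w j \<in> b \<and> b \<subseteq> U j" if "j < n" for j
      proof -
        have "w j \<in> U j" using U(2) that by auto
        then show ?thesis using topological_basisE[OF B(2) U(1)[OF that]] by metis
      qed
      then obtain b where b: "\<And>j. j < n \<Longrightarrow> b j \<in> B \<and> w j \<in> b j \<and> b j \<subseteq> U j" by metis
      have "PiE {..<n} (restrict b {..<n}) = PiE {..<n} b" by (rule PiE_cong) auto
      moreover have "PiE {..<n} b \<subseteq> PiE {..<n} U" using b by (intro PiE_mono) auto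
      ultimately have "PiE {..<n} b \<in> \<B>"
        unfolding \<B>_def using b U(3) by (intro CollectI exI[of _ "restrict b {..<n}"]) auto
      moreover have "w \<in> PiE {..<n} b" using b U(2) by (auto simp: PiE_def)
      ultimately show "w \<in> \<Union>\<B>" by blast
    qed
  qed (auto simp: \<B>_def)
  moreover have "S \<in> sets (vol {..<n})" if "S \<in> \<B>" for S
  proof -
    from that obtain b where b: "S = PiE {..<n} b" "b \<in> PiE {..<n} (\<lambda>_. B)" by (auto simp: \<B>_def)
    have "b j \<in> sets borel" if "j < n" for j
      using b(2) B(2) that by (auto intro!: borel_open topological_basis_open)
    then show ?thesis unfolding b(1) sets_vol_cong by (intro sets_PiM_I_finite) auto
  qed
  ultimately show ?thesis using cB by (metis sets.countable_Union subsetI)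
qed

lemma measurable_fun_upd_vol:
  assumes "w \<in> extensional {..<n}" "j < n"
  shows "(\<lambda>y. w(j := y)) \<in> borel \<rightarrow>\<^sub>M vol {..<n}"
proof -
  have "(\<lambda>y. \<lambda>i\<in>{..<n}. if i = j then y else w i) \<in> borel \<rightarrow>\<^sub>M vol {..<n}"
    unfolding vol_def by (rule measurable_restrict) auto
  moreover have "(\<lambda>i\<in>{..<n}. if i = j then y else w i) = w(j := y)" for y
    using assms by (auto simp: extensional_def fun_eq_iff)
  ultimately show ?thesis by simp
qed

text \<open>Averaging over all rotations about \<open>a\<close> turns circle means into disc means without polar coordinates.\<close>

lemma supermean_disc:
  fixes H :: "complex \<Rightarrow> ennreal" and \<kappa> :: "real \<Rightarrow> ennreal"
  assumes H [measurable]: "H \<in> borel_measurable borel" and \<kappa> [measurable]: "\<kappa> \<in> borel_measurable borel"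
    and supp: "\<And>t. \<rho>\<^sup>2 < t \<Longrightarrow> \<kappa> t = 0" and "\<rho> > 0"
    and mean: "\<And>v. cmod v \<le> \<rho> \<Longrightarrow> (\<integral>\<^sup>+\<theta>\<in>{0..2*pi}. H (a + cis \<theta> * v) \<partial>lborel) \<le> ennreal (2 * pi) * H a"
  shows "(\<integral>\<^sup>+y. \<kappa> ((cmod (y - a))\<^sup>2) * H y \<partial>lborel) \<le> (\<integral>\<^sup>+z. \<kappa> ((cmod z)\<^sup>2) \<partial>lborel) * H a"
proof -
  let ?I = "\<integral>\<^sup>+y. \<kappa> ((cmod (y - a))\<^sup>2) * H y \<partial>lborel"
  \<comment> \<open>Translation to a and rotation by \<theta>: the kernel depends on the modulus
    alone, so the integral is the same for every angle.\<close>
  have I: "?I = (\<integral>\<^sup>+z. \<kappa> ((cmod z)\<^sup>2) * H (a + cis \<theta> * z) \<partial>lborel)" for \<theta>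
  proof -
    have "?I = (\<integral>\<^sup>+z. \<kappa> ((cmod z)\<^sup>2) * H (a + z) \<partial>lborel)"
      by (subst (1) lborel_distr_plus[of a, symmetric]) (subst nn_integral_distr, auto)
    also have "\<dots> = (\<integral>\<^sup>+z. \<kappa> ((cmod (cis \<theta> * z))\<^sup>2) * H (a + cis \<theta> * z) \<partial>lborel)"
      by (rule nn_integral_rotation[of "\<lambda>z. \<kappa> ((cmod z)\<^sup>2) * H (a + z)", symmetric]) auto
    finally show ?thesis by (simp add: norm_mult)
  qed
  have "(\<lambda>p. cis (fst p) * snd p) \<in> borel_measurable (borel :: (real \<times> complex) measure)"
    by (intro borel_measurable_continuous_onI continuous_intros)
  then have cm: "(\<lambda>p::real \<times> complex. a + cis (fst p) * snd p) \<in> borel_measurable (lborel \<Otimes>\<^sub>M lborel)"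
    unfolding lborel_prod by simp
  \<comment> \<open>Integrating over \<theta> and exchanging the integrals leaves, for fixed z, the
    integral of H over the circle through a + z about a.\<close>
  have "ennreal (2 * pi) * ?I = (\<integral>\<^sup>+\<theta>\<in>{0..2*pi}. ?I \<partial>lborel)"
    by (subst nn_integral_cmult_indicator) (auto simp: mult.commute)
  also have "\<dots> = (\<integral>\<^sup>+\<theta>. \<integral>\<^sup>+z. \<kappa> ((cmod z)\<^sup>2) * (H (a + cis \<theta> * z) * indicator {0..2*pi} \<theta>) \<partial>lborel \<partial>lborel)"
    by (intro nn_integral_cong) (auto simp: I[symmetric] indicator_def I)
  also have "\<dots> = (\<integral>\<^sup>+z. \<integral>\<^sup>+\<theta>. \<kappa> ((cmod z)\<^sup>2) * (H (a + cis \<theta> * z) * indicator {0..2*pi} \<theta>) \<partial>lborel \<partial>lborel)"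
  proof (rule lborel_pair.Fubini'[symmetric])
    have "(\<lambda>p. H (a + cis (fst p) * snd p)) \<in> borel_measurable (lborel \<Otimes>\<^sub>M lborel)"
      using measurable_compose[OF cm H] .
    then show "(\<lambda>(\<theta>, z). \<kappa> ((cmod z)\<^sup>2) * (H (a + cis \<theta> * z) * indicator {0..2*pi} \<theta>))
        \<in> borel_measurable (lborel \<Otimes>\<^sub>M lborel)"
      by (simp add: case_prod_beta')
  qed
  also have "\<dots> \<le> (\<integral>\<^sup>+z. \<kappa> ((cmod z)\<^sup>2) * (ennreal (2 * pi) * H a) \<partial>lborel)"
  proof (rule nn_integral_mono)
    fix z :: complex
    have [measurable]: "(\<lambda>\<theta>. cis \<theta> * z) \<in> borel_measurable borel"
      by (intro borel_measurable_continuous_onI continuous_intros)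
    have "(\<integral>\<^sup>+\<theta>. \<kappa> ((cmod z)\<^sup>2) * (H (a + cis \<theta> * z) * indicator {0..2*pi} \<theta>) \<partial>lborel)
        = \<kappa> ((cmod z)\<^sup>2) * (\<integral>\<^sup>+\<theta>\<in>{0..2*pi}. H (a + cis \<theta> * z) \<partial>lborel)"
      by (rule nn_integral_cmult) measurable
    also have "\<dots> \<le> \<kappa> ((cmod z)\<^sup>2) * (ennreal (2 * pi) * H a)"
    proof (cases "cmod z \<le> \<rho>")
      case True
      then show ?thesis using mean by (intro mult_left_mono) auto
    next
      case False
      then have "\<kappa> ((cmod z)\<^sup>2) = 0" using supp \<open>\<rho> > 0\<close> by (intro supp power_strict_mono) auto
      then show ?thesis by simp
    qed
    finally show "(\<integral>\<^sup>+\<theta>. \<kappa> ((cmod z)\<^sup>2) * (H (a + cis \<theta> * z) * indicator {0..2*pi} \<theta>) \<partial>lborel)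
       \<le> \<kappa> ((cmod z)\<^sup>2) * (ennreal (2 * pi) * H a)" .
  qed
  also have "\<dots> = ennreal (2 * pi) * ((\<integral>\<^sup>+z. \<kappa> ((cmod z)\<^sup>2) \<partial>lborel) * H a)"
    by (subst nn_integral_multc) (auto simp: ac_simps)
  finally show ?thesis
    by (subst (asm) ennreal_mult_le_mult_iff) (auto simp: ennreal_zero_less_mult_iff)
qed

text \<open>The disc inequality is iterated, one coordinate at a time. In \<open>mean\<close> the
  averaged coordinate sits at the centre while the others are arbitrary in the polydisc, because
  outer integration variables are frozen at arbitrary values when an inner one is treated.\<close>

lemma supermean_polydisc:
  fixes H :: "(nat \<Rightarrow> complex) \<Rightarrow> ennreal" and \<kappa> :: "real \<Rightarrow> ennreal"
  assumes H [measurable]: "H \<in> borel_measurable (vol {..<n})" and \<kappa> [measurable]: "\<kappa> \<in> borel_measurable borel"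
    and supp: "\<And>t. \<rho>\<^sup>2 < t \<Longrightarrow> \<kappa> t = 0" and "\<rho> > 0" and \<zeta>: "\<zeta> \<in> topspace (Cn n)"
    and mean: "\<And>w j v. \<lbrakk>w \<in> topspace (Cn n); \<And>k. k < n \<Longrightarrow> cmod (w k - \<zeta> k) \<le> \<rho>; j < n; w j = \<zeta> j; cmod v \<le> \<rho>\<rbrakk> \<Longrightarrow>
      (\<integral>\<^sup>+\<theta>\<in>{0..2*pi}. H (w(j := w j + cis \<theta> * v)) \<partial>lborel) \<le> ennreal (2 * pi) * H w"
  shows "(\<integral>\<^sup>+w. (\<Prod>j<n. \<kappa> ((cmod (w j - \<zeta> j))\<^sup>2)) * H w \<partial>vol {..<n}) \<le> (\<integral>\<^sup>+z. \<kappa> ((cmod z)\<^sup>2) \<partial>lborel) ^ n * H \<zeta>"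
proof -
  define m where "m = (\<integral>\<^sup>+z. \<kappa> ((cmod z)\<^sup>2) \<partial>lborel)"
  \<comment> \<open>Coordinates in I are integration variables, the others are frozen at w.\<close>
  define mix where "mix I v w = (\<lambda>i\<in>{..<n}. if i \<in> I then v i else w i)" for I and v w :: "nat \<Rightarrow> complex"
  have mixmeas: "(\<lambda>v. mix I v w) \<in> vol I \<rightarrow>\<^sub>M vol {..<n}" for I w
    unfolding mix_def vol_def
  proof (rule measurable_restrict)
    fix i
    show "(\<lambda>v. if i \<in> I then v i else w i) \<in> Pi\<^sub>M I (\<lambda>_. lborel) \<rightarrow>\<^sub>M lborel"
      by (cases "i \<in> I") auto
  qed
  have *: "(\<integral>\<^sup>+v. (\<Prod>j\<in>I. \<kappa> ((cmod (v j - \<zeta> j))\<^sup>2)) * H (mix I v w) \<partial>vol I) \<le> m ^ card I * H w"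
    if "finite I" "I \<subseteq> {..<n}" "w \<in> topspace (Cn n)" "\<And>k. k < n \<Longrightarrow> cmod (w k - \<zeta> k) \<le> \<rho>" "\<And>k. k \<in> I \<Longrightarrow> w k = \<zeta> k" for I w
    using that
  proof (induction I arbitrary: w rule: finite_induct)
    case empty
    then have "mix {} v w = w" for v by (auto simp: mix_def topspace_Cn extensional_def fun_eq_iff)
    then show ?case using vol.emeasure_PiM[of "{}" "\<lambda>_. {}"] by (simp add: vol_def space_PiM)
  next
    case (insert i I)
    have wext: "w \<in> extensional {..<n}" using insert.prems by (simp add: topspace_Cn)
    have i: "i < n" using insert by auto
    have meas: "(\<lambda>v. mix J v w) \<in> vol J \<rightarrow>\<^sub>M vol {..<n}" for J
      by (rule mixmeas)
    have "(\<integral>\<^sup>+v. (\<Prod>j\<in>insert i I. \<kappa> ((cmod (v j - \<zeta> j))\<^sup>2)) * H (mix (insert i I) v w) \<partial>vol (insert i I))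
       = (\<integral>\<^sup>+y. \<integral>\<^sup>+v. (\<Prod>j\<in>insert i I. \<kappa> ((cmod ((v(i := y)) j - \<zeta> j))\<^sup>2)) * H (mix (insert i I) (v(i := y)) w) \<partial>vol I \<partial>lborel)"
      unfolding vol_def
    proof (rule vol.product_nn_integral_insert_rev)
      have "(\<lambda>v. \<kappa> ((cmod (v j - \<zeta> j))\<^sup>2)) \<in> borel_measurable (vol (insert i I))" if "j \<in> insert i I" for j
        unfolding vol_def using that by measurable
      moreover have "(\<lambda>v. H (mix (insert i I) v w)) \<in> borel_measurable (vol (insert i I))"
        using measurable_compose[OF meas H] insert.prems by simp
      ultimately show "(\<lambda>v. (\<Prod>j\<in>insert i I. \<kappa> ((cmod (v j - \<zeta> j))\<^sup>2)) * H (mix (insert i I) v w))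
         \<in> borel_measurable (Pi\<^sub>M (insert i I) (\<lambda>_. lborel))"
        unfolding vol_def by (intro borel_measurable_times_ennreal borel_measurable_prod_ennreal) auto
    qed (use insert in auto)
    also have "\<dots> = (\<integral>\<^sup>+y. \<integral>\<^sup>+v. \<kappa> ((cmod (y - \<zeta> i))\<^sup>2) * ((\<Prod>j\<in>I. \<kappa> ((cmod (v j - \<zeta> j))\<^sup>2)) * H (mix I v (w(i := y)))) \<partial>vol I \<partial>lborel)"
    proof (intro nn_integral_cong)
      fix y v
      have "mix (insert i I) (v(i := y)) w = mix I v (w(i := y))"
        using insert by (auto simp: mix_def fun_eq_iff)
      moreover have "(\<Prod>j\<in>I. \<kappa> ((cmod ((v(i := y)) j - \<zeta> j))\<^sup>2)) = (\<Prod>j\<in>I. \<kappa> ((cmod (v j - \<zeta> j))\<^sup>2))"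
        using insert by (intro prod.cong) auto
      ultimately show "(\<Prod>j\<in>insert i I. \<kappa> ((cmod ((v(i := y)) j - \<zeta> j))\<^sup>2)) * H (mix (insert i I) (v(i := y)) w)
          = \<kappa> ((cmod (y - \<zeta> i))\<^sup>2) * ((\<Prod>j\<in>I. \<kappa> ((cmod (v j - \<zeta> j))\<^sup>2)) * H (mix I v (w(i := y))))"
        using insert by (simp add: mult.assoc)
    qed
    also have "\<dots> \<le> (\<integral>\<^sup>+y. \<kappa> ((cmod (y - \<zeta> i))\<^sup>2) * (m ^ card I * H (w(i := y))) \<partial>lborel)"
    proof (rule nn_integral_mono)
      fix y :: complex
      let ?w = "w(i := y)"
      have [measurable]: "(\<lambda>v. mix I v ?w) \<in> vol I \<rightarrow>\<^sub>M vol {..<n}"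
        by (rule mixmeas)
      have m1: "(\<lambda>v. H (mix I v ?w)) \<in> borel_measurable (vol I)" by measurable
      have "(\<lambda>v. \<kappa> ((cmod (v j - \<zeta> j))\<^sup>2)) \<in> borel_measurable (vol I)" if "j \<in> I" for j
        unfolding vol_def using that by measurable
      then have m2: "(\<lambda>v. (\<Prod>j\<in>I. \<kappa> ((cmod (v j - \<zeta> j))\<^sup>2)) * H (mix I v ?w)) \<in> borel_measurable (vol I)"
        using m1 by (intro borel_measurable_times_ennreal borel_measurable_prod_ennreal) auto
      show "(\<integral>\<^sup>+v. \<kappa> ((cmod (y - \<zeta> i))\<^sup>2) * ((\<Prod>j\<in>I. \<kappa> ((cmod (v j - \<zeta> j))\<^sup>2)) * H (mix I v ?w)) \<partial>vol I)
        \<le> \<kappa> ((cmod (y - \<zeta> i))\<^sup>2) * (m ^ card I * H ?w)"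
      proof (cases "cmod (y - \<zeta> i) \<le> \<rho>")
        case True
        then have "(\<integral>\<^sup>+v. (\<Prod>j\<in>I. \<kappa> ((cmod (v j - \<zeta> j))\<^sup>2)) * H (mix I v ?w) \<partial>vol I) \<le> m ^ card I * H ?w"
          using insert.prems insert.hyps i wext by (intro insert.IH) (auto simp: topspace_Cn extensional_def)
        then show ?thesis by (subst nn_integral_cmult[OF m2]) (auto intro: mult_left_mono)
      next
        case False
        then have "\<kappa> ((cmod (y - \<zeta> i))\<^sup>2) = 0" using \<open>\<rho> > 0\<close> by (intro supp power_strict_mono) auto
        then show ?thesis by simp
      qed
    qed
    also have "\<dots> = m ^ card I * (\<integral>\<^sup>+y. \<kappa> ((cmod (y - w i))\<^sup>2) * H (w(i := y)) \<partial>lborel)"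
      using measurable_compose[OF measurable_fun_upd_vol[OF wext i] H] insert.prems(4)[of i]
      by (subst nn_integral_cmult[symmetric]) (auto intro!: nn_integral_cong simp: ac_simps)
    also have "\<dots> \<le> m ^ card I * (m * H (w(i := w i)))"
      unfolding m_def
    proof (intro mult_left_mono supermean_disc[OF _ \<kappa> supp \<open>\<rho> > 0\<close>, of "\<lambda>y. H (w(i := y))" "w i"])
      show "(\<lambda>y. H (w(i := y))) \<in> borel_measurable borel"
        using measurable_compose[OF measurable_fun_upd_vol[OF wext i] H] .
      fix v assume "cmod v \<le> \<rho>"
      then show "(\<integral>\<^sup>+\<theta>\<in>{0..2*pi}. H (w(i := w i + cis \<theta> * v)) \<partial>lborel) \<le> ennreal (2 * pi) * H (w(i := w i))"
        using mean[of w i v] insert.prems(2,3) insert.prems(4)[of i] i unfolding fun_upd_triv by auto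
    qed auto
    finally show ?case using insert.hyps by (simp add: ac_simps)
  qed
  have "mix {..<n} v \<zeta> = v" if "v \<in> space (vol {..<n})" for v
    using that by (auto simp: mix_def space_vol extensional_def fun_eq_iff)
  then have "(\<integral>\<^sup>+w. (\<Prod>j<n. \<kappa> ((cmod (w j - \<zeta> j))\<^sup>2)) * H w \<partial>vol {..<n})
     = (\<integral>\<^sup>+v. (\<Prod>j\<in>{..<n}. \<kappa> ((cmod (v j - \<zeta> j))\<^sup>2)) * H (mix {..<n} v \<zeta>) \<partial>vol {..<n})"
    by (intro nn_integral_cong) simp
  also have "\<dots> \<le> m ^ n * H \<zeta>"
    using *[of "{..<n}" \<zeta>] \<zeta> \<open>\<rho> > 0\<close> by simp
  finally show ?thesis by (simp add: m_def)
qed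

section \<open>Jensen's inequality\<close>

text \<open>Jensen's inequality, from the maximum principle for the product of the rotated functions
  \<open>f (\<omega>\<^sup>k z)\<close>, where \<open>\<omega>\<close> is a primitive \<open>N\<close>-th root of unity: the logarithm of that product is \<open>N\<close>
  times a Riemann sum of the circle mean of \<open>ln \<bar>f\<bar>\<close>.\<close>

lemma log_mean_continuous_bound:
  fixes f :: "complex \<Rightarrow> complex"
  assumes f: "f holomorphic_on S" "open S" "cball 0 1 \<subseteq> S" and f0: "f 0 \<noteq> 0" and "\<delta> > 0"
    and C: "\<And>\<theta>. max (cmod (f (cis \<theta>))) \<delta> \<le> exp C"
  shows "(\<integral>\<^sup>+\<theta>\<in>{0..2*pi}. ennreal (C - ln (max (cmod (f (cis \<theta>))) \<delta>)) \<partial>lborel) \<le> ennreal (2 * pi * (C - ln (cmod (f 0))))"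
proof -
  \<comment> \<open>Truncation at \<delta> makes the logarithm continuous on the circle, and uniform
    continuity then controls the Riemann sums from every starting angle. It only enlarges
    \<bar>f\<bar>, which is the right direction for an upper bound of ln \<bar>f 0\<bar>.\<close>
  define h where "h z = ln (max (cmod (f z)) \<delta>)" for z
  define g where "g \<theta> = h (cis \<theta>)" for \<theta>
  have conth: "continuous_on (sphere 0 1) h"
  proof -
    have "continuous_on (sphere 0 1) f"
      using f by (intro holomorphic_on_imp_continuous_on holomorphic_on_subset[OF f(1)]) auto
    then show ?thesis unfolding h_def using \<open>\<delta> > 0\<close>
      by (intro continuous_intros) auto
  qed
  have contg: "continuous_on UNIV g"
    unfolding g_def by (rule continuous_on_compose2[OF conth]) (auto intro!: continuous_intros)
  obtain G where G: "\<And>x. (G has_real_derivative g x) (at x)"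
    using continuous_has_antiderivative[OF contg] by blast
  have per: "g (x + 2 * pi) = g x" for x by (simp add: g_def flip: cis_mult)
  have Gper: "G (x + 2 * pi) - G x = G (2 * pi) - G 0" for x
  proof -
    have d: "((\<lambda>x. G (1 * x + 2 * pi) - G x) has_real_derivative 0) (at x)" for x
    proof -
      have "((\<lambda>x. G (x + 2 * pi)) has_real_derivative g (x + 2 * pi)) (at x)"
        using G[of "x + 2 * pi"] by (simp add: DERIV_shift)
      from DERIV_diff[OF this G[of x]] show ?thesis by (simp add: per)
    qed
    then have "(\<lambda>x. G (1 * x + 2 * pi) - G x) x = (\<lambda>x. G (1 * x + 2 * pi) - G x) 0"
      by (intro DERIV_isconst_all) blast
    then show ?thesis by simp
  qed
  have key: "2 * pi * ln (cmod (f 0)) \<le> G (2 * pi) - G 0 + 2 * pi * e" if "e > 0" for e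
  proof -
    have "uniformly_continuous_on (sphere 0 1) h"
      by (intro compact_uniformly_continuous conth compact_sphere)
    then obtain d where d: "d > 0" "\<And>x y. x \<in> sphere 0 1 \<Longrightarrow> y \<in> sphere 0 1 \<Longrightarrow> dist y x < d \<Longrightarrow> dist (h y) (h x) < e"
      using \<open>e > 0\<close> unfolding uniformly_continuous_on_def by metis
    obtain N :: nat where N: "2 * pi / d < real N" using reals_Archimedean2 by blast
    have Npos: "N > 0" using N d(1) by (intro gr0I) (use pi_gt_zero in \<open>auto simp: field_simps\<close>)
    define t where "t k = 2 * pi * real k / real N" for k
    define H where "H z = (\<Prod>k<N. f (cis (t k) * z))" for z
    have Hhol: "H holomorphic_on ball 0 1" and Hcont: "continuous_on (cball 0 1) H"
    proof -
      have im: "(\<lambda>z. cis (t k) * z) ` cball 0 1 \<subseteq> S" for k using f(3) by (auto simp: norm_mult)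
      have "(\<lambda>z. f (cis (t k) * z)) holomorphic_on ball 0 1" for k
        using im ball_subset_cball[of 0 1]
        by (intro holomorphic_on_compose_gen[OF _ f(1), unfolded o_def] holomorphic_intros) blast
      then show "H holomorphic_on ball 0 1" unfolding H_def by (intro holomorphic_intros)
      have "continuous_on (cball 0 1) (\<lambda>z. f (cis (t k) * z))" for k
        by (rule continuous_on_compose2[OF holomorphic_on_imp_continuous_on[OF f(1)] _ im]) (intro continuous_intros)
      then show "continuous_on (cball 0 1) H" unfolding H_def by (intro continuous_intros)
    qed
    have "continuous_on (sphere 0 1) (\<lambda>z. cmod (H z))"
      by (intro continuous_intros continuous_on_subset[OF Hcont]) auto
    moreover have "sphere (0::complex) 1 \<noteq> {}" by simp
    ultimately obtain z0 where z0: "z0 \<in> sphere 0 1" "\<And>z. z \<in> sphere 0 1 \<Longrightarrow> cmod (H z) \<le> cmod (H z0)"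
      using continuous_attains_sup[of "sphere (0::complex) 1" "\<lambda>z. cmod (H z)"] by auto
    have Hle: "cmod (H 0) \<le> cmod (H z0)"
      by (rule maximum_modulus_frontier[of H "cball 0 1"]) (use Hhol Hcont z0 in auto)
    \<comment> \<open>The sample points start at the angle of a maximum of \<bar>H\<bar> on the
      circle. This angle depends on N, hence the need for an estimate uniform in it.\<close>
    obtain x where x: "z0 = cis x"
      using z0(1) complex_unimodular_polar[of z0] by (auto simp: cis.code)
    have H0: "H 0 = f 0 ^ N" by (simp add: H_def)
    have "real N * ln (cmod (f 0)) = ln (cmod (H 0))"
      using f0 by (simp add: H0 norm_power ln_realpow)
    also have "\<dots> \<le> ln (\<Prod>k<N. max (cmod (f (cis (t k + x)))) \<delta>)"
    proof (rule ln_mono)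
      have "cmod (H z0) \<le> (\<Prod>k<N. max (cmod (f (cis (t k + x)))) \<delta>)"
        unfolding H_def x prod_norm[symmetric] by (intro prod_mono) (auto simp: cis_mult)
      then show "cmod (H 0) \<le> (\<Prod>k<N. max (cmod (f (cis (t k + x)))) \<delta>)" using Hle by linarith
      show "0 < cmod (H 0)" using f0 by (simp add: H0)
    qed
    also have "\<dots> = (\<Sum>k<N. g (t k + x))"
      using \<open>\<delta> > 0\<close> by (subst ln_prod) (auto simp: g_def h_def)
    \<comment> \<open>By the mean value theorem the average of g over the arc following a sample
      point is a value of g on that arc, so it is within e of the sample. Periodicity makes the arcs
      add up to the integral from 0 to 2\<pi>.\<close>
    also have "\<dots> \<le> (\<Sum>k<N. real N / (2 * pi) * (G (x + t (Suc k)) - G (x + t k)) + e)"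
    proof (rule sum_mono)
      fix k assume "k \<in> {..<N}"
      have lt: "x + t k < x + t (Suc k)" using Npos by (simp add: t_def divide_strict_right_mono)
      obtain \<xi> where \<xi>: "x + t k < \<xi>" "\<xi> < x + t (Suc k)"
        "G (x + t (Suc k)) - G (x + t k) = (x + t (Suc k) - (x + t k)) * g \<xi>"
        using MVT2[OF lt, of G g] G by blast
      have len: "t (Suc k) - t k = 2 * pi / real N" by (simp add: t_def field_simps add_divide_distrib)
      have "dist (cis (t k + x)) (cis \<xi>) \<le> \<bar>(t k + x) - \<xi>\<bar>"
      proof -
        have "dist (cis (t k + x)) (cis \<xi>) = cmod (cis \<xi> * (cis (t k + x - \<xi>) - 1))"
          by (simp add: dist_norm algebra_simps cis_mult)
        also have "\<dots> = cmod (exp (\<i> * complex_of_real (t k + x - \<xi>)) - 1)"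
          by (simp add: norm_mult cis_conv_exp)
        also have "\<dots> \<le> \<bar>t k + x - \<xi>\<bar>"
          using dist_exp_i_1[of "t k + x - \<xi>"] abs_sin_x_le_abs_x[of "(t k + x - \<xi>) / 2"] by simp
        finally show ?thesis .
      qed
      also have "\<dots> \<le> 2 * pi / real N" using \<xi> len by linarith
      also have "\<dots> < d" using N d(1) Npos by (simp add: field_simps)
      finally have "dist (g (t k + x)) (g \<xi>) < e"
        unfolding g_def by (intro d(2)) auto
      then have "g (t k + x) \<le> g \<xi> + e" by (simp add: dist_real_def abs_less_iff)
      also have "g \<xi> = real N / (2 * pi) * (G (x + t (Suc k)) - G (x + t k))"
        unfolding \<xi>(3) using len Npos by simp
      finally show "g (t k + x) \<le> real N / (2 * pi) * (G (x + t (Suc k)) - G (x + t k)) + e" .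
    qed
    also have "\<dots> = real N / (2 * pi) * (G (x + t N) - G (x + t 0)) + real N * e"
      unfolding sum.distrib sum_distrib_left[symmetric] sum_lessThan_telescope[of "\<lambda>k. G (x + t k)"] by simp
    also have "G (x + t N) - G (x + t 0) = G (2 * pi) - G 0"
      using Gper[of x] Npos by (simp add: t_def)
    finally have "real N * ln (cmod (f 0)) \<le> real N * ((G (2 * pi) - G 0) / (2 * pi) + e)"
      by (simp add: algebra_simps diff_divide_distrib)
    then have "ln (cmod (f 0)) \<le> (G (2 * pi) - G 0) / (2 * pi) + e"
      using Npos by simp
    then have "2 * pi * ln (cmod (f 0)) \<le> 2 * pi * ((G (2 * pi) - G 0) / (2 * pi) + e)" by simp
    also have "\<dots> = G (2 * pi) - G 0 + 2 * pi * e" by (simp add: distrib_left)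
    finally show ?thesis .
  qed
  have key': "2 * pi * ln (cmod (f 0)) \<le> G (2 * pi) - G 0"
  proof (rule field_le_epsilon)
    fix e :: real assume "e > 0"
    then show "2 * pi * ln (cmod (f 0)) \<le> G (2 * pi) - G 0 + e" using key[of "e / (2 * pi)"] by simp
  qed
  have gC: "g \<theta> \<le> C" for \<theta>
  proof -
    have "ln (max (cmod (f (cis \<theta>))) \<delta>) \<le> ln (exp C)"
      using C[of \<theta>] \<open>\<delta> > 0\<close> by (intro ln_mono) auto
    then show ?thesis by (simp add: g_def h_def)
  qed
  have "(\<integral>\<^sup>+\<theta>\<in>{0..2*pi}. ennreal (C - ln (max (cmod (f (cis \<theta>))) \<delta>)) \<partial>lborel)
     = (\<integral>\<^sup>+\<theta>\<in>{0..2*pi}. ennreal (C - g \<theta>) \<partial>lborel)"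
    by (simp add: g_def h_def)
  also have "\<dots> = ennreal ((C * (2 * pi) - G (2 * pi)) - (C * 0 - G 0))"
  proof (rule nn_integral_FTC_Icc[where F = "\<lambda>x. C * x - G x"])
    show "(\<lambda>x. C - g x) \<in> borel_measurable borel"
      by (intro borel_measurable_continuous_onI continuous_intros contg)
    show "((\<lambda>x. C * x - G x) has_real_derivative C - g x) (at x)" for x
      using DERIV_diff[OF DERIV_cmult[OF DERIV_ident, of C] G[of x]] by simp
  qed (use gC in auto)
  also have "\<dots> \<le> ennreal (2 * pi * (C - ln (cmod (f 0))))"
    using key' by (intro ennreal_leI) (simp add: algebra_simps)
  finally show ?thesis .
qed

text \<open>The shift by C makes - ln \<bar>z\<bar> nonnegative on the disc of radius exp C, so that
  it can be integrated as an extended nonnegative function, infinite at zeros.\<close>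

definition neg_log :: "real \<Rightarrow> complex \<Rightarrow> ennreal" where
  "neg_log C z = (if z = 0 then \<infinity> else ennreal (C - ln (cmod z)))"

lemma neg_log_measurable [measurable]: "neg_log C \<in> borel_measurable borel"
  unfolding neg_log_def by measurable

text \<open>Monotone limit of the truncated inequality along \<delta> = exp (C - k). At a zero of f
  the truncated integrand is exactly k, and its limit is the value \<infinity> built into
  \<open>neg_log\<close>; for f 0 = 0 the right side is infinite.\<close>

lemma neg_log_jensen:
  fixes f :: "complex \<Rightarrow> complex"
  assumes f: "f holomorphic_on S" "open S" "cball 0 1 \<subseteq> S" and C: "\<And>\<theta>. cmod (f (cis \<theta>)) \<le> exp C"
  shows "(\<integral>\<^sup>+\<theta>\<in>{0..2*pi}. neg_log C (f (cis \<theta>)) \<partial>lborel) \<le> ennreal (2 * pi) * neg_log C (f 0)"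
proof (cases "f 0 = 0")
  case True
  then show ?thesis by (simp add: neg_log_def ennreal_mult_top)
next
  case False
  define \<delta> where "\<delta> k = exp (C - real k)" for k
  have \<delta>: "\<delta> k > 0" "\<delta> k \<le> exp C" "\<delta> (Suc k) \<le> \<delta> k" for k by (auto simp: \<delta>_def)
  define u where "u k \<theta> = ennreal (C - ln (max (cmod (f (cis \<theta>))) (\<delta> k))) * indicator {0..2*pi} \<theta>" for k \<theta>
  have cont: "continuous_on UNIV (\<lambda>\<theta>. f (cis \<theta>))"
    by (rule continuous_on_compose2[OF holomorphic_on_imp_continuous_on[OF f(1)]]) (use f(3) in \<open>auto intro!: continuous_intros\<close>)
  have "incseq u"
  proof (intro incseq_SucI le_funI)
    fix k \<theta>
    have "ln (max (cmod (f (cis \<theta>))) (\<delta> (Suc k))) \<le> ln (max (cmod (f (cis \<theta>))) (\<delta> k))"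
      using \<delta>[of k] \<delta>[of "Suc k"] by (intro ln_mono) auto
    then show "u k \<theta> \<le> u (Suc k) \<theta>"
      unfolding u_def by (intro mult_right_mono ennreal_leI) auto
  qed
  have meas: "u k \<in> borel_measurable lborel" for k
  proof -
    have "continuous_on UNIV (\<lambda>\<theta>. C - ln (max (cmod (f (cis \<theta>))) (\<delta> k)))"
      using \<delta>(1)[of k] by (intro continuous_intros cont) auto
    then have "(\<lambda>\<theta>. C - ln (max (cmod (f (cis \<theta>))) (\<delta> k))) \<in> borel_measurable borel"
      by (rule borel_measurable_continuous_onI)
    then show ?thesis unfolding u_def by measurable
  qed
  have SUP: "(SUP k. u k \<theta>) = neg_log C (f (cis \<theta>)) * indicator {0..2*pi} \<theta>" for \<theta>
  proof -
    have "(\<lambda>k. u k \<theta>) \<longlonglongrightarrow> neg_log C (f (cis \<theta>)) * indicator {0..2*pi} \<theta>"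
    proof (cases "\<theta> \<in> {0..2*pi}")
      case in_range: True
      show ?thesis
      proof (cases "f (cis \<theta>) = 0")
        case True
        have "u k \<theta> = ennreal (real k)" for k
          using in_range True \<delta>(1)[of k] by (simp add: u_def \<delta>_def max_def)
        then show ?thesis
          using in_range True by (simp add: neg_log_def of_nat_tendsto_top_ennreal ennreal_of_nat_eq_real_of_nat[symmetric])
      next
        case nz: False
        obtain K :: nat where K: "C - ln (cmod (f (cis \<theta>))) < real K" using reals_Archimedean2 by blast
        have "u k \<theta> = neg_log C (f (cis \<theta>)) * indicator {0..2*pi} \<theta>" if "k \<ge> K" for k
        proof -
          have "C - real k \<le> ln (cmod (f (cis \<theta>)))" using K that by linarith
          then have "\<delta> k \<le> cmod (f (cis \<theta>))" unfolding \<delta>_def using nz by (simp add: ln_ge_iff)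
          then show ?thesis using nz by (simp add: u_def neg_log_def max_def)
        qed
        then show ?thesis by (intro tendsto_eventually) (auto simp: eventually_sequentially)
      qed
    qed (simp add: u_def)
    then show ?thesis
      using LIMSEQ_SUP[of "\<lambda>k. u k \<theta>"] \<open>incseq u\<close> LIMSEQ_unique by (auto simp: incseq_def le_fun_def)
  qed
  have "(\<integral>\<^sup>+\<theta>\<in>{0..2*pi}. neg_log C (f (cis \<theta>)) \<partial>lborel) = (\<integral>\<^sup>+\<theta>. (SUP k. u k \<theta>) \<partial>lborel)"
    by (simp add: SUP)
  also have "\<dots> = (SUP k. \<integral>\<^sup>+\<theta>. u k \<theta> \<partial>lborel)"
    by (rule nn_integral_monotone_convergence_SUP[OF \<open>incseq u\<close> meas])
  also have "\<dots> \<le> ennreal (2 * pi * (C - ln (cmod (f 0))))"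
    unfolding u_def using C \<delta> by (intro SUP_least log_mean_continuous_bound[OF f False \<delta>(1)]) auto
  also have "\<dots> = ennreal (2 * pi) * neg_log C (f 0)"
    using False by (simp add: neg_log_def ennreal_mult')
  finally show ?thesis .
qed

section \<open>Plurisubharmonic functions on polydiscs\<close>

definition polydisc :: "nat \<Rightarrow> (nat \<Rightarrow> complex) \<Rightarrow> real \<Rightarrow> (nat \<Rightarrow> complex) set" where
  "polydisc n a r = PiE {..<n} (\<lambda>j. ball (a j) r)"

definition cpolydisc :: "nat \<Rightarrow> (nat \<Rightarrow> complex) \<Rightarrow> real \<Rightarrow> (nat \<Rightarrow> complex) set" where
  "cpolydisc n a r = PiE {..<n} (\<lambda>j. cball (a j) r)"

lemma polydisc_iff: "w \<in> polydisc n a r \<longleftrightarrow> w \<in> extensional {..<n} \<and> (\<forall>j<n. cmod (w j - a j) < r)"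
  by (auto simp: polydisc_def PiE_iff dist_norm norm_minus_commute)

lemma cpolydisc_iff: "w \<in> cpolydisc n a r \<longleftrightarrow> w \<in> extensional {..<n} \<and> (\<forall>j<n. cmod (w j - a j) \<le> r)"
  by (auto simp: cpolydisc_def PiE_iff dist_norm norm_minus_commute)

lemma openin_polydisc: "openin (Cn n) (polydisc n a r)"
  unfolding polydisc_def by (rule openin_Cn_PiE) auto

lemma compactin_cpolydisc: "compactin (Cn n) (cpolydisc n a r)"
  unfolding cpolydisc_def Cn_def compactin_PiE by auto

lemma polydisc_subset_cpolydisc: "polydisc n a r \<subseteq> cpolydisc n a r"
  by (fastforce simp: polydisc_iff cpolydisc_iff)

lemma polydisc_sets [measurable]: "polydisc n a r \<in> sets (vol {..<n})"
  by (rule openin_Cn_sets[OF openin_polydisc])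

lemma cpolydisc_sets [measurable]: "cpolydisc n a r \<in> sets (vol {..<n})"
  unfolding cpolydisc_def sets_vol_cong by (rule sets_PiM_I_finite) auto

lemma openin_Cn_extensional: "openin (Cn n) W \<Longrightarrow> W \<subseteq> extensional {..<n}"
  using openin_subset topspace_Cn by metis

lemma cpolydisc_in_open:
  assumes "openin (Cn n) W" "a \<in> W"
  obtains r where "r > 0" "cpolydisc n a r \<subseteq> W"
proof -
  obtain U where U: "\<And>j. j < n \<Longrightarrow> open (U j)" "a \<in> PiE {..<n} U" "PiE {..<n} U \<subseteq> W"
    using openin_Cn_box[OF assms] by metis
  have "\<exists>r>0. cball (a j) r \<subseteq> U j" if "j < n" for j
    using U(1)[OF that] U(2) that open_contains_cball by (metis PiE_mem lessThan_iff)
  then obtain r where r: "\<And>j. j < n \<Longrightarrow> r j > 0 \<and> cball (a j) (r j) \<subseteq> U j" by metis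
  \<comment> \<open>The inserted 1 covers n = 0, where there are no radii.\<close>
  define \<rho> where "\<rho> = Min (insert 1 (r ` {..<n}))"
  have "\<rho> > 0" unfolding \<rho>_def using r by (subst Min_gr_iff) auto
  moreover have "cball (a j) \<rho> \<subseteq> U j" if "j < n" for j
  proof -
    have "\<rho> \<le> r j" unfolding \<rho>_def using that by (intro Min_le) auto
    then show ?thesis using r[OF that] by (meson order_trans subset_cball)
  qed
  then have "cpolydisc n a \<rho> \<subseteq> PiE {..<n} U" unfolding cpolydisc_def by (intro PiE_mono) auto
  ultimately show ?thesis using that U(3) by blast
qed

lemma continuous_fun_upd_Cn:
  assumes "w \<in> extensional {..<n}" "j < n"
  shows "continuous_map euclidean (Cn n) (\<lambda>y. w(j := y))"
  unfolding Cn_def continuous_map_componentwise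
  using assms by (auto simp: extensional_def image_subset_iff)

lemma open_slice_Cn:
  assumes "openin (Cn n) W" "w \<in> extensional {..<n}" "j < n"
  shows "open {y. w(j := y) \<in> W}"
proof -
  have "openin euclidean {y \<in> topspace euclidean. w(j := y) \<in> W}"
    by (rule openin_continuous_map_preimage[OF continuous_fun_upd_Cn[OF assms(2,3)] assms(1)])
  then show ?thesis by simp
qed

lemma openin_Cn_preimage:
  assumes W: "openin (Cn n) W" and f: "continuous_map (subtopology (Cn n) W) euclidean f" and S: "open S"
  shows "openin (Cn n) {w \<in> W. f w \<in> S}"
proof -
  have "openin (subtopology (Cn n) W) {w \<in> topspace (subtopology (Cn n) W). f w \<in> S}"
    using S by (intro openin_continuous_map_preimage[OF f]) (simp only: open_openin)
  then have "openin (Cn n) {w \<in> topspace (subtopology (Cn n) W). f w \<in> S}"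
    by (rule openin_trans_full[OF _ W])
  moreover have "topspace (subtopology (Cn n) W) = W" using openin_subset[OF W] by (simp add: Int_absorb1)
  ultimately show ?thesis by (simp only:)
qed

lemma holo_slice:
  assumes f: "holo n W f" and w: "w \<in> extensional {..<n}" "j < n"
  shows "open {y. w(j := y) \<in> W}" "(\<lambda>y. f (w(j := y))) holomorphic_on {y. w(j := y) \<in> W}"
proof -
  show "open {y. w(j := y) \<in> W}"
    by (rule open_slice_Cn[OF _ w]) (use f in \<open>simp add: holo_def\<close>)
  show "(\<lambda>y. f (w(j := y))) holomorphic_on {y. w(j := y) \<in> W}"
    unfolding holomorphic_on_def
  proof
    fix y assume y: "y \<in> {y. w(j := y) \<in> W}"
    then have "(\<lambda>t. f ((w(j := y))(j := t))) field_differentiable at ((w(j := y)) j)"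
      using f w(2) unfolding holo_def by blast
    then show "(\<lambda>y. f (w(j := y))) field_differentiable at y within {y. w(j := y) \<in> W}"
      by (simp add: field_differentiable_at_within)
  qed
qed

lemma borel_measurable_on_open:
  assumes U: "openin (Cn n) U" and f: "continuous_map (subtopology (Cn n) U) euclidean f"
    and g: "g \<in> borel \<rightarrow>\<^sub>M N" and c: "c \<in> space N"
  shows "(\<lambda>w. if w \<in> U then g (f w) else c) \<in> vol {..<n} \<rightarrow>\<^sub>M N"
proof -
  have [measurable]: "U \<in> sets (vol {..<n})" by (rule openin_Cn_sets[OF U])
  have "f \<in> borel_measurable (restrict_space (vol {..<n}) U)"
  proof (rule borel_measurableI)
    fix S :: "'a set" assume "open S"
    then have "{x \<in> U. f x \<in> S} \<in> sets (vol {..<n})"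
      by (intro openin_Cn_sets openin_Cn_preimage[OF U f])
    moreover have "{x \<in> U. f x \<in> S} = f -` S \<inter> space (restrict_space (vol {..<n}) U)"
      using openin_Cn_extensional[OF U] by (auto simp: space_restrict_space space_vol)
    ultimately show "f -` S \<inter> space (restrict_space (vol {..<n}) U) \<in> sets (restrict_space (vol {..<n}) U)"
      using \<open>U \<in> sets (vol {..<n})\<close> by (subst sets_restrict_space_iff) (auto simp: sets.Int_space_eq1)
  qed
  then have "(\<lambda>w. g (f w)) \<in> restrict_space (vol {..<n}) U \<rightarrow>\<^sub>M N"
    by (rule measurable_compose[OF _ g])
  then show ?thesis
    by (subst measurable_restrict_space_iff[symmetric]) (use c in auto)
qed

text \<open>H may be meaningless outside U. It is cut off by 0 there, and since the product kernel
  vanishes off the polydisc, the cut-off changes no integral.\<close>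

lemma supermean_polydisc_on:
  fixes H :: "(nat \<Rightarrow> complex) \<Rightarrow> ennreal" and \<kappa> :: "real \<Rightarrow> ennreal"
  assumes H: "(\<lambda>w. if w \<in> U then H w else 0) \<in> borel_measurable (vol {..<n})"
    and U: "cpolydisc n \<zeta> \<rho> \<subseteq> U" and \<kappa>: "\<kappa> \<in> borel_measurable borel"
    and supp: "\<And>t. \<rho>\<^sup>2 < t \<Longrightarrow> \<kappa> t = 0" and "\<rho> > 0" and \<zeta>: "\<zeta> \<in> extensional {..<n}"
    and mean: "\<And>w j v. \<lbrakk>w \<in> cpolydisc n \<zeta> \<rho>; j < n; w j = \<zeta> j; cmod v \<le> \<rho>\<rbrakk> \<Longrightarrow>
      (\<integral>\<^sup>+\<theta>\<in>{0..2*pi}. H (w(j := w j + cis \<theta> * v)) \<partial>lborel) \<le> ennreal (2 * pi) * H w"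
  shows "(\<integral>\<^sup>+w. (\<Prod>j<n. \<kappa> ((cmod (w j - \<zeta> j))\<^sup>2)) * H w \<partial>vol {..<n}) \<le> (\<integral>\<^sup>+z. \<kappa> ((cmod z)\<^sup>2) \<partial>lborel) ^ n * H \<zeta>"
proof -
  let ?H = "\<lambda>w. if w \<in> U then H w else 0"
  have out: "(\<Prod>j<n. \<kappa> ((cmod (w j - \<zeta> j))\<^sup>2)) = 0" if "w \<in> space (vol {..<n})" "w \<notin> U" for w
  proof -
    from that U have "w \<notin> cpolydisc n \<zeta> \<rho>" by blast
    with that obtain j where j: "j < n" "\<rho> < cmod (w j - \<zeta> j)"
      by (auto simp: cpolydisc_iff space_vol not_le)
    then have "\<kappa> ((cmod (w j - \<zeta> j))\<^sup>2) = 0" using \<open>\<rho> > 0\<close> by (intro supp power_strict_mono) auto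
    then show ?thesis using j by (intro prod_zero) auto
  qed
  have "(\<integral>\<^sup>+w. (\<Prod>j<n. \<kappa> ((cmod (w j - \<zeta> j))\<^sup>2)) * H w \<partial>vol {..<n})
      = (\<integral>\<^sup>+w. (\<Prod>j<n. \<kappa> ((cmod (w j - \<zeta> j))\<^sup>2)) * ?H w \<partial>vol {..<n})"
    by (intro nn_integral_cong) (auto simp: out)
  also have "\<dots> \<le> (\<integral>\<^sup>+z. \<kappa> ((cmod z)\<^sup>2) \<partial>lborel) ^ n * ?H \<zeta>"
  proof (rule supermean_polydisc[OF H \<kappa> supp \<open>\<rho> > 0\<close>])
    show "\<zeta> \<in> topspace (Cn n)" using \<zeta> by (simp add: topspace_Cn)
    fix w j v assume w: "w \<in> topspace (Cn n)" "\<And>k. k < n \<Longrightarrow> cmod (w k - \<zeta> k) \<le> \<rho>" "j < n" "w j = \<zeta> j" "cmod v \<le> \<rho>"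
    then have wc: "w \<in> cpolydisc n \<zeta> \<rho>" by (auto simp: cpolydisc_iff topspace_Cn)
    have "w(j := w j + cis \<theta> * v) \<in> cpolydisc n \<zeta> \<rho>" for \<theta>
      using w wc by (auto simp: cpolydisc_iff extensional_def norm_mult)
    then show "(\<integral>\<^sup>+\<theta>\<in>{0..2*pi}. ?H (w(j := w j + cis \<theta> * v)) \<partial>lborel) \<le> ennreal (2 * pi) * ?H w"
      using mean[OF wc w(3-5)] U wc by (simp add: subset_iff)
  qed auto
  also have "?H \<zeta> = H \<zeta>" using U \<zeta> \<open>\<rho> > 0\<close> by (auto simp: cpolydisc_iff subset_iff)
  finally show ?thesis .
qed

text \<open>Jensen's inequality on each coordinate disc, rescaled to the unit disc, is the mean
  hypothesis of the polydisc inequality.\<close>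

lemma neg_log_polydisc:
  assumes f: "holo n W f" and W: "cpolydisc n \<zeta> \<rho> \<subseteq> W" and \<kappa>: "\<kappa> \<in> borel_measurable borel"
    and supp: "\<And>t. \<rho>\<^sup>2 < t \<Longrightarrow> \<kappa> t = 0" and "\<rho> > 0" and \<zeta>: "\<zeta> \<in> extensional {..<n}"
    and C: "\<And>w. w \<in> cpolydisc n \<zeta> \<rho> \<Longrightarrow> cmod (f w) \<le> exp C"
  shows "(\<integral>\<^sup>+w. (\<Prod>j<n. \<kappa> ((cmod (w j - \<zeta> j))\<^sup>2)) * neg_log C (f w) \<partial>vol {..<n})
    \<le> (\<integral>\<^sup>+z. \<kappa> ((cmod z)\<^sup>2) \<partial>lborel) ^ n * neg_log C (f \<zeta>)"
proof (rule supermean_polydisc_on[OF _ W \<kappa> supp \<open>\<rho> > 0\<close> \<zeta>])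
  show "(\<lambda>w. if w \<in> W then neg_log C (f w) else 0) \<in> borel_measurable (vol {..<n})"
    using f unfolding holo_def by (intro borel_measurable_on_open) auto
  fix w j v assume w: "w \<in> cpolydisc n \<zeta> \<rho>" "j < n" "w j = \<zeta> j" "cmod v \<le> \<rho>"
  have wext: "w \<in> extensional {..<n}" using w by (simp add: cpolydisc_iff)
  have disc: "w(j := w j + t * v) \<in> cpolydisc n \<zeta> \<rho>" if "cmod t \<le> 1" for t
    using w that mult_mono[of "cmod t" 1 "cmod v" \<rho>] by (auto simp: cpolydisc_iff extensional_def norm_mult)
  let ?S = "{y. w(j := y) \<in> W}"
  let ?T = "(\<lambda>t. w j + t * v) -` ?S"
  have hol: "(\<lambda>t. f (w(j := w j + t * v))) holomorphic_on ?T"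
    by (rule holomorphic_on_compose_gen[OF _ holo_slice(2)[OF f wext w(2)], unfolded o_def])
       (auto intro!: holomorphic_intros)
  have "open ?T"
    using holo_slice(1)[OF f wext w(2)] by (intro continuous_open_vimage continuous_intros)
  moreover have "cball 0 1 \<subseteq> ?T" using disc W by auto
  ultimately show "(\<integral>\<^sup>+\<theta>\<in>{0..2*pi}. neg_log C (f (w(j := w j + cis \<theta> * v))) \<partial>lborel) \<le> ennreal (2 * pi) * neg_log C (f w)"
    using neg_log_jensen[OF hol, of C] C disc by simp
qed auto

text \<open>The value \<infinity> outside U turns every strict sublevel set into an open subset of
  U.\<close>

lemma psh_measurable:
  assumes "psh n U \<psi>"
  shows "(\<lambda>w. if w \<in> U then \<psi> w else \<infinity>) \<in> borel_measurable (vol {..<n})"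
proof (rule borel_measurableI_less)
  fix y :: ereal
  have "{w \<in> space (vol {..<n}). (if w \<in> U then \<psi> w else \<infinity>) < y} = {w \<in> U. \<psi> w < y}"
    using assms openin_Cn_extensional by (auto simp: psh_def space_vol split: if_splits)
  then show "{w \<in> space (vol {..<n}). (if w \<in> U then \<psi> w else \<infinity>) < y} \<in> sets (vol {..<n})"
    using assms openin_Cn_sets by (auto simp: psh_def)
qed

text \<open>The submean inequality from \<open>psh\<close>, applied on coordinate discs, is the mean
  hypothesis for C - \<psi>.\<close>

lemma psh_polydisc:
  assumes \<psi>: "psh n U \<psi>" and U: "cpolydisc n \<zeta> \<rho> \<subseteq> U" and \<kappa>: "\<kappa> \<in> borel_measurable borel"
    and supp: "\<And>t. \<rho>\<^sup>2 < t \<Longrightarrow> \<kappa> t = 0" and "\<rho> > 0" and \<zeta>: "\<zeta> \<in> extensional {..<n}"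
    and C: "\<And>w. w \<in> cpolydisc n \<zeta> \<rho> \<Longrightarrow> \<psi> w \<le> ereal C"
  shows "(\<integral>\<^sup>+w. (\<Prod>j<n. \<kappa> ((cmod (w j - \<zeta> j))\<^sup>2)) * e2ennreal (ereal C - \<psi> w) \<partial>vol {..<n})
    \<le> (\<integral>\<^sup>+z. \<kappa> ((cmod z)\<^sup>2) \<partial>lborel) ^ n * e2ennreal (ereal C - \<psi> \<zeta>)"
proof (rule supermean_polydisc_on[OF _ U \<kappa> supp \<open>\<rho> > 0\<close> \<zeta>])
  note [measurable] = psh_measurable[OF \<psi>]
  have "(\<lambda>w. e2ennreal (ereal C - (if w \<in> U then \<psi> w else \<infinity>))) \<in> borel_measurable (vol {..<n})"
    by measurable
  moreover have "(\<lambda>w. e2ennreal (ereal C - (if w \<in> U then \<psi> w else \<infinity>))) = (\<lambda>w. if w \<in> U then e2ennreal (ereal C - \<psi> w) else 0)"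
    by (auto simp: fun_eq_iff e2ennreal_neg)
  ultimately show "(\<lambda>w. if w \<in> U then e2ennreal (ereal C - \<psi> w) else 0) \<in> borel_measurable (vol {..<n})" by simp
  fix w j v assume w: "w \<in> cpolydisc n \<zeta> \<rho>" "j < n" "w j = \<zeta> j" "cmod v \<le> \<rho>"
  have wext: "w \<in> extensional {..<n}" using w by (simp add: cpolydisc_iff)
  have disc: "w(j := w j + t * v) \<in> cpolydisc n \<zeta> \<rho>" if "cmod t \<le> 1" for t
    using w that mult_mono[of "cmod t" 1 "cmod v" \<rho>] by (auto simp: cpolydisc_iff extensional_def norm_mult)
  define v' where "v' i = (if i = j then v else 0)" for i
  have eq: "(\<lambda>i\<in>{..<n}. w i + t * v' i) = w(j := w j + t * v)" for t
    using wext w(2) by (auto simp: v'_def extensional_def fun_eq_iff)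
  define I where "I = (\<integral>\<^sup>+\<theta>\<in>{0..2*pi}. e2ennreal (ereal C - \<psi> (w(j := w j + cis \<theta> * v))) \<partial>lborel)"
  have submean: "\<psi> w \<le> ereal C - enn2ereal I / ereal (2*pi)"
  proof -
    have "\<forall>w\<in>U. \<forall>v. (\<forall>t\<in>cball 0 1. (\<lambda>i\<in>{..<n}. w i + t * v i) \<in> U) \<longrightarrow>
        (\<forall>C::real. (\<forall>\<theta>. \<psi> (\<lambda>i\<in>{..<n}. w i + cis \<theta> * v i) \<le> ereal C) \<longrightarrow>
           \<psi> w \<le> ereal C - enn2ereal (\<integral>\<^sup>+\<theta>\<in>{0..2*pi}.
              e2ennreal (ereal C - \<psi> (\<lambda>i\<in>{..<n}. w i + cis \<theta> * v i)) \<partial>lborel) / ereal (2*pi))"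
      using \<psi> unfolding psh_def by blast
    from this[rule_format, of w v' C] show ?thesis
      unfolding eq I_def using disc U C w by (auto simp: subset_iff)
  qed
  have "\<psi> w < \<infinity>" using \<psi> U w by (auto simp: psh_def subset_iff)
  then consider p where "\<psi> w = ereal p" | "\<psi> w = -\<infinity>" by (cases "\<psi> w") auto
  \<comment> \<open>A real value of \<psi> at w forces I to be finite, since otherwise the submean
    inequality would give -\<infinity>; for \<psi> w = -\<infinity> the right side is
    infinite.\<close>
  then have "I \<le> ennreal (2 * pi) * e2ennreal (ereal C - \<psi> w)"
  proof cases
    case 1
    show ?thesis
    proof (cases I)
      case (real i)
      then have "p \<le> C - i / (2 * pi)" using submean 1 by simp
      then have "i \<le> 2 * pi * (C - p)" by (simp add: field_simps)
      then show ?thesis using real 1 ennreal_leI[of i "2 * pi * (C - p)"] by (simp add: ennreal_mult')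
    next
      case top
      then show ?thesis using submean 1 by simp
    qed
  next
    case 2
    then show ?thesis by (simp add: ennreal_mult_top)
  qed
  then show "(\<integral>\<^sup>+\<theta>\<in>{0..2*pi}. e2ennreal (ereal C - \<psi> (w(j := w j + cis \<theta> * v))) \<partial>lborel) \<le> ennreal (2 * pi) * e2ennreal (ereal C - \<psi> w)"
    by (simp add: I_def)
qed auto

section \<open>Radial test functions\<close>

text \<open>A class of functions closed under real partial derivatives, so that membership alone
  gives \<open>Ck\<close> for every k. The coordinate functions belong to it because the chain rule
  for a function of a squared distance produces them.\<close>

inductive_set radial_algebra :: "nat \<Rightarrow> (nat \<Rightarrow> complex) \<Rightarrow> ((nat \<Rightarrow> complex) \<Rightarrow> complex) set"
  for n :: nat and \<zeta> :: "nat \<Rightarrow> complex" where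
  const: "(\<lambda>w. c) \<in> radial_algebra n \<zeta>"
| re: "j < n \<Longrightarrow> (\<lambda>w. of_real (Re (w j))) \<in> radial_algebra n \<zeta>"
| im: "j < n \<Longrightarrow> (\<lambda>w. of_real (Im (w j))) \<in> radial_algebra n \<zeta>"
| radial: "j < n \<Longrightarrow> smooth h \<Longrightarrow> (\<lambda>w. of_real (h ((cmod (w j - \<zeta> j))\<^sup>2))) \<in> radial_algebra n \<zeta>"
| add: "f \<in> radial_algebra n \<zeta> \<Longrightarrow> g \<in> radial_algebra n \<zeta> \<Longrightarrow> (\<lambda>w. f w + g w) \<in> radial_algebra n \<zeta>"
| mult: "f \<in> radial_algebra n \<zeta> \<Longrightarrow> g \<in> radial_algebra n \<zeta> \<Longrightarrow> (\<lambda>w. f w * g w) \<in> radial_algebra n \<zeta>"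

lemma radial_has_vector_derivative:
  assumes h: "\<And>t. (h has_real_derivative h' t) (at t)"
  shows "((\<lambda>t::real. complex_of_real (h ((cmod (a + of_real t * u))\<^sup>2))) has_vector_derivative
    of_real (h' ((cmod a)\<^sup>2) * (2 * (Re u * Re a + Im u * Im a)))) (at 0)"
proof -
  have "((\<lambda>t::real. (Re a + t * Re u)\<^sup>2 + (Im a + t * Im u)\<^sup>2) has_real_derivative
      2 * (Re u * Re a + Im u * Im a)) (at 0)"
    by (auto intro!: derivative_eq_intros simp: algebra_simps)
  then have "((\<lambda>t::real. (cmod (a + of_real t * u))\<^sup>2) has_real_derivative 2 * (Re u * Re a + Im u * Im a)) (at 0)"
    by (simp add: cmod_power2)
  from DERIV_chain2[OF h this]
  have "((\<lambda>t::real. h ((cmod (a + of_real t * u))\<^sup>2)) has_real_derivative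
      h' ((cmod a)\<^sup>2) * (2 * (Re u * Re a + Im u * Im a))) (at 0)" by simp
  then show ?thesis by (rule has_vector_derivative_of_real)
qed

lemma radial_algebra_derivative:
  assumes "f \<in> radial_algebra n \<zeta>"
  obtains f' where "f' \<in> radial_algebra n \<zeta>"
    "\<And>w. ((\<lambda>t::real. f (w(i := w i + of_real t * u))) has_vector_derivative f' w) (at 0)"
proof -
  have "\<exists>f'\<in>radial_algebra n \<zeta>. \<forall>w. ((\<lambda>t::real. f (w(i := w i + of_real t * u))) has_vector_derivative f' w) (at 0)"
    using assms
  proof induction
    case (const c)
    show ?case by (rule bexI[of _ "\<lambda>w. 0"]) (auto intro: radial_algebra.intros)
  next
    case (re j)
    have "((\<lambda>t::real. complex_of_real (Re (w i + of_real t * u))) has_vector_derivative of_real (Re u)) (at 0)" for w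
      by (rule has_vector_derivative_of_real) (auto intro!: derivative_eq_intros )
    then show ?case
      by (cases "i = j") (auto intro!: bexI[of _ "\<lambda>w. if i = j then of_real (Re u) else 0"] radial_algebra.intros)
  next
    case (im j)
    have "((\<lambda>t::real. complex_of_real (Im (w i + of_real t * u))) has_vector_derivative of_real (Im u)) (at 0)" for w
      by (rule has_vector_derivative_of_real) (auto intro!: derivative_eq_intros )
    then show ?case
      by (cases "i = j") (auto intro!: bexI[of _ "\<lambda>w. if i = j then of_real (Im u) else 0"] radial_algebra.intros)
  next
    case (radial j h)
    obtain h' where h': "\<And>t. (h has_real_derivative h' t) (at t)" "smooth h'"
      using smoothE[OF radial(2)] by blast
    show ?case
    proof (cases "i = j")
      case True
      let ?f' = "\<lambda>w. complex_of_real (h' ((cmod (w j - \<zeta> j))\<^sup>2)) *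
        (of_real (2 * Re u) * (of_real (Re (w j)) + of_real (- Re (\<zeta> j))) + of_real (2 * Im u) * (of_real (Im (w j)) + of_real (- Im (\<zeta> j))))"
      have "?f' \<in> radial_algebra n \<zeta>" using radial h' by (intro radial_algebra.intros)
      moreover have "((\<lambda>t::real. complex_of_real (h ((cmod ((w(i := w i + of_real t * u)) j - \<zeta> j))\<^sup>2))) has_vector_derivative ?f' w) (at 0)" for w
        using radial_has_vector_derivative[OF h'(1), of "w j - \<zeta> j" u] True
        by (simp add: algebra_simps)
      ultimately show ?thesis by (intro bexI[of _ ?f'] allI)
    next
      case False
      then show ?thesis by (intro bexI[of _ "\<lambda>w. 0"]) (auto intro: radial_algebra.intros)
    qed
  next
    case (add f g)
    then obtain f' g' where f': "f' \<in> radial_algebra n \<zeta>" "\<And>w. ((\<lambda>t::real. f (w(i := w i + of_real t * u))) has_vector_derivative f' w) (at 0)"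
      and g': "g' \<in> radial_algebra n \<zeta>" "\<And>w. ((\<lambda>t::real. g (w(i := w i + of_real t * u))) has_vector_derivative g' w) (at 0)"
      by blast
    then show ?case
      by (intro bexI[of _ "\<lambda>w. f' w + g' w"] allI has_vector_derivative_add radial_algebra.add)
  next
    case (mult f g)
    then obtain f' g' where f': "f' \<in> radial_algebra n \<zeta>" "\<And>w. ((\<lambda>t::real. f (w(i := w i + of_real t * u))) has_vector_derivative f' w) (at 0)"
      and g': "g' \<in> radial_algebra n \<zeta>" "\<And>w. ((\<lambda>t::real. g (w(i := w i + of_real t * u))) has_vector_derivative g' w) (at 0)"
      by blast
    have "((\<lambda>t::real. f (w(i := w i + of_real t * u)) * g (w(i := w i + of_real t * u))) has_vector_derivative
        f w * g' w + f' w * g w) (at 0)" for w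
      using has_vector_derivative_mult[OF f'(2) g'(2), of w w] by simp
    moreover have "(\<lambda>w. f w * g' w + f' w * g w) \<in> radial_algebra n \<zeta>"
      using f' g' mult by (intro radial_algebra.intros)
    ultimately show ?case by (intro bexI[of _ "\<lambda>w. f w * g' w + f' w * g w"] allI)
  qed
  then show ?thesis using that by blast
qed

lemma continuous_map_component_Cn: "j < n \<Longrightarrow> continuous_map (Cn n) euclidean (\<lambda>w. w j)"
  unfolding Cn_def by (rule continuous_map_product_projection) auto

lemma continuous_map_compose_UNIV:
  assumes "continuous_map X euclidean f" "continuous_on UNIV g"
  shows "continuous_map X euclidean (\<lambda>x. g (f x))"
  using continuous_map_compose[OF assms(1), of euclidean g] assms(2) by (simp add: o_def continuous_map_iff_continuous2)

lemma radial_algebra_continuous: "f \<in> radial_algebra n \<zeta> \<Longrightarrow> continuous_map (Cn n) euclidean f"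
proof (induction rule: radial_algebra.induct)
  case (re j)
  then show ?case
    by (intro continuous_map_compose_UNIV[OF continuous_map_component_Cn]) (auto intro!: continuous_intros)
next
  case (im j)
  then show ?case
    by (intro continuous_map_compose_UNIV[OF continuous_map_component_Cn]) (auto intro!: continuous_intros)
next
  case (radial j h)
  have "continuous_on UNIV (\<lambda>z. complex_of_real (h ((cmod (z - \<zeta> j))\<^sup>2)))"
    by (intro continuous_on_of_real continuous_on_compose2[OF smooth_continuous[OF radial(2)]] continuous_intros) auto
  from continuous_map_compose_UNIV[OF continuous_map_component_Cn[OF radial(1)] this] show ?case .
qed (auto simp: continuous_map_atin intro: tendsto_add tendsto_mult)

lemma radial_algebra_Ck: "f \<in> radial_algebra n \<zeta> \<Longrightarrow> Ck n k f"
proof (induction k arbitrary: f)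
  case 0
  then show ?case by (simp add: radial_algebra_continuous)
next
  case (Suc k)
  have "(\<lambda>t::real. f (w(j := w j + of_real t * u))) differentiable (at 0) \<and> Ck n k (rderiv j u f)" for j u w
  proof -
    obtain f' where f': "f' \<in> radial_algebra n \<zeta>"
      "\<And>w. ((\<lambda>t::real. f (w(j := w j + of_real t * u))) has_vector_derivative f' w) (at 0)"
      using radial_algebra_derivative[OF Suc.prems] by blast
    then have "rderiv j u f = f'" unfolding rderiv_def by (auto intro!: vector_derivative_at)
    then show ?thesis using Suc.IH[OF f'(1)] f'(2)
      by (auto simp: has_vector_derivative_def intro: differentiableI)
  qed
  then show ?case using radial_algebra_continuous[OF Suc.prems] by simp
qed

definition radial_prod :: "nat \<Rightarrow> (nat \<Rightarrow> real \<Rightarrow> real) \<Rightarrow> (nat \<Rightarrow> complex) \<Rightarrow> (nat \<Rightarrow> complex) \<Rightarrow> complex" where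
  "radial_prod n h \<zeta> w = (\<Prod>j<n. of_real (h j ((cmod (w j - \<zeta> j))\<^sup>2)))"

lemma radial_prod_in_algebra:
  assumes "\<And>j. j < n \<Longrightarrow> smooth (h j)"
  shows "radial_prod n h \<zeta> \<in> radial_algebra n \<zeta>"
proof -
  have "(\<lambda>w. \<Prod>j\<in>I. of_real (h j ((cmod (w j - \<zeta> j))\<^sup>2))) \<in> radial_algebra n \<zeta>" if "finite I" "I \<subseteq> {..<n}" for I
    using that by (induction I rule: finite_induct) (auto intro!: radial_algebra.intros assms)
  then show ?thesis unfolding radial_prod_def[abs_def] by auto
qed

lemma radial_prod_test_function:
  assumes h: "\<And>j. j < n \<Longrightarrow> smooth (h j)" and supp: "\<And>j t. j < n \<Longrightarrow> \<rho>\<^sup>2 \<le> t \<Longrightarrow> h j t = 0"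
    and "\<rho> > 0" and U: "cpolydisc n \<zeta> \<rho> \<subseteq> U"
  shows "radial_prod n h \<zeta> \<in> test_functions n U"
proof -
  have "radial_prod n h \<zeta> w = 0" if "w \<in> topspace (Cn n) - cpolydisc n \<zeta> \<rho>" for w
  proof -
    from that obtain j where j: "j < n" "\<rho> < cmod (w j - \<zeta> j)"
      by (auto simp: cpolydisc_iff topspace_Cn not_le)
    then have "h j ((cmod (w j - \<zeta> j))\<^sup>2) = 0"
      using \<open>\<rho> > 0\<close> by (intro supp power_mono) auto
    then show ?thesis unfolding radial_prod_def using j by (intro prod_zero) auto
  qed
  moreover have "Ck n k (radial_prod n h \<zeta>)" for k
    by (intro radial_algebra_Ck[where \<zeta> = \<zeta>] radial_prod_in_algebra h)
  ultimately show ?thesis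
    unfolding test_functions_def using compactin_cpolydisc U by blast
qed

text \<open>In one variable, \<open>\<partial>dbar\<close> of h(\<bar>z\<bar>^2) is h' + t h'' = (t
  h')' at t = \<bar>z\<bar>^2. The result is again a radial product with a single factor changed;
  when h is the regularized logarithm, that factor becomes the kernel.\<close>

lemma d_z_d_zbar_radial_prod:
  assumes h1: "\<And>t. (h j has_real_derivative h1 t) (at t)" and h2: "\<And>t. (h1 has_real_derivative h2 t) (at t)"
    and j: "j < n"
  shows "d_z j (d_zbar j (radial_prod n h \<zeta>)) w =
    radial_prod n (h(j := \<lambda>t. h1 t + t * h2 t)) \<zeta> w"
proof -
  define A where "A w = (\<Prod>i\<in>{..<n} - {j}. complex_of_real (h i ((cmod (w i - \<zeta> i))\<^sup>2)))" for w
  have A_upd: "A (w(j := y)) = A w" for w y unfolding A_def by (intro prod.cong) auto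
  have split: "radial_prod n (h(j := k)) \<zeta> w = A w * of_real (k ((cmod (w j - \<zeta> j))\<^sup>2))" for k w
    unfolding radial_prod_def A_def using j
    by (subst prod.remove[of _ j]) (auto intro!: prod.cong simp: mult.commute)
  have f: "radial_prod n h \<zeta> w = A w * of_real (h j ((cmod (w j - \<zeta> j))\<^sup>2))" for w
    using split[of "h j" w] by simp
  have r1: "rderiv j u (radial_prod n h \<zeta>) w = A w * of_real (h1 ((cmod (w j - \<zeta> j))\<^sup>2) * (2 * (Re u * Re (w j - \<zeta> j) + Im u * Im (w j - \<zeta> j))))" for u w
    unfolding rderiv_def f A_upd
    using has_vector_derivative_mult_right[OF radial_has_vector_derivative[OF h1, of "w j - \<zeta> j" u], of "A w"]
    by (intro vector_derivative_at) (simp add: algebra_simps)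
  \<comment> \<open>\<open>ring\<close> and \<open>ring2\<close> isolate the algebra of (d/dx + i
    d/dy) / 2 and (d/dx - i d/dy) / 2 on radial factors from the computation of the real
    derivatives.\<close>
  have ring: "(a * of_real (H * (2 * (Re 1 * x + Im 1 * y))) + \<i> * (a * of_real (H * (2 * (Re \<i> * x + Im \<i> * y))))) / 2
      = a * (complex_of_real H * (complex_of_real x + \<i> * of_real y))" for a :: complex and H x y
    by (simp add: field_simps)
  have ring2: "(a * (of_real H * 1 + of_real (K * (2 * (Re 1 * x + Im 1 * y))) * z)
        - \<i> * (a * (of_real H * \<i> + of_real (K * (2 * (Re \<i> * x + Im \<i> * y))) * z))) / 2
      = a * (complex_of_real H + complex_of_real K * z * (complex_of_real x - \<i> * of_real y))" for a z :: complex and H K x y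
    by (simp add: field_simps)
  have zbar: "d_zbar j (radial_prod n h \<zeta>) = (\<lambda>w. A w * (of_real (h1 ((cmod (w j - \<zeta> j))\<^sup>2)) * (w j - \<zeta> j)))"
  proof
    fix w
    have "complex_of_real (Re (w j - \<zeta> j)) + \<i> * of_real (Im (w j - \<zeta> j)) = w j - \<zeta> j" by (simp add: complex_eq_iff)
    then show "d_zbar j (radial_prod n h \<zeta>) w = A w * (of_real (h1 ((cmod (w j - \<zeta> j))\<^sup>2)) * (w j - \<zeta> j))"
      using ring[of "A w" "h1 ((cmod (w j - \<zeta> j))\<^sup>2)" "Re (w j - \<zeta> j)" "Im (w j - \<zeta> j)"]
      unfolding d_zbar_def r1 by metis
  qed
  let ?z = "w j - \<zeta> j"
  have r2: "rderiv j u (\<lambda>w. A w * (of_real (h1 ((cmod (w j - \<zeta> j))\<^sup>2)) * (w j - \<zeta> j))) w =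
     A w * (of_real (h1 ((cmod ?z)\<^sup>2)) * u + of_real (h2 ((cmod ?z)\<^sup>2) * (2 * (Re u * Re ?z + Im u * Im ?z))) * ?z)" for u
  proof -
    have "((\<lambda>t::real. ?z + of_real t * u) has_vector_derivative 0 + 1 * u) (at 0)"
      by (intro has_vector_derivative_add has_vector_derivative_mult_left has_vector_derivative_const)
         (auto intro!: derivative_eq_intros simp: has_vector_derivative_of_real[of "\<lambda>t. t" 1, simplified])
    from has_vector_derivative_mult_right[OF has_vector_derivative_mult[OF radial_has_vector_derivative[OF h2, of ?z u] this], of "A w"]
    show ?thesis
      unfolding rderiv_def A_upd by (intro vector_derivative_at) (simp add: algebra_simps)
  qed
  have sq: "complex_of_real ((cmod ?z)\<^sup>2) = ?z * cnj ?z" by (rule complex_norm_square)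
  have cnj: "complex_of_real (Re ?z) - \<i> * of_real (Im ?z) = cnj ?z" by (simp add: complex_eq_iff)
  have "d_z j (d_zbar j (radial_prod n h \<zeta>)) w
      = A w * (of_real (h1 ((cmod ?z)\<^sup>2)) + of_real (h2 ((cmod ?z)\<^sup>2)) * ?z * (complex_of_real (Re ?z) - \<i> * of_real (Im ?z)))"
    unfolding zbar d_z_def r2 by (rule ring2)
  also have "\<dots> = A w * of_real (h1 ((cmod ?z)\<^sup>2) + (cmod ?z)\<^sup>2 * h2 ((cmod ?z)\<^sup>2))"
    unfolding cnj of_real_add of_real_mult sq by (simp add: algebra_simps)
  finally show ?thesis unfolding split .
qed

section \<open>The current of integration along a coordinate hyperplane\<close>

lemma smooth_equation_hyperplane:
  assumes U: "openin (Cn n) U" and n: "1 \<le> n" and Z: "Z = {w \<in> U. w (n - 1) = 0}" and w: "w \<in> Z"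
  shows "smooth_equation n Z w (\<lambda>w. w (n - 1))"
proof -
  have "continuous_map (subtopology (Cn n) U) euclidean (\<lambda>w. w (n - 1))"
    using n by (intro continuous_map_from_subtopology continuous_map_component_Cn) auto
  moreover have "(\<lambda>t. (v(j := t)) (n - 1)) field_differentiable (at (v j))" for v :: "nat \<Rightarrow> complex" and j
    by (cases "j = n - 1") auto
  ultimately have "holo n U (\<lambda>w. w (n - 1))" using U by (simp add: holo_def)
  moreover have "cderiv (n - 1) (\<lambda>w. w (n - 1)) w \<noteq> 0" by (simp add: cderiv_def)
  ultimately show ?thesis
    unfolding smooth_equation_def using w n Z
    by (intro conjI exI[of _ U] exI[of _ "n - 1"]) auto
qed

lemma regular_part_hyperplane:
  assumes "openin (Cn n) U" "1 \<le> n" "Z = {w \<in> U. w (n - 1) = 0}"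
  shows "regular_part n Z = Z"
proof -
  have "w \<in> Z" if "smooth_equation n Z w F" for w F using that by (simp add: smooth_equation_def)
  then show ?thesis unfolding regular_part_def using smooth_equation_hyperplane[OF assms] by blast
qed

text \<open>Whatever local equation the choice operator returns, it vanishes along the hyperplane,
  so its tangential derivatives are 0 and the normal one cannot be.\<close>

lemma conormal_hyperplane:
  assumes U: "openin (Cn n) U" and n: "1 \<le> n" and Z: "Z = {w \<in> U. w (n - 1) = 0}" and w: "w \<in> Z"
  shows "conormal n Z w (n - 1) \<noteq> 0" "\<And>j. j < n \<Longrightarrow> j \<noteq> n - 1 \<Longrightarrow> conormal n Z w j = 0"
proof -
  have "\<exists>\<nu> F. smooth_equation n Z w F \<and> \<nu> = (\<lambda>j. cderiv j F w)"
    using smooth_equation_hyperplane[OF assms] by blast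
  from someI_ex[OF this] obtain F where F: "smooth_equation n Z w F" and \<nu>: "conormal n Z w = (\<lambda>j. cderiv j F w)"
    unfolding conormal_def by blast
  from F obtain W where W: "w \<in> W" "holo n W F" "Z \<inter> W = {v \<in> W. F v = 0}" "\<exists>j<n. cderiv j F w \<noteq> 0"
    unfolding smooth_equation_def by blast
  have wext: "w \<in> extensional {..<n}" using openin_Cn_extensional[OF U] w Z by auto
  have 0: "cderiv j F w = 0" if j: "j < n" "j \<noteq> n - 1" for j
  proof -
    have "openin (Cn n) (U \<inter> W)" using U W by (auto simp: holo_def)
    then have op: "open {t. w(j := t) \<in> U \<inter> W}" by (rule open_slice_Cn[OF _ wext j(1)])
    have "w(j := w j) \<in> U \<inter> W" using W w Z by simp
    moreover have "F (w(j := t)) = 0" if "t \<in> {t. w(j := t) \<in> U \<inter> W}" for t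
    proof -
      have "w(j := t) \<in> Z" using that j w Z by auto
      then show ?thesis using W(3) that by auto
    qed
    ultimately have "((\<lambda>t. F (w(j := t))) has_field_derivative 0) (at (w j))"
      by (intro has_field_derivative_transform_within_open[OF DERIV_const op, of "w j" 0]) auto
    then show ?thesis unfolding cderiv_def by (rule DERIV_imp_deriv)
  qed
  then show "conormal n Z w j = 0" if "j < n" "j \<noteq> n - 1" for j using that by (simp add: \<nu>)
  show "conormal n Z w (n - 1) \<noteq> 0" using W(4) 0 by (metis \<nu>)
qed

lemma AE_vol_component_nonzero:
  assumes "finite I" "i \<in> I"
  shows "AE w in vol I. w i \<noteq> 0"
proof (rule AE_I)
  show "{w \<in> space (vol I). \<not> w i \<noteq> 0} \<subseteq> PiE I (\<lambda>k. if k = i then {0} else UNIV)"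
    using assms by (auto simp: space_vol extensional_def)
  show "emeasure (vol I) (PiE I (\<lambda>k. if k = i then {0} else UNIV)) = 0"
    unfolding vol_def using assms
    by (subst vol.emeasure_PiM) (auto intro!: prod_zero bexI[of _ i])
  show "PiE I (\<lambda>k. if k = i then {0} else UNIV) \<in> sets (vol I)"
    unfolding vol_def using assms by (intro sets_PiM_I_finite) auto
qed

text \<open>The conormal is a multiple of the last coordinate covector, so among the diagonal
  coefficients the last one survives, with weight 1. Projection along another axis sees the
  hyperplane only over the null set where the last coordinate is 0; projection along the last axis
  has at most one point in each fibre.\<close>

lemma integration_current_hyperplane:
  assumes U: "openin (Cn n) U" and n: "1 \<le> n" and Z: "Z = {w \<in> U. w (n - 1) = 0}"
    and f: "\<And>w. w \<in> topspace (Cn n) - U \<Longrightarrow> f w = 0" and j: "j < n"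
  shows "integration_current n Z j j f =
    (if j = n - 1 then (LINT w|vol ({..<n} - {n - 1}). f (w(n - 1 := 0))) / 2 else 0)"
proof -
  define g where "g w = f w * (conormal n Z w j * cnj (conormal n Z w j))
            / of_real (\<Sum>i<n. (cmod (conormal n Z w i))\<^sup>2)" for w
  have g: "g w = (if j = n - 1 then f w else 0)" if "w \<in> Z" for w
  proof -
    note c = conormal_hyperplane[OF U n Z that]
    have "(\<Sum>i<n. (cmod (conormal n Z w i))\<^sup>2) = (\<Sum>i\<in>{n - 1}. (cmod (conormal n Z w i))\<^sup>2)"
      using n c(2) by (intro sum.mono_neutral_right) auto
    also have "complex_of_real \<dots> = conormal n Z w (n - 1) * cnj (conormal n Z w (n - 1))"
      by (simp add: complex_norm_square[symmetric])
    finally show ?thesis using c j by (auto simp: g_def)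
  qed
  have ext: "w(l := t) \<in> topspace (Cn n)" if "w \<in> space (vol ({..<n} - {l}))" "l < n" for w l t
    using that by (auto simp: space_vol topspace_Cn extensional_def)
  have other: "(LINT w|vol ({..<n} - {l}). (\<Sum>\<^sub>\<infinity>t\<in>{t. w(l := t) \<in> Z}. g (w(l := t)))) = 0" if l: "l < n" "l \<noteq> n - 1" for l
  proof (rule integral_eq_zero_AE)
    show "AE w in vol ({..<n} - {l}). (\<Sum>\<^sub>\<infinity>t\<in>{t. w(l := t) \<in> Z}. g (w(l := t))) = 0"
      using AE_vol_component_nonzero[of "{..<n} - {l}" "n - 1"] l n
      by (auto elim!: eventually_mono simp: Z)
  qed
  have last: "(LINT w|vol ({..<n} - {n - 1}). (\<Sum>\<^sub>\<infinity>t\<in>{t. w(n - 1 := t) \<in> Z}. g (w(n - 1 := t))))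
     = (if j = n - 1 then (LINT w|vol ({..<n} - {n - 1}). f (w(n - 1 := 0))) else 0)"
  proof -
    have "(\<Sum>\<^sub>\<infinity>t\<in>{t. w(n - 1 := t) \<in> Z}. g (w(n - 1 := t))) = (if j = n - 1 then f (w(n - 1 := 0)) else 0)"
      if w: "w \<in> space (vol ({..<n} - {n - 1}))" for w
    proof (cases "w(n - 1 := 0) \<in> U")
      case True
      then have "{t. w(n - 1 := t) \<in> Z} = {0}" by (auto simp: Z)
      then show ?thesis using True g[of "w(n - 1 := 0)"] by (simp add: Z)
    next
      case False
      then have "{t. w(n - 1 := t) \<in> Z} = {}" by (auto simp: Z)
      moreover have "f (w(n - 1 := 0)) = 0" using f ext[OF w] n False by auto
      ultimately show ?thesis by simp
    qed
    then have "(LINT w|vol ({..<n} - {n - 1}). (\<Sum>\<^sub>\<infinity>t\<in>{t. w(n - 1 := t) \<in> Z}. g (w(n - 1 := t))))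
      = (LINT w|vol ({..<n} - {n - 1}). (if j = n - 1 then f (w(n - 1 := 0)) else 0))"
      by (intro Bochner_Integration.integral_cong) auto
    then show ?thesis by auto
  qed
  define T where "T l = (LINT w|vol ({..<n} - {l}). (\<Sum>\<^sub>\<infinity>t\<in>{t. w(l := t) \<in> Z}. g (w(l := t))))" for l
  have "integration_current n Z j j f = hypersurface_integral n Z g / 2"
    unfolding integration_current_def g_def ..
  also have "hypersurface_integral n Z g = (\<Sum>l<n. T l)"
    unfolding hypersurface_integral_def regular_part_hyperplane[OF U n Z] T_def ..
  also have "\<dots> = sum T {n - 1}"
    using n other by (intro sum.mono_neutral_right) (auto simp: T_def)
  also have "\<dots> = T (n - 1)" by simp
  finally show ?thesis unfolding last T_def[of "n - 1"] by (cases "j = n - 1") (simp_all only: if_True if_False simp_thms div_0)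
qed

section \<open>Kernel averages of potentials\<close>

definition real_radial_prod :: "nat \<Rightarrow> (nat \<Rightarrow> real \<Rightarrow> real) \<Rightarrow> (nat \<Rightarrow> complex) \<Rightarrow> (nat \<Rightarrow> complex) \<Rightarrow> real" where
  "real_radial_prod n h \<zeta> w = (\<Prod>j<n. h j ((cmod (w j - \<zeta> j))\<^sup>2))"

lemma radial_prod_of_real: "radial_prod n h \<zeta> w = of_real (real_radial_prod n h \<zeta> w)"
  by (simp add: radial_prod_def real_radial_prod_def)

lemma real_radial_prod_measurable:
  assumes "\<And>j. j < n \<Longrightarrow> continuous_on UNIV (h j)"
  shows "real_radial_prod n h \<zeta> \<in> borel_measurable (vol {..<n})"
proof -
  have "(\<lambda>w. h j ((cmod (w j - \<zeta> j))\<^sup>2)) \<in> borel_measurable (vol {..<n})" if "j < n" for j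
  proof -
    have [measurable]: "h j \<in> borel_measurable borel" using assms[OF that] by (rule borel_measurable_continuous_onI)
    have "(\<lambda>w. w j) \<in> vol {..<n} \<rightarrow>\<^sub>M borel"
      using measurable_component_singleton[of j "{..<n}" "\<lambda>_. borel"] that
      by (simp add: measurable_cong_sets[OF sets_vol_cong refl])
    then show ?thesis
      by (rule measurable_compose[where g = "\<lambda>z. h j ((cmod (z - \<zeta> j))\<^sup>2)"]) measurable
  qed
  then show ?thesis unfolding real_radial_prod_def[abs_def] by (intro borel_measurable_prod) auto
qed

lemma real_radial_prod_outside:
  assumes supp: "\<And>j t. j < n \<Longrightarrow> \<rho>\<^sup>2 \<le> t \<Longrightarrow> h j t = 0" and "\<rho> > 0"
    and "w \<in> extensional {..<n}" "w \<notin> cpolydisc n \<zeta> \<rho>"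
  shows "real_radial_prod n h \<zeta> w = 0"
proof -
  from assms obtain j where j: "j < n" "\<rho> < cmod (w j - \<zeta> j)" by (auto simp: cpolydisc_iff not_le)
  then have "h j ((cmod (w j - \<zeta> j))\<^sup>2) = 0" using \<open>\<rho> > 0\<close> by (intro supp power_mono) auto
  then show ?thesis unfolding real_radial_prod_def using j by (intro prod_zero) auto
qed

lemma real_radial_prod_bounded:
  assumes h: "\<And>j. j < n \<Longrightarrow> continuous_on UNIV (h j)" and supp: "\<And>j t. j < n \<Longrightarrow> \<rho>\<^sup>2 \<le> t \<Longrightarrow> h j t = 0"
  obtains B where "\<And>\<zeta> w. \<bar>real_radial_prod n h \<zeta> w\<bar> \<le> B"
proof -
  have "\<exists>b. \<forall>t\<ge>0. \<bar>h j t\<bar> \<le> b" if "j < n" for j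
  proof -
    have "compact (h j ` {0..\<rho>\<^sup>2})"
      using h[OF that] by (intro compact_continuous_image) (auto intro: continuous_on_subset)
    then obtain b where b: "\<And>t. t \<in> {0..\<rho>\<^sup>2} \<Longrightarrow> \<bar>h j t\<bar> \<le> b"
      using compact_imp_bounded bounded_real by (metis imageI)
    have "\<bar>h j t\<bar> \<le> b" if "t \<ge> 0" for t
    proof (cases "t \<le> \<rho>\<^sup>2")
      case False
      then have "h j t = 0" using supp \<open>j < n\<close> by auto
      then show ?thesis using b[of 0] by auto
    qed (use b that in auto)
    then show ?thesis by blast
  qed
  then obtain b where b: "\<And>j t. j < n \<Longrightarrow> t \<ge> 0 \<Longrightarrow> \<bar>h j t\<bar> \<le> b j" by metis
  have "\<bar>real_radial_prod n h \<zeta> w\<bar> \<le> (\<Prod>j<n. b j)" for \<zeta> w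
    unfolding real_radial_prod_def abs_prod by (intro prod_mono) (auto intro: b)
  then show ?thesis using that by blast
qed

lemma integrable_times_radial_prod:
  fixes V :: "(nat \<Rightarrow> complex) \<Rightarrow> real"
  assumes V: "integrable (vol {..<n}) (\<lambda>w. indicator P w * V w)"
    and h: "\<And>j. j < n \<Longrightarrow> continuous_on UNIV (h j)" and supp: "\<And>j t. j < n \<Longrightarrow> \<rho>\<^sup>2 \<le> t \<Longrightarrow> h j t = 0"
    and "\<rho> > 0" and P: "cpolydisc n \<zeta> \<rho> \<subseteq> P"
  shows "integrable (vol {..<n}) (\<lambda>w. V w * real_radial_prod n h \<zeta> w)"
proof -
  obtain B where B: "\<And>\<zeta> w. \<bar>real_radial_prod n h \<zeta> w\<bar> \<le> B"
    using real_radial_prod_bounded[of n h \<rho>, OF h supp] by blast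
  note out = real_radial_prod_outside[of n \<rho> h, OF supp \<open>\<rho> > 0\<close>]
  have eq: "V w * real_radial_prod n h \<zeta> w = real_radial_prod n h \<zeta> w * (indicator P w * V w)"
    if "w \<in> space (vol {..<n})" for w
    using out[of w \<zeta>] that P
    by (cases "w \<in> P") (auto simp: space_vol subset_iff)
  have "integrable (vol {..<n}) (\<lambda>w. real_radial_prod n h \<zeta> w * (indicator P w * V w))"
  proof (rule Bochner_Integration.integrable_bound)
    show "integrable (vol {..<n}) (\<lambda>w. B * (indicator P w * V w))" using V by (rule integrable_mult_right)
    show "(\<lambda>w. real_radial_prod n h \<zeta> w * (indicator P w * V w)) \<in> borel_measurable (vol {..<n})"
      by (intro borel_measurable_times[OF real_radial_prod_measurable borel_measurable_integrable[OF V]] h)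
    show "AE w in vol {..<n}. norm (real_radial_prod n h \<zeta> w * (indicator P w * V w)) \<le> norm (B * (indicator P w * V w))"
    proof (intro AE_I2)
      fix w
      have "\<bar>real_radial_prod n h \<zeta> w\<bar> \<le> \<bar>B\<bar>" using B[of \<zeta> w] by linarith
      then show "norm (real_radial_prod n h \<zeta> w * (indicator P w * V w)) \<le> norm (B * (indicator P w * V w))"
        by (simp add: abs_mult mult_right_mono)
    qed
  qed
  then show ?thesis using eq by (subst Bochner_Integration.integrable_cong[OF refl eq]) auto
qed

lemma integrable_radial:
  assumes h: "continuous_on UNIV h" and supp: "\<And>t. \<rho>\<^sup>2 \<le> t \<Longrightarrow> h t = 0" and "\<rho> > 0"
  shows "integrable lborel (\<lambda>z::complex. h ((cmod (z - c))\<^sup>2) :: real)"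
proof -
  have "integrable lborel (\<lambda>z. indicator (cball c \<rho>) z *\<^sub>R h ((cmod (z - c))\<^sup>2))"
    by (intro borel_integrable_compact compact_cball continuous_on_compose2[OF h] continuous_intros) auto
  moreover have "indicator (cball c \<rho>) z *\<^sub>R h ((cmod (z - c))\<^sup>2) = h ((cmod (z - c))\<^sup>2)" for z
  proof (cases "z \<in> cball c \<rho>")
    case False
    then have "\<rho> \<le> cmod (z - c)" by (simp add: dist_norm norm_minus_commute)
    then have "h ((cmod (z - c))\<^sup>2) = 0" using \<open>\<rho> > 0\<close> by (intro supp power_mono) auto
    then show ?thesis by simp
  qed simp
  ultimately show ?thesis by (simp only:)
qed

lemma hyperplane_integral_radial_prod:
  assumes n: "1 \<le> n" and h: "\<And>j. j < n \<Longrightarrow> continuous_on UNIV (h j)"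
    and supp: "\<And>j t. j < n \<Longrightarrow> \<rho>\<^sup>2 \<le> t \<Longrightarrow> h j t = 0" and "\<rho> > 0"
  shows "(LINT w|vol ({..<n} - {n - 1}). radial_prod n h \<zeta> (w(n - 1 := 0)))
    = of_real ((\<Prod>j<n - 1. LINT z|lborel. h j ((cmod (z - \<zeta> j))\<^sup>2)) * h (n - 1) ((cmod (\<zeta> (n - 1)))\<^sup>2))"
proof -
  have I: "{..<n} - {n - 1} = {..<n - 1}" using n by auto
  have In: "{..<n} = insert (n - 1) {..<n - 1}" using n by auto
  have "(\<Prod>j<n. h j ((cmod ((w(n - 1 := 0)) j - \<zeta> j))\<^sup>2)) = (\<Prod>j<n - 1. h j ((cmod (w j - \<zeta> j))\<^sup>2)) * h (n - 1) ((cmod (\<zeta> (n - 1)))\<^sup>2)" for w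
  proof -
    have "(\<Prod>j<n - 1. h j ((cmod ((w(n - 1 := 0)) j - \<zeta> j))\<^sup>2)) = (\<Prod>j<n - 1. h j ((cmod (w j - \<zeta> j))\<^sup>2))"
      by (intro prod.cong) auto
    then show ?thesis unfolding In by (subst prod.insert) auto
  qed
  then have "(LINT w|vol ({..<n} - {n - 1}). radial_prod n h \<zeta> (w(n - 1 := 0)))
     = (LINT w|vol {..<n - 1}. complex_of_real ((\<Prod>j<n - 1. h j ((cmod (w j - \<zeta> j))\<^sup>2)) * h (n - 1) ((cmod (\<zeta> (n - 1)))\<^sup>2)))"
    unfolding radial_prod_of_real real_radial_prod_def I by simp
  also have "\<dots> = of_real ((LINT w|vol {..<n - 1}. (\<Prod>j<n - 1. h j ((cmod (w j - \<zeta> j))\<^sup>2))) * h (n - 1) ((cmod (\<zeta> (n - 1)))\<^sup>2))"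
    unfolding integral_mult_left_zero[symmetric] by (rule integral_complex_of_real)
  also have "(LINT w|vol {..<n - 1}. (\<Prod>j<n - 1. h j ((cmod (w j - \<zeta> j))\<^sup>2))) = (\<Prod>j<n - 1. LINT z|lborel. h j ((cmod (z - \<zeta> j))\<^sup>2))"
    unfolding vol_def
    by (rule vol.product_integral_prod[of _ "\<lambda>j z. h j ((cmod (z - \<zeta> j))\<^sup>2)"])
       (use h supp \<open>\<rho> > 0\<close> n in \<open>auto intro!: integrable_radial\<close>)
  finally show ?thesis .
qed

lemma ddc_radial_prod:
  assumes h1: "\<And>t. (h j has_real_derivative h1 t) (at t)" and h2: "\<And>t. (h1 has_real_derivative h2 t) (at t)"
    and j: "j < n"
  shows "ddc n \<phi> j j (radial_prod n h \<zeta>) = of_real ((LINT w|vol {..<n}. real_of_ereal (\<phi> w) *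
     real_radial_prod n (h(j := \<lambda>t. h1 t + t * h2 t)) \<zeta> w) / (2 * pi))"
  unfolding ddc_def d_z_d_zbar_radial_prod[of h j h1 h2, OF h1 h2 j] radial_prod_of_real of_real_mult[symmetric] integral_complex_of_real
  by simp

section \<open>Kernels at all scales and the exchange of scales\<close>

context log_kernel
begin

text \<open>The variable t is a squared radius: the kernel at scale \<tau> lives on the disc of
  radius \<open>sqrt \<tau>\<close>, and the division by \<tau> preserves its mass.\<close>

definition kern :: "real \<Rightarrow> real \<Rightarrow> real" where "kern \<tau> t = \<beta> (t / \<tau>) / \<tau>"
text \<open>The summand ln \<tau> makes the rescaled E agree with ln t beyond \<tau>, so the
  difference of two scales is compactly supported and can serve as a test function.\<close>

definition reg :: "real \<Rightarrow> real \<Rightarrow> real" where "reg \<tau> t = E (t / \<tau>) + ln \<tau>"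

lemma continuous_kern: "continuous_on UNIV (kern \<tau>)"
proof -
  have "continuous_on UNIV (\<lambda>t. \<beta> (t / \<tau>))" by (intro smooth_continuous smooth_uminus_diff smooth_\<beta>)
  then show ?thesis unfolding kern_def[abs_def] by (cases "\<tau> = 0") (auto intro!: continuous_intros)
qed

lemma smooth_kern: "smooth (kern \<tau>)"
  using smooth_intros(3)[OF smooth_intros(1)[of "1/\<tau>"] smooth_uminus_diff(3)[OF smooth_\<beta>, of \<tau>]]
  by (simp add: kern_def[abs_def])

lemma kern_nonneg: "\<tau> > 0 \<Longrightarrow> 0 \<le> kern \<tau> t"
  using \<beta>_nonneg by (simp add: kern_def)

lemma kern_support: "\<tau> > 0 \<Longrightarrow> \<tau> \<le> t \<Longrightarrow> kern \<tau> t = 0"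
  using \<beta>_support[of "t / \<tau>"] by (simp add: kern_def)

text \<open>The mass is \<pi> and not 1 because area is \<pi> dt in the variable t; this is the
  source of all factors \<open>pi ^ n\<close>.\<close>

lemma kern_mass:
  assumes "\<tau> > 0"
  shows "(\<integral>\<^sup>+z. ennreal (kern \<tau> ((cmod z)\<^sup>2)) \<partial>lborel) = ennreal pi"
proof -
  have [measurable]: "\<beta> \<in> borel_measurable borel"
    using smooth_continuous[OF smooth_\<beta>] by (rule borel_measurable_continuous_onI)
  have [measurable]: "kern \<tau> \<in> borel_measurable borel"
    using continuous_kern by (rule borel_measurable_continuous_onI)
  have "(\<integral>\<^sup>+z. ennreal (kern \<tau> ((cmod z)\<^sup>2)) \<partial>lborel)
      = ennreal pi * (\<integral>\<^sup>+t. ennreal (kern \<tau> t) * indicator {0..} t \<partial>lborel)"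
    by (rule nn_integral_radial[of "\<lambda>t. ennreal (kern \<tau> t)"]) measurable
  also have "(\<integral>\<^sup>+t. ennreal (kern \<tau> t) * indicator {0..} t \<partial>lborel) = (\<integral>\<^sup>+t. ennreal (kern \<tau> t) \<partial>lborel)"
    using \<beta>_support assms by (intro nn_integral_cong) (auto simp: indicator_def kern_def not_le divide_neg_pos less_imp_le)
  also have "\<dots> = ennreal \<tau> * (\<integral>\<^sup>+t. ennreal (kern \<tau> (0 + \<tau> * t)) \<partial>lborel)"
    using assms by (subst nn_integral_real_affine[where c = \<tau> and t = 0]) auto
  also have "\<dots> = (\<integral>\<^sup>+t. ennreal \<tau> * ennreal (kern \<tau> (0 + \<tau> * t)) \<partial>lborel)"
    by (subst nn_integral_cmult) auto
  also have "\<dots> = (\<integral>\<^sup>+t. ennreal (\<beta> t) \<partial>lborel)"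
    using assms by (intro nn_integral_cong) (simp add: kern_def ennreal_mult'[symmetric])
  finally show ?thesis by (simp add: \<beta>_mass)
qed

lemma kern_integral:
  assumes "\<tau> > 0"
  shows "(LINT z|lborel. kern \<tau> ((cmod (z - c))\<^sup>2)) = pi"
proof -
  have [measurable]: "kern \<tau> \<in> borel_measurable borel"
    using continuous_kern by (rule borel_measurable_continuous_onI)
  have "(\<integral>\<^sup>+z. ennreal (kern \<tau> ((cmod (z - c))\<^sup>2)) \<partial>lborel) = (\<integral>\<^sup>+z. ennreal (kern \<tau> ((cmod z)\<^sup>2)) \<partial>lborel)"
    by (subst (1) lborel_distr_plus[of c, symmetric]) (subst nn_integral_distr, auto)
  then show ?thesis
    using kern_nonneg[OF assms] by (subst integral_eq_nn_integral) (auto simp: kern_mass[OF assms])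
qed

lemma reg_derivs:
  assumes "\<tau> > 0"
  shows "(reg \<tau> has_real_derivative E1 (t / \<tau>) / \<tau>) (at t)"
    "((\<lambda>t. E1 (t / \<tau>) / \<tau>) has_real_derivative E2 (t / \<tau>) / \<tau> / \<tau>) (at t)"
    "E1 (t / \<tau>) / \<tau> + t * (E2 (t / \<tau>) / \<tau> / \<tau>) = kern \<tau> t"
proof -
  have d: "((\<lambda>t. t / \<tau>) has_real_derivative 1 / \<tau>) (at t)" by (rule DERIV_cdivide[OF DERIV_ident])
  show "(reg \<tau> has_real_derivative E1 (t / \<tau>) / \<tau>) (at t)"
    using DERIV_add[OF DERIV_chain2[OF DERIV_E d] DERIV_const[of "ln \<tau>"]] by (simp add: reg_def[abs_def])
  show "((\<lambda>t. E1 (t / \<tau>) / \<tau>) has_real_derivative E2 (t / \<tau>) / \<tau> / \<tau>) (at t)"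
    using DERIV_cdivide[OF DERIV_chain2[OF DERIV_E1 d], of \<tau>] by simp
  show "E1 (t / \<tau>) / \<tau> + t * (E2 (t / \<tau>) / \<tau> / \<tau>) = kern \<tau> t"
    using assms by (simp add: kern_def \<beta>_eq field_simps)
qed

lemma smooth_reg: "smooth (reg \<tau>)"
  unfolding reg_def[abs_def] by (intro smooth_intros smooth_uminus_diff smooth_E)

lemma reg_eq_ln: "\<tau> > 0 \<Longrightarrow> \<tau> \<le> t \<Longrightarrow> reg \<tau> t = ln t"
  using E_eq_ln[of "t / \<tau>"] by (simp add: reg_def ln_div)

definition kern_prod :: "nat \<Rightarrow> real \<Rightarrow> (nat \<Rightarrow> complex) \<Rightarrow> (nat \<Rightarrow> complex) \<Rightarrow> real" where
  "kern_prod n \<tau> = real_radial_prod n (\<lambda>_. kern \<tau>)"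

text \<open>The test functions that are \<open>reg \<tau> - reg \<mu>\<close> in one coordinate and kernels in the others
  replace the kernels of radius \<open>\<tau>\<close> by kernels of radius \<open>\<mu>\<close>, one coordinate at a time.\<close>

lemma average_identity:
  fixes \<phi> \<psi> :: "(nat \<Rightarrow> complex) \<Rightarrow> ereal"
  defines "V \<equiv> \<lambda>w. real_of_ereal (\<phi> w) - real_of_ereal (\<psi> w)"
  assumes n: "1 \<le> n" and U: "openin (Cn n) U" and Z: "Z = {w \<in> U. w (n - 1) = 0}"
    and int\<phi>: "integrable (vol {..<n}) (\<lambda>w. indicator P w * real_of_ereal (\<phi> w))"
    and int\<psi>: "integrable (vol {..<n}) (\<lambda>w. indicator P w * real_of_ereal (\<psi> w))"
    and cur: "\<And>f j. f \<in> test_functions n U \<Longrightarrow> j < n \<Longrightarrow>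
      ddc n \<phi> j j f - of_real \<eta> * integration_current n Z j j f = ddc n \<psi> j j f"
    and P: "cpolydisc n \<zeta> \<rho> \<subseteq> P" "P \<subseteq> U" and \<tau>: "0 < \<tau>" "\<tau> \<le> \<mu>" "\<mu> \<le> \<rho>\<^sup>2" "0 < \<rho>"
  shows "(LINT w|vol {..<n}. V w * kern_prod n \<tau> \<zeta> w) = (LINT w|vol {..<n}. V w * kern_prod n \<mu> \<zeta> w)
     + pi ^ n * \<eta> * (reg \<tau> ((cmod (\<zeta> (n - 1)))\<^sup>2) - reg \<mu> ((cmod (\<zeta> (n - 1)))\<^sup>2))"
proof -
  define g where "g t = reg \<tau> t - reg \<mu> t" for t
  have \<mu>: "\<mu> > 0" using \<tau> by linarith
  \<comment> \<open>After i exchanges the first i coordinates carry the scale \<mu>, the others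
    still \<tau>.\<close>
  define k where "k i = (\<lambda>j. if j < i then kern \<mu> else kern \<tau>)" for i :: nat
  define A where "A i = (LINT w|vol {..<n}. V w * real_radial_prod n (k i) \<zeta> w)" for i
  have kc: "continuous_on UNIV (k i j)" "smooth (k i j)" for i j
    using continuous_kern smooth_kern by (auto simp: k_def)
  have ks: "k i j t = 0" if "\<rho>\<^sup>2 \<le> t" for i j t
    using kern_support[of \<tau> t] kern_support[of \<mu> t] \<tau> \<mu> that by (auto simp: k_def)
  have gs: "g t = 0" if "\<rho>\<^sup>2 \<le> t" for t
    using reg_eq_ln[of \<tau> t] reg_eq_ln[of \<mu> t] \<tau> \<mu> that by (simp add: g_def)
  have smg: "smooth g" unfolding g_def[abs_def] by (intro smooth_uminus_diff smooth_reg)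
  define g1 where "g1 t = E1 (t / \<tau>) / \<tau> - E1 (t / \<mu>) / \<mu>" for t
  define g2 where "g2 t = E2 (t / \<tau>) / \<tau> / \<tau> - E2 (t / \<mu>) / \<mu> / \<mu>" for t
  have g1: "(g has_real_derivative g1 t) (at t)" for t
    unfolding g_def[abs_def] g1_def by (intro DERIV_diff reg_derivs \<tau> \<mu>)
  have g2: "(g1 has_real_derivative g2 t) (at t)" for t
    unfolding g1_def[abs_def] g2_def by (intro DERIV_diff reg_derivs \<tau> \<mu>)
  have g12: "g1 t + t * g2 t = kern \<tau> t - kern \<mu> t" for t
    using reg_derivs(3)[OF \<tau>(1), of t] reg_derivs(3)[OF \<mu>, of t] by (simp add: g1_def g2_def algebra_simps)
  have PU: "cpolydisc n \<zeta> \<rho> \<subseteq> U" using P by blast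
  \<comment> \<open>Exchanging the scale in coordinate i tests the (i, i) coefficient of the
    equation of currents, and the current of integration contributes for the normal
    coordinate.\<close>
  have step: "A i - A (Suc i) = (if i = n - 1 then pi ^ n * \<eta> * g ((cmod (\<zeta> (n - 1)))\<^sup>2) else 0)" if i: "i < n" for i
  proof -
    \<comment> \<open>With g in place of the i-th kernel, \<open>\<partial>dbar\<close> in the i-th
      variable is the difference of two kernel products, one with \<tau> and one with \<mu> in
      coordinate i.\<close>
    define h where "h = (k i)(i := g)"
    let ?h' = "h(i := \<lambda>t. g1 t + t * g2 t)"
    have h': "?h' = (k i)(i := \<lambda>t. kern \<tau> t - kern \<mu> t)" by (simp add: h_def g12)
    have hsm: "smooth (h j)" for j using kc smg by (simp add: h_def)
    have hs: "h j t = 0" if "\<rho>\<^sup>2 \<le> t" for j t using ks gs that by (simp add: h_def)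
    have test: "radial_prod n h \<zeta> \<in> test_functions n U"
      by (rule radial_prod_test_function[of n h \<rho>, OF hsm hs \<tau>(4) PU])
    have h'c: "continuous_on UNIV (?h' j)" for j
      unfolding h' using kc continuous_kern by (auto intro!: continuous_intros)
    have h's: "?h' j t = 0" if "\<rho>\<^sup>2 \<le> t" for j t
      unfolding h' using ks that kern_support[of \<tau> t] kern_support[of \<mu> t] \<tau> \<mu> by auto
    have i\<phi>: "integrable (vol {..<n}) (\<lambda>w. real_of_ereal (\<phi> w) * real_radial_prod n ?h' \<zeta> w)"
      by (rule integrable_times_radial_prod[of n P _ ?h' \<rho>, OF int\<phi> h'c h's \<tau>(4) P(1)])
    have i\<psi>: "integrable (vol {..<n}) (\<lambda>w. real_of_ereal (\<psi> w) * real_radial_prod n ?h' \<zeta> w)"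
      by (rule integrable_times_radial_prod[of n P _ ?h' \<rho>, OF int\<psi> h'c h's \<tau>(4) P(1)])
    have intV: "integrable (vol {..<n}) (\<lambda>w. indicator P w * V w)"
      using Bochner_Integration.integrable_diff[OF int\<phi> int\<psi>] by (simp add: V_def algebra_simps)
    have pr: "real_radial_prod n (k i) \<zeta> w - real_radial_prod n (k (Suc i)) \<zeta> w = real_radial_prod n ?h' \<zeta> w" for w
    proof -
      have upd: "real_radial_prod n ((k i)(i := f)) \<zeta> w
         = f ((cmod (w i - \<zeta> i))\<^sup>2) * (\<Prod>j\<in>{..<n} - {i}. k i j ((cmod (w j - \<zeta> j))\<^sup>2))" for f
        unfolding real_radial_prod_def using i
        by (subst prod.remove[of _ i]) (auto intro!: prod.cong arg_cong2[where f = "(*)"])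
      have "k i = (k i)(i := kern \<tau>)" by (auto simp: k_def)
      then have e1: "real_radial_prod n (k i) \<zeta> w = real_radial_prod n ((k i)(i := kern \<tau>)) \<zeta> w"
        by (rule arg_cong)
      have "k (Suc i) = (k i)(i := kern \<mu>)" by (auto simp: k_def fun_eq_iff)
      then have e2: "real_radial_prod n (k (Suc i)) \<zeta> w = real_radial_prod n ((k i)(i := kern \<mu>)) \<zeta> w"
        by (rule arg_cong)
      show ?thesis unfolding h' e1 e2 upd by (rule left_diff_distrib[symmetric])
    qed
    have "A i - A (Suc i) = (LINT w|vol {..<n}. V w * real_radial_prod n (k i) \<zeta> w - V w * real_radial_prod n (k (Suc i)) \<zeta> w)"
      unfolding A_def
      by (rule Bochner_Integration.integral_diff[symmetric]; rule integrable_times_radial_prod[of n P V "k _" \<rho>, OF intV kc(1) ks \<tau>(4) P(1)])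
    also have "\<dots> = (LINT w|vol {..<n}. real_of_ereal (\<phi> w) * real_radial_prod n ?h' \<zeta> w - real_of_ereal (\<psi> w) * real_radial_prod n ?h' \<zeta> w)"
      by (rule Bochner_Integration.integral_cong) (auto simp: V_def algebra_simps pr[symmetric])
    also have "\<dots> = (LINT w|vol {..<n}. real_of_ereal (\<phi> w) * real_radial_prod n ?h' \<zeta> w)
        - (LINT w|vol {..<n}. real_of_ereal (\<psi> w) * real_radial_prod n ?h' \<zeta> w)"
      by (rule Bochner_Integration.integral_diff[OF i\<phi> i\<psi>])
    finally have Aeq: "A i - A (Suc i) = \<dots>" .
    have hi: "h i = g" by (simp add: h_def)
    have "complex_of_real (A i - A (Suc i)) = of_real (2 * pi) * (ddc n \<phi> i i (radial_prod n h \<zeta>) - ddc n \<psi> i i (radial_prod n h \<zeta>))"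
      unfolding Aeq ddc_radial_prod[of h i g1 g2, unfolded hi, OF g1 g2 i] using pi_neq_zero
      by (simp add: field_simps)
    also have "\<dots> = of_real (2 * pi) * (of_real \<eta> * integration_current n Z i i (radial_prod n h \<zeta>))"
      using cur[OF test i] by (simp add: algebra_simps)
    also have "integration_current n Z i i (radial_prod n h \<zeta>) =
        (if i = n - 1 then (LINT w|vol ({..<n} - {n - 1}). radial_prod n h \<zeta> (w(n - 1 := 0))) / 2 else 0)"
    proof (rule integration_current_hyperplane[OF U n Z _ i])
      fix w assume "w \<in> topspace (Cn n) - U"
      then have "real_radial_prod n h \<zeta> w = 0"
        using PU by (intro real_radial_prod_outside[of n \<rho> h, OF hs \<tau>(4)]) (auto simp: topspace_Cn)
      then show "radial_prod n h \<zeta> w = 0" by (simp add: radial_prod_of_real)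
    qed
    \<comment> \<open>For i = n - 1 the constants combine as 2 \<pi> from the normalization of the
      curvature, 1/2 from the current of integration and \<pi> from each of the n - 1 tangential
      kernels.\<close>
    also have "of_real (2 * pi) * (of_real \<eta> * \<dots>) = complex_of_real (if i = n - 1 then pi ^ n * \<eta> * g ((cmod (\<zeta> (n - 1)))\<^sup>2) else 0)"
    proof (cases "i = n - 1")
      case True
      have "(\<Prod>j<n - 1. LINT z|lborel. h j ((cmod (z - \<zeta> j))\<^sup>2)) = pi ^ (n - 1)"
        using True kern_integral[OF \<tau>(1)] by (simp add: h_def k_def kern_integral \<tau> \<mu>)
      moreover have "h (n - 1) = g" using True hi by simp
      ultimately have "(LINT w|vol ({..<n} - {n - 1}). radial_prod n h \<zeta> (w(n - 1 := 0)))
         = of_real (pi ^ (n - 1) * g ((cmod (\<zeta> (n - 1)))\<^sup>2))"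
        using hyperplane_integral_radial_prod[of n h \<rho> \<zeta>, OF n smooth_continuous[OF hsm] hs \<tau>(4)] by simp
      moreover have "pi ^ n = pi * pi ^ (n - 1)" using n by (cases n) auto
      ultimately show ?thesis using True by simp
    qed simp
    finally show ?thesis by (simp only: of_real_eq_iff)
  qed
  have "A 0 - A n = (\<Sum>i<n. A i - A (Suc i))" by (rule sum_lessThan_telescope'[symmetric])
  also have "\<dots> = (\<Sum>i<n. if i = n - 1 then pi ^ n * \<eta> * g ((cmod (\<zeta> (n - 1)))\<^sup>2) else 0)"
    by (intro sum.cong step) auto
  also have "\<dots> = pi ^ n * \<eta> * g ((cmod (\<zeta> (n - 1)))\<^sup>2)" using n by simp
  finally have "A 0 = A n + pi ^ n * \<eta> * g ((cmod (\<zeta> (n - 1)))\<^sup>2)" by simp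
  moreover have "k 0 = (\<lambda>_. kern \<tau>)" by (simp add: k_def)
  moreover have "real_radial_prod n (k n) \<zeta> = real_radial_prod n (\<lambda>_. kern \<mu>) \<zeta>"
    unfolding real_radial_prod_def k_def by (intro ext prod.cong) auto
  ultimately show ?thesis by (simp add: A_def kern_prod_def g_def)
qed

end

section \<open>Separate holomorphy and division by a coordinate\<close>

text \<open>Every point of the smaller disc is the centre of a disc of radius r inside the domain,
  on which Cauchy's estimate bounds the derivative by B / r.\<close>

lemma holomorphic_slice_lipschitz:
  assumes f: "f holomorphic_on ball a (2 * r)" and B: "\<And>z. z \<in> ball a (2 * r) \<Longrightarrow> cmod (f z) \<le> B"
    and r: "r > 0" and y: "y \<in> ball a r" "z \<in> ball a r"
  shows "cmod (f y - f z) \<le> B / r * cmod (y - z)"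
proof -
  have sub: "cball x r \<subseteq> ball a (2 * r)" if "x \<in> ball a r" for x
    using that r by (intro cball_subset_ball_iff[THEN iffD2]) (auto simp: dist_commute)
  have "cmod (deriv f x) \<le> B / r" if x: "x \<in> ball a r" for x
  proof -
    have "cmod ((deriv ^^ 1) f x) \<le> fact 1 * B / r ^ 1"
    proof (rule Cauchy_inequality)
      show "f holomorphic_on ball x r"
        using f sub[OF x] by (meson ball_subset_cball holomorphic_on_subset order_trans)
      show "continuous_on (cball x r) f"
        using f sub[OF x] by (meson holomorphic_on_imp_continuous_on holomorphic_on_subset)
      show "cmod (f z) \<le> B" if "cmod (x - z) = r" for z
        using that sub[OF x] by (intro B) (auto simp: dist_norm subset_iff)
    qed (use r in auto)
    then show ?thesis by simp
  qed
  moreover have "(f has_field_derivative deriv f x) (at x within ball a r)" if "x \<in> ball a r" for x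
    by (rule has_field_derivative_at_within[OF holomorphic_derivI[OF f open_ball]]) (use that r in auto)
  ultimately show ?thesis
    using y by (intro field_differentiable_bound[of "ball a r" f "deriv f"]) auto
qed

lemma tendsto_atin_component:
  assumes "j < n" "W \<subseteq> topspace (Cn n)" "a \<in> W"
  shows "((\<lambda>w. w j) \<longlongrightarrow> a j) (atin (subtopology (Cn n) W) a)"
proof -
  have "continuous_map (subtopology (Cn n) W) euclidean (\<lambda>w. w j)"
    by (intro continuous_map_from_subtopology continuous_map_component_Cn assms)
  then show ?thesis using assms by (auto simp: continuous_map_atin Int_absorb1)
qed

text \<open>Osgood's lemma: separate holomorphy and local boundedness suffice, because Cauchy's estimate
  makes the function locally Lipschitz in each coordinate.\<close>

lemma holo_osgood:
  assumes W: "openin (Cn n) W"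
    and sep: "\<And>w j. w \<in> W \<Longrightarrow> j < n \<Longrightarrow> (\<lambda>t. f (w(j := t))) field_differentiable (at (w j))"
    and bdd: "\<And>a. a \<in> W \<Longrightarrow> \<exists>r>0. \<exists>B. polydisc n a r \<subseteq> W \<and> (\<forall>w\<in>polydisc n a r. cmod (f w) \<le> B)"
  shows "holo n W f"
proof -
  have Wt: "W \<subseteq> topspace (Cn n)" using W by (rule openin_subset)
  have "(f \<longlongrightarrow> f a) (atin (subtopology (Cn n) W) a)" if a: "a \<in> W" for a
  proof -
    obtain r' B where r': "r' > 0" "polydisc n a r' \<subseteq> W" "\<And>w. w \<in> polydisc n a r' \<Longrightarrow> cmod (f w) \<le> B"
      using bdd[OF a] by blast
    define r where "r = r' / 2"
    have r: "r > 0" "2 * r = r'" using r' by (auto simp: r_def)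
    have aext: "a \<in> extensional {..<n}" using a Wt by (auto simp: topspace_Cn)
    have lip: "cmod (f w - f a) \<le> (\<Sum>j<n. B / r * cmod (w j - a j))" if w: "w \<in> polydisc n a r" for w
    proof -
      \<comment> \<open>An axis-parallel path from w to a, replacing one coordinate per
        step.\<close>
      define v where "v k = (\<lambda>i. if i < k then a i else w i)" for k
      have vext: "v k \<in> extensional {..<n}" for k
        using w aext by (auto simp: v_def polydisc_iff extensional_def)
      have step: "cmod (f (v k) - f (v (Suc k))) \<le> B / r * cmod (w k - a k)" if k: "k < n" for k
      proof -
        have vin: "(v k)(k := y) \<in> polydisc n a r'" if "y \<in> ball (a k) (2 * r)" for y
        proof -
          have "cmod (v k j - a j) < r'" if "j < n" for j
            using w that r by (auto simp: v_def polydisc_iff intro: less_trans)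
          then show ?thesis using that vext[of k] k r
            by (auto simp: polydisc_iff extensional_def dist_norm norm_minus_commute)
        qed
        have hol: "(\<lambda>y. f ((v k)(k := y))) holomorphic_on ball (a k) (2 * r)"
          unfolding holomorphic_on_def
        proof
          fix y assume "y \<in> ball (a k) (2 * r)"
          then have "(v k)(k := y) \<in> W" using vin r' by blast
          from sep[OF this k] show "(\<lambda>y. f ((v k)(k := y))) field_differentiable at y within ball (a k) (2 * r)"
            by (simp add: field_differentiable_at_within)
        qed
        have "cmod (f ((v k)(k := w k)) - f ((v k)(k := a k))) \<le> B / r * cmod (w k - a k)"
          by (rule holomorphic_slice_lipschitz[OF hol])
             (use vin r' r w k in \<open>auto simp: polydisc_iff dist_norm norm_minus_commute\<close>)
        moreover have "(v k)(k := w k) = v k" "(v k)(k := a k) = v (Suc k)"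
          by (auto simp: v_def fun_eq_iff)
        ultimately show ?thesis by simp
      qed
      have "v 0 = w" by (simp add: v_def)
      moreover have "v n = a" using w aext by (auto simp: v_def fun_eq_iff polydisc_iff extensional_def)
      ultimately have "f w - f a = (\<Sum>k<n. f (v k) - f (v (Suc k)))"
        using sum_lessThan_telescope'[of "\<lambda>k. f (v k)" n] by simp
      also have "cmod \<dots> \<le> (\<Sum>k<n. B / r * cmod (w k - a k))"
        by (intro sum_norm_le step) auto
      finally show ?thesis .
    qed
    have ev: "eventually (\<lambda>w. w \<in> polydisc n a r) (atin (subtopology (Cn n) W) a)"
      unfolding eventually_atin using a Wt aext r
      by (intro disjI2 exI[of _ "W \<inter> polydisc n a r"])
         (auto simp: polydisc_iff openin_subtopology_Int2 openin_polydisc)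
    have "((\<lambda>w. \<Sum>j<n. B / r * cmod (w j - a j)) \<longlongrightarrow> (\<Sum>j<n. B / r * cmod (a j - a j))) (atin (subtopology (Cn n) W) a)"
      by (intro tendsto_intros tendsto_atin_component) (use a Wt in auto)
    then have "((\<lambda>w. \<Sum>j<n. B / r * cmod (w j - a j)) \<longlongrightarrow> 0) (atin (subtopology (Cn n) W) a)" by simp
    then have "((\<lambda>w. f w - f a) \<longlongrightarrow> 0) (atin (subtopology (Cn n) W) a)"
      by (rule Lim_null_comparison[rotated]) (use ev lip in \<open>auto elim: eventually_mono\<close>)
    then show ?thesis by (rule LIM_zero_cancel)
  qed
  then have "continuous_map (subtopology (Cn n) W) euclidean f"
    using Wt by (simp add: continuous_map_atin Int_absorb1)
  then show ?thesis using W sep by (simp add: holo_def)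
qed

section \<open>Division by a power of the normal coordinate\<close>

lemma holo_bounded_on_cpolydisc:
  assumes "holo n W f" "cpolydisc n a r \<subseteq> W"
  obtains B where "B > 0" "\<And>w. w \<in> cpolydisc n a r \<Longrightarrow> cmod (f w) \<le> B"
proof -
  have "compactin (subtopology (Cn n) W) (cpolydisc n a r)"
    using assms(2) compactin_cpolydisc by (auto simp: compactin_subtopology)
  then have "compactin euclidean (f ` cpolydisc n a r)"
    by (rule image_compactin) (use assms(1) in \<open>simp add: holo_def\<close>)
  then have "bounded (f ` cpolydisc n a r)" by (simp add: compact_imp_bounded)
  then show ?thesis using that unfolding bounded_pos by (metis imageI)
qed

text \<open>On a normal line, k < p + 1 gives t f / t^k \<rightarrow> 0, so the quotient has a
  removable singularity. The maximum principle on normal lines bounds all quotients uniformly. In a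
  tangential coordinate the quotient is holomorphic even on the hyperplane, as a uniform limit of
  quotients off it, and Osgood's lemma assembles these facts.\<close>

lemma holo_divide_power:
  assumes f: "holo n W f" and n: "1 \<le> n" and r: "r > 0" and W: "cpolydisc n a (2 * r) \<subseteq> W"
    and a: "a \<in> extensional {..<n}" "a (n - 1) = 0"
    and C: "\<And>w. w \<in> cpolydisc n a (2 * r) \<Longrightarrow> w (n - 1) \<noteq> 0 \<Longrightarrow> cmod (f w) \<le> C * cmod (w (n - 1)) powr p"
    and p: "real k < p + 1"
  obtains g where "holo n (polydisc n a (2 * r)) g" "\<And>w. w \<in> polydisc n a (2 * r) \<Longrightarrow> f w = w (n - 1) ^ k * g w"
proof -
  let ?K = "cpolydisc n a (2 * r)" and ?P = "polydisc n a (2 * r)"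
  define m where "m = n - 1"
  have m: "m < n" using n by (simp add: m_def)
  obtain B where B: "B > 0" "\<And>w. w \<in> ?K \<Longrightarrow> cmod (f w) \<le> B" using holo_bounded_on_cpolydisc[OF f W] by metis
  have upd: "w(m := t) \<in> ?K" if "w \<in> ?K" "cmod t \<le> 2 * r" for w t
    using that m a by (auto simp: cpolydisc_iff extensional_def m_def)
  have ex: "\<exists>G. G holomorphic_on {t. w(m := t) \<in> W} \<and> (\<forall>t\<in>{t. w(m := t) \<in> W} - {0}. G t = f (w(m := t)) / t ^ k)"
    if w: "w \<in> ?K" for w
  proof -
    let ?S = "{t. w(m := t) \<in> W}"
    have wext: "w \<in> extensional {..<n}" using w by (simp add: cpolydisc_iff)
    note sl = holo_slice[OF f wext m]
    have 0: "0 \<in> ?S" using upd[OF w, of 0] W r by auto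
    have "(\<lambda>t. f (w(m := t)) / t ^ k) holomorphic_on ?S - {0}"
      by (intro holomorphic_intros holomorphic_on_subset[OF sl(2)]) auto
    moreover have "0 \<in> interior ?S" using 0 sl(1) by (simp add: interior_open)
    moreover have "((\<lambda>t. (t - 0) * (f (w(m := t)) / t ^ k)) \<longlongrightarrow> 0) (at 0)"
    proof (rule Lim_null_comparison)
      show "((\<lambda>t. C * cmod t powr (p + 1 - k)) \<longlongrightarrow> 0) (at (0::complex))"
      proof -
        have "((\<lambda>t. C * cmod t powr (p + 1 - k)) \<longlongrightarrow> C * 0) (at (0::complex))"
        proof (intro tendsto_mult tendsto_const)
          have "((\<lambda>t. cmod t powr (p + 1 - k)) \<longlongrightarrow> cmod (0::complex) powr (p + 1 - k)) (at (0::complex))"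
            using p by (intro tendsto_powr' tendsto_intros) (auto simp: eventually_at_filter)
          then show "((\<lambda>t. cmod t powr (p + 1 - k)) \<longlongrightarrow> 0) (at (0::complex))" using p by simp
        qed
        then show ?thesis by simp
      qed
      have "eventually (\<lambda>t. t \<in> ball 0 (2 * r)) (at (0::complex))"
        using r by (intro eventually_at_in_open') auto
      moreover have "eventually (\<lambda>t. t \<noteq> 0) (at (0::complex))" by (simp add: eventually_at_filter)
      ultimately show "eventually (\<lambda>t. cmod ((t - 0) * (f (w(m := t)) / t ^ k)) \<le> C * cmod t powr (p + 1 - k)) (at (0::complex))"
      proof eventually_elim
        case (elim t)
        then have "cmod (f (w(m := t))) \<le> C * cmod t powr p"
          using C[OF upd[OF w, of t]] by (simp add: m_def)
        then have "cmod t * cmod (f (w(m := t))) / cmod t ^ k \<le> cmod t * (C * cmod t powr p) / cmod t ^ k"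
          by (intro divide_right_mono mult_left_mono) auto
        also have "\<dots> = C * cmod t powr (p + 1 - k)"
          using elim by (simp add: powr_add powr_diff powr_realpow)
        finally show ?case by (simp add: norm_mult norm_divide norm_power)
      qed
    qed
    ultimately show ?thesis
      using holomorphic_on_extend_lim[of "\<lambda>t. f (w(m := t)) / t ^ k" ?S 0] by auto
  qed
  \<comment> \<open>On the hyperplane the value is the limit along the normal line, which is the
    value filling the removable singularity.\<close>
  define g where "g w = (if w m \<noteq> 0 then f w / w m ^ k else Lim (at 0) (\<lambda>t. f (w(m := t)) / t ^ k))" for w
  have slice: "\<exists>G. G holomorphic_on {t. w(m := t) \<in> W} \<and> (\<forall>t\<in>cball 0 (2 * r). G t = g (w(m := t)) \<and> f (w(m := t)) = t ^ k * G t)"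
    if w: "w \<in> ?K" for w
  proof -
    let ?S = "{t. w(m := t) \<in> W}"
    obtain G where G: "G holomorphic_on ?S" "\<And>t. t \<in> ?S \<Longrightarrow> t \<noteq> 0 \<Longrightarrow> G t = f (w(m := t)) / t ^ k"
      using ex[OF w] by auto
    have wext: "w \<in> extensional {..<n}" using w by (simp add: cpolydisc_iff)
    note sl = holo_slice[OF f wext m]
    have S: "t \<in> ?S" if "t \<in> cball 0 (2 * r)" for t using upd[OF w, of t] that W by auto
    have 0: "0 \<in> ?S" using S r by auto
    have near: "eventually (\<lambda>t. t \<in> ?S \<and> t \<noteq> 0) (at 0)"
      using eventually_at_in_open'[OF sl(1), of 0] 0 eventually_neq_at_within[of 0 0 UNIV] by (auto elim: eventually_elim2)
    have G0: "(G \<longlongrightarrow> G 0) (at 0)"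
      using holomorphic_on_imp_continuous_on[OF G(1)] sl(1) 0 continuous_on_eq_continuous_at isCont_def by blast
    have f0: "((\<lambda>t. f (w(m := t))) \<longlongrightarrow> f (w(m := 0))) (at 0)"
      using holomorphic_on_imp_continuous_on[OF sl(2)] sl(1) 0 continuous_on_eq_continuous_at isCont_def by blast
    have "((\<lambda>t. f (w(m := t)) / t ^ k) \<longlongrightarrow> G 0) (at 0)"
      by (rule Lim_transform_eventually[OF G0]) (use near G(2) in \<open>auto elim: eventually_mono\<close>)
    then have L: "Lim (at 0) (\<lambda>t. f (w(m := t)) / t ^ k) = G 0" by (intro tendsto_Lim) auto
    have "((\<lambda>t. t ^ k * G t) \<longlongrightarrow> 0 ^ k * G 0) (at 0)" by (intro tendsto_intros G0)
    moreover have "((\<lambda>t. t ^ k * G t) \<longlongrightarrow> f (w(m := 0))) (at 0)"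
      by (rule Lim_transform_eventually[OF f0]) (use near G(2) in \<open>auto elim!: eventually_mono\<close>)
    ultimately have F0: "f (w(m := 0)) = 0 ^ k * G 0" using tendsto_unique trivial_limit_at by blast
    have "G t = g (w(m := t)) \<and> f (w(m := t)) = t ^ k * G t" if "t \<in> cball 0 (2 * r)" for t
      using G(2)[OF S[OF that]] L F0 by (cases "t = 0") (auto simp: g_def)
    then show ?thesis using G(1) by blast
  qed
  have slice_holo: "(\<lambda>t. g (w(m := t))) holomorphic_on ball 0 (2 * r)" if w: "w \<in> ?K" for w
  proof -
    obtain G where G: "G holomorphic_on {t. w(m := t) \<in> W}" "\<And>t. t \<in> cball 0 (2 * r) \<Longrightarrow> G t = g (w(m := t))"
      using slice[OF w] by blast
    have "G holomorphic_on ball 0 (2 * r)" using upd[OF w] W by (intro holomorphic_on_subset[OF G(1)]) auto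
    then show ?thesis by (rule holomorphic_transform) (use G(2) in auto)
  qed
  \<comment> \<open>The bound of f divided by \<bar>t\<bar>^k on the circle \<bar>t\<bar> = 2 r,
    where the maximum principle is applied.\<close>
  define B' where "B' = B / (2 * r) ^ k"
  have gB: "cmod (g w) \<le> B'" if w: "w \<in> ?K" for w
  proof -
    obtain G where G: "G holomorphic_on {t. w(m := t) \<in> W}"
      "\<And>t. t \<in> cball 0 (2 * r) \<Longrightarrow> G t = g (w(m := t))" "\<And>t. t \<in> cball 0 (2 * r) \<Longrightarrow> f (w(m := t)) = t ^ k * G t"
      using slice[OF w] by blast
    have sub: "cball 0 (2 * r) \<subseteq> {t. w(m := t) \<in> W}" using upd[OF w] W by auto
    have wm: "w m \<in> cball 0 (2 * r)" using w m a by (auto simp: cpolydisc_iff m_def)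
    have "cmod (G (w m)) \<le> B'"
    proof (rule maximum_modulus_frontier[of G "cball 0 (2 * r)"])
      show "G holomorphic_on interior (cball 0 (2 * r))"
        using sub interior_subset by (intro holomorphic_on_subset[OF G(1)]) blast
      show "continuous_on (closure (cball 0 (2 * r))) G"
        using sub by (intro holomorphic_on_imp_continuous_on holomorphic_on_subset[OF G(1)]) auto
      fix t :: complex assume "t \<in> frontier (cball 0 (2 * r))"
      then have t: "cmod t = 2 * r" using r by simp
      have "(2 * r) ^ k * cmod (G t) = cmod (f (w(m := t)))"
        using G(3)[of t] t by (simp add: norm_mult norm_power)
      also have "\<dots> \<le> B" using B upd[OF w, of t] t by simp
      finally show "cmod (G t) \<le> B'" using r by (simp add: B'_def field_simps)
    qed (use wm in auto)
    moreover have "G (w m) = g w" using G(2)[OF wm] by simp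
    ultimately show ?thesis by simp
  qed
  have PK: "?P \<subseteq> ?K" by (rule polydisc_subset_cpolydisc)
  have sep: "(\<lambda>t. g (w(j := t))) field_differentiable (at (w j))" if w: "w \<in> ?P" and j: "j < n" for w j
  proof (cases "j = m")
    case True
    have "w m \<in> ball 0 (2 * r)" using w m a by (auto simp: polydisc_iff m_def)
    then show ?thesis using slice_holo[of w] w PK True
      by (auto simp: holomorphic_on_open field_differentiable_def)
  next
    case jm: False
    let ?S = "ball (a j) (2 * r)"
    have wj: "w j \<in> ?S" using w j by (auto simp: polydisc_iff dist_norm norm_minus_commute)
    have inP: "w(j := y, m := t) \<in> ?P" if "y \<in> ?S" "cmod t < 2 * r" for y t
      using that w j m a by (auto simp: polydisc_iff extensional_def dist_norm norm_minus_commute m_def)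
    have hol1: "(\<lambda>y. g (w(j := y, m := t))) holomorphic_on ?S" if t: "t \<noteq> 0" "cmod t < 2 * r" for t
    proof -
      have wext: "w(m := t) \<in> extensional {..<n}" using w m by (auto simp: polydisc_iff extensional_def)
      have eq: "w(m := t, j := y) = w(j := y, m := t)" for y using jm by (auto simp: fun_upd_twist)
      have "(\<lambda>y. f (w(j := y, m := t)) / t ^ k) holomorphic_on ?S"
      proof (intro holomorphic_intros holomorphic_on_subset[OF holo_slice(2)[OF f wext j, unfolded eq]])
        show "?S \<subseteq> {y. w(j := y, m := t) \<in> W}" using inP[OF _ t(2)] PK W by blast
      qed (use t in auto)
      then show ?thesis by (rule holomorphic_transform) (use t in \<open>auto simp: g_def\<close>)
    qed
    have "(\<lambda>y. g (w(j := y, m := w m))) holomorphic_on ?S"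
    proof (cases "w m = 0")
      case False
      moreover have "cmod (w m) < 2 * r" using w m a by (auto simp: polydisc_iff m_def)
      ultimately show ?thesis by (rule hol1)
    next
      case True
      \<comment> \<open>A sequence of nonzero numbers tending to 0; the 2 in the denominator keeps
        them below r, inside the disc of the Lipschitz estimate.\<close>
      define t where "t N = complex_of_real (r / (2 + real N))" for N
      have t: "t N \<noteq> 0" "cmod (t N) < r" for N
      proof -
        have "r / (2 + real N) \<noteq> 0" using r by (simp add: add_nonneg_eq_0_iff)
        then show "t N \<noteq> 0" unfolding t_def by (simp only: of_real_eq_0_iff not_False_eq_True)
        have "r / (2 + real N) < r" using r by (simp add: divide_less_eq)
        then show "cmod (t N) < r" using r by (simp only: t_def norm_of_real) (simp add: abs_of_pos)
      qed
      have "(\<lambda>y. g (w(j := y, m := 0))) holomorphic_on ?S"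
      proof (rule holomorphic_uniform_sequence)
        show "(\<lambda>y. g (w(j := y, m := t N))) holomorphic_on ?S" for N
          using t[of N] r by (intro hol1) auto
        fix x assume "x \<in> ?S"
        then obtain d where d: "d > 0" "cball x d \<subseteq> ?S" using open_contains_cball open_ball by metis
        have "uniform_limit (cball x d) (\<lambda>N y. g (w(j := y, m := t N))) (\<lambda>y. g (w(j := y, m := 0))) sequentially"
        proof (rule uniform_limitI)
          fix e :: real assume e: "e > 0"
          have "(\<lambda>N. B' / r * cmod (t N)) \<longlonglongrightarrow> B' / r * 0"
          proof (intro tendsto_mult tendsto_const)
            have "(\<lambda>N. r / (2 + real N)) \<longlonglongrightarrow> 0" by real_asymp
            then show "(\<lambda>N. cmod (t N)) \<longlonglongrightarrow> 0" unfolding t_def norm_of_real by (rule tendsto_rabs_zero)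
          qed
          then have "eventually (\<lambda>N. B' / r * cmod (t N) < e) sequentially"
            using e by (intro order_tendstoD(2)[of _ "B' / r * 0"]) auto
          then show "\<forall>\<^sub>F N in sequentially. \<forall>y\<in>cball x d. dist (g (w(j := y, m := t N))) (g (w(j := y, m := 0))) < e"
          proof eventually_elim
            case (elim N)
            show ?case
            proof
              fix y assume "y \<in> cball x d"
              then have "y \<in> ?S" using d by blast
              then have "w(j := y, m := 0) \<in> ?K" using inP[of y 0] r PK by auto
              note K = this
              have "cmod (g ((w(j := y, m := 0))(m := t N)) - g ((w(j := y, m := 0))(m := 0))) \<le> B' / r * cmod (t N - 0)"
                by (rule holomorphic_slice_lipschitz[OF slice_holo[OF K] gB[OF upd[OF K]]]) (use t[of N] r in auto)
              then show "dist (g (w(j := y, m := t N))) (g (w(j := y, m := 0))) < e"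
                using elim by (simp add: dist_norm)
            qed
          qed
        qed
        then show "\<exists>d>0. cball x d \<subseteq> ?S \<and> uniform_limit (cball x d) (\<lambda>N y. g (w(j := y, m := t N))) (\<lambda>y. g (w(j := y, m := 0))) sequentially"
          using d by blast
      qed auto
      then show ?thesis by (simp add: True)
    qed
    moreover have "w(j := y, m := w m) = w(j := y)" for y using jm by (auto simp: fun_eq_iff)
    ultimately show ?thesis using wj by (auto simp: holomorphic_on_open field_differentiable_def)
  qed
  have "holo n ?P g"
  proof (rule holo_osgood[OF openin_polydisc sep])
    fix b assume b: "b \<in> ?P"
    obtain e where e: "e > 0" "cpolydisc n b e \<subseteq> ?P" using cpolydisc_in_open[OF openin_polydisc b] by (rule cpolydisc_in_open[OF openin_polydisc b])
    have "polydisc n b e \<subseteq> ?P" using e(2) polydisc_subset_cpolydisc[of n b e] by (rule order.trans[rotated])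
    moreover from this have "\<forall>w\<in>polydisc n b e. cmod (g w) \<le> B'" using PK gB by blast
    ultimately show "\<exists>r'>0. \<exists>B. polydisc n b r' \<subseteq> ?P \<and> (\<forall>w\<in>polydisc n b r'. cmod (g w) \<le> B)"
      using e(1) by (intro exI[of _ e] conjI exI[of _ B'])
  qed
  moreover have "f w = w (n - 1) ^ k * g w" if "w \<in> ?P" for w
  proof -
    have wK: "w \<in> ?K" using that PK by blast
    have wm: "w m \<in> cball 0 (2 * r)" using wK m a by (auto simp: cpolydisc_iff m_def)
    obtain G where "\<And>t. t \<in> cball 0 (2 * r) \<Longrightarrow> G t = g (w(m := t))" "\<And>t. t \<in> cball 0 (2 * r) \<Longrightarrow> f (w(m := t)) = t ^ k * G t"
      using slice[OF wK] by blast
    from this[OF wm] show ?thesis by (simp add: m_def)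
  qed
  ultimately show ?thesis using that by blast
qed

section \<open>Local integrability from mean inequalities\<close>

lemma emeasure_cpolydisc_finite: "emeasure (vol {..<n}) (cpolydisc n a r) < \<infinity>"
proof -
  have "emeasure (vol {..<n}) (cpolydisc n a r) = (\<Prod>j<n. emeasure lborel (cball (a j) r))"
    unfolding vol_def cpolydisc_def by (subst vol.emeasure_PiM) auto
  also have "\<dots> < \<infinity>"
    using emeasure_lborel_cball_finite by (auto simp: less_top[symmetric] ennreal_prod_eq_top)
  finally show ?thesis .
qed

lemma emeasure_polydisc_finite: "emeasure (vol {..<n}) (polydisc n a r) < \<infinity>"
  using emeasure_mono[OF polydisc_subset_cpolydisc cpolydisc_sets] emeasure_cpolydisc_finite
  by (rule order.strict_trans1)

text \<open>A finite integral of C - \<phi> excludes the value -\<infinity> almost everywhere, and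
  off that null set the real value of \<phi> is C minus an integrable function.\<close>

lemma finite_nn_integral_imp_integrable:
  fixes \<phi> :: "(nat \<Rightarrow> complex) \<Rightarrow> ereal"
  assumes meas: "(\<lambda>w. if w \<in> P then \<phi> w else 0) \<in> borel_measurable (vol {..<n})" and P: "P = polydisc n a r"
    and C: "\<And>w. w \<in> P \<Longrightarrow> \<phi> w \<le> ereal C"
    and fin: "(\<integral>\<^sup>+w\<in>P. e2ennreal (ereal C - \<phi> w) \<partial>vol {..<n}) < \<infinity>"
  shows "integrable (vol {..<n}) (\<lambda>w. indicator P w * real_of_ereal (\<phi> w))"
    and "AE w in vol {..<n}. w \<in> P \<longrightarrow> \<phi> w \<noteq> -\<infinity>"
proof -
  let ?M = "vol {..<n}"
  have PM [measurable]: "P \<in> sets ?M" unfolding P by (rule polydisc_sets)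
  define \<phi>' where "\<phi>' w = (if w \<in> P then \<phi> w else 0)" for w
  have [measurable]: "\<phi>' \<in> borel_measurable ?M" using meas by (simp add: \<phi>'_def[abs_def])
  define H where "H w = e2ennreal (ereal C - \<phi>' w) * indicator P w" for w
  have [measurable]: "H \<in> borel_measurable ?M" unfolding H_def by measurable
  have finH: "(\<integral>\<^sup>+w. H w \<partial>?M) < \<infinity>"
  proof -
    have "(\<integral>\<^sup>+w. H w \<partial>?M) = (\<integral>\<^sup>+w\<in>P. e2ennreal (ereal C - \<phi> w) \<partial>?M)"
      by (intro nn_integral_cong) (auto simp: H_def \<phi>'_def indicator_def)
    then show ?thesis using fin by simp
  qed
  have AE: "AE w in ?M. H w \<noteq> \<infinity>" using finH by (intro nn_integral_PInf_AE) auto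
  show AE2: "AE w in ?M. w \<in> P \<longrightarrow> \<phi> w \<noteq> -\<infinity>"
    using AE by eventually_elim (auto simp: H_def \<phi>'_def indicator_def)
  have "integrable ?M (\<lambda>w. enn2real (H w))"
  proof (rule integrableI_nonneg)
    have "(\<integral>\<^sup>+w. ennreal (enn2real (H w)) \<partial>?M) \<le> (\<integral>\<^sup>+w. H w \<partial>?M)"
    proof (rule nn_integral_mono)
      show "ennreal (enn2real (H w)) \<le> H w" for w by (cases "H w") auto
    qed
    then show "(\<integral>\<^sup>+w. ennreal (enn2real (H w)) \<partial>?M) < \<infinity>" using finH by (rule order.strict_trans1)
  qed auto
  moreover have "integrable ?M (\<lambda>w. indicator P w * C)"
    using emeasure_polydisc_finite[of n a r] by (intro integrable_mult_left integrable_real_indicator) (auto simp: P)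
  ultimately have int: "integrable ?M (\<lambda>w. indicator P w * C - enn2real (H w))"
    by (rule Bochner_Integration.integrable_diff[rotated])
  have meas2: "(\<lambda>w. indicator P w * real_of_ereal (\<phi> w)) \<in> borel_measurable ?M"
  proof -
    have "(\<lambda>w. real_of_ereal (\<phi>' w)) \<in> borel_measurable ?M" by measurable
    moreover have "real_of_ereal (\<phi>' w) = indicator P w * real_of_ereal (\<phi> w)" for w
      by (simp add: \<phi>'_def)
    ultimately show ?thesis by (simp cong: measurable_cong)
  qed
  have "AE w in ?M. indicator P w * C - enn2real (H w) = indicator P w * real_of_ereal (\<phi> w)"
    using AE2
  proof eventually_elim
    case (elim w)
    show ?case
    proof (cases "w \<in> P")
      case True
      then have "\<phi> w \<le> ereal C" "\<phi> w \<noteq> -\<infinity>" using C elim by auto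
      then obtain x where x: "\<phi> w = ereal x" "x \<le> C" by (cases "\<phi> w") auto
      then show ?thesis using True by (simp add: H_def \<phi>'_def)
    qed (simp add: H_def)
  qed
  then show "integrable ?M (\<lambda>w. indicator P w * real_of_ereal (\<phi> w))"
    using integrable_cong_AE_imp[OF int meas2] by (simp add: eq_commute)
qed

text \<open>One point p with H p finite is enough: the polydisc of radius 2 R about p covers the one
  of radius R about a, and the mean inequality is used with the indicator of a disc as
  kernel.\<close>

lemma finite_from_supermean:
  assumes le: "(\<integral>\<^sup>+w. (\<Prod>j<n. indicator {..(2 * R)\<^sup>2} ((cmod (w j - p j))\<^sup>2)) * H w \<partial>vol {..<n})
      \<le> (\<integral>\<^sup>+z. indicator {..(2 * R)\<^sup>2} ((cmod z)\<^sup>2) \<partial>lborel) ^ n * H p"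
    and "H p < \<infinity>" and p: "p \<in> polydisc n a R" and R: "R > 0"
  shows "(\<integral>\<^sup>+w\<in>polydisc n a R. H w \<partial>vol {..<n}) < \<infinity>"
proof -
  have "indicator (polydisc n a R) w \<le> (\<Prod>j<n. indicator {..(2 * R)\<^sup>2} ((cmod (w j - p j))\<^sup>2) :: ennreal)" for w
  proof (cases "w \<in> polydisc n a R")
    case True
    have "cmod (w j - p j) \<le> 2 * R" if "j < n" for j
    proof -
      have "cmod (w j - p j) \<le> cmod (w j - a j) + cmod (p j - a j)"
        using norm_triangle_ineq4[of "w j - a j" "p j - a j"] by simp
      moreover have "cmod (w j - a j) < R" "cmod (p j - a j) < R" using True p that by (auto simp: polydisc_iff)
      ultimately show ?thesis by linarith
    qed
    then have "(cmod (w j - p j))\<^sup>2 \<le> (2 * R)\<^sup>2" if "j < n" for j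
      using that by (intro power_mono) auto
    then have "(\<Prod>j<n. indicator {..(2 * R)\<^sup>2} ((cmod (w j - p j))\<^sup>2) :: ennreal) = 1"
      by (intro prod.neutral ballI indicator_simps(1)) auto
    then show ?thesis by (simp add: indicator_def)
  qed simp
  then have "(\<integral>\<^sup>+w\<in>polydisc n a R. H w \<partial>vol {..<n})
     \<le> (\<integral>\<^sup>+w. (\<Prod>j<n. indicator {..(2 * R)\<^sup>2} ((cmod (w j - p j))\<^sup>2)) * H w \<partial>vol {..<n})"
    by (intro nn_integral_mono) (simp add: mult.commute[of "H _"] mult_right_mono)
  also note le
  also have "(\<integral>\<^sup>+z. indicator {..(2 * R)\<^sup>2} ((cmod z)\<^sup>2) \<partial>lborel) ^ n * H p < \<infinity>"
  proof -
    have "(\<integral>\<^sup>+z. indicator {..(2 * R)\<^sup>2} ((cmod z)\<^sup>2) \<partial>lborel) \<le> (\<integral>\<^sup>+z. indicator (cball (0::complex) (2 * R)) z \<partial>lborel)"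
      using R abs_le_square_iff[of "cmod _" "2 * R"] by (intro nn_integral_mono) (auto simp: indicator_def)
    also have "\<dots> < \<infinity>" using emeasure_lborel_cball_finite[of "0::complex" "2 * R"] by simp
    finally show ?thesis using \<open>H p < \<infinity>\<close>
      unfolding infinity_ennreal_def by (simp only: ennreal_mult_less_top power_less_top_ennreal simp_thms)
  qed
  finally show ?thesis .
qed

lemma indicator_atMost_kernel:
  "(indicator {..(c::real)} :: real \<Rightarrow> ennreal) \<in> borel_measurable borel"
  "c < t \<Longrightarrow> (indicator {..(c::real)} t :: ennreal) = 0"
  by auto

text \<open>The definition of \<open>psh\<close> supplies a point of the small polydisc at which
  \<psi> is finite; the radius 4 R leaves room for the polydisc of radius 2 R about that
  point.\<close>

lemma psh_locally_integrable:
  assumes \<psi>: "psh n U \<psi>" and U: "cpolydisc n a (4 * R) \<subseteq> U" and R: "R > 0" and a: "a \<in> extensional {..<n}"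
    and C: "\<And>w. w \<in> cpolydisc n a (4 * R) \<Longrightarrow> \<psi> w \<le> ereal C"
  shows "integrable (vol {..<n}) (\<lambda>w. indicator (polydisc n a R) w * real_of_ereal (\<psi> w))"
    and "AE w in vol {..<n}. w \<in> polydisc n a R \<longrightarrow> \<psi> w \<noteq> -\<infinity>"
proof -
  have PU: "polydisc n a R \<subseteq> cpolydisc n a (4 * R)" using R by (fastforce simp: polydisc_iff cpolydisc_iff)
  have "a \<in> polydisc n a R" using a R by (simp add: polydisc_iff)
  then obtain p where p: "p \<in> polydisc n a R" "\<psi> p \<noteq> -\<infinity>"
    using \<psi> openin_polydisc[of n a R] PU U unfolding psh_def by (metis empty_iff order.trans)
  have sub: "cpolydisc n p (2 * R) \<subseteq> cpolydisc n a (4 * R)"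
  proof
    fix w assume w: "w \<in> cpolydisc n p (2 * R)"
    have "cmod (w j - a j) \<le> 4 * R" if "j < n" for j
    proof -
      have "cmod (w j - a j) \<le> cmod (w j - p j) + cmod (p j - a j)"
        using norm_triangle_ineq[of "w j - p j" "p j - a j"] by simp
      moreover have "cmod (w j - p j) \<le> 2 * R" "cmod (p j - a j) < R" using w p that by (auto simp: polydisc_iff cpolydisc_iff)
      ultimately show ?thesis using R by linarith
    qed
    then show "w \<in> cpolydisc n a (4 * R)" using w by (simp add: cpolydisc_iff)
  qed
  have fin: "(\<integral>\<^sup>+w\<in>polydisc n a R. e2ennreal (ereal C - \<psi> w) \<partial>vol {..<n}) < \<infinity>"
  proof (rule finite_from_supermean[OF _ _ p(1) R])
    show "(\<integral>\<^sup>+w. (\<Prod>j<n. indicator {..(2 * R)\<^sup>2} ((cmod (w j - p j))\<^sup>2)) * e2ennreal (ereal C - \<psi> w) \<partial>vol {..<n})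
      \<le> (\<integral>\<^sup>+z. indicator {..(2 * R)\<^sup>2} ((cmod z)\<^sup>2) \<partial>lborel) ^ n * e2ennreal (ereal C - \<psi> p)"
    proof (rule psh_polydisc[OF \<psi> _ indicator_atMost_kernel, where \<rho> = "2 * R"])
      show "cpolydisc n p (2 * R) \<subseteq> U" using sub U by blast
      show "\<psi> w \<le> ereal C" if "w \<in> cpolydisc n p (2 * R)" for w using that sub C by blast
    qed (use R p in \<open>auto simp: polydisc_iff\<close>)
    show "e2ennreal (ereal C - \<psi> p) < \<infinity>" using p(2) C PU p(1)
      by (cases "\<psi> p") (fastforce simp: subset_iff)+
  qed
  have meas: "(\<lambda>w. if w \<in> polydisc n a R then \<psi> w else 0) \<in> borel_measurable (vol {..<n})"
  proof -
    note [measurable] = psh_measurable[OF \<psi>]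
    have "(\<lambda>w. if w \<in> polydisc n a R then (if w \<in> U then \<psi> w else \<infinity>) else 0) \<in> borel_measurable (vol {..<n})"
      by measurable
    moreover have "(\<lambda>w. if w \<in> polydisc n a R then (if w \<in> U then \<psi> w else \<infinity>) else 0) = (\<lambda>w. if w \<in> polydisc n a R then \<psi> w else 0)"
      using PU U by (auto simp: fun_eq_iff)
    ultimately show ?thesis by simp
  qed
  show "integrable (vol {..<n}) (\<lambda>w. indicator (polydisc n a R) w * real_of_ereal (\<psi> w))"
    "AE w in vol {..<n}. w \<in> polydisc n a R \<longrightarrow> \<psi> w \<noteq> -\<infinity>"
    by (rule finite_nn_integral_imp_integrable[OF meas refl _ fin]; use C PU in blast)+
qed

section \<open>Averages against product kernels\<close>

context log_kernel
begin

lemma kern_prod_nonneg: "\<tau> > 0 \<Longrightarrow> 0 \<le> kern_prod n \<tau> \<zeta> w"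
  unfolding kern_prod_def real_radial_prod_def by (intro prod_nonneg kern_nonneg) auto

lemma kern_prod_outside:
  assumes "0 < \<tau>" "\<rho> > 0" "\<tau> \<le> \<rho>\<^sup>2" "w \<in> extensional {..<n}" "w \<notin> cpolydisc n \<zeta> \<rho>"
  shows "kern_prod n \<tau> \<zeta> w = 0"
  unfolding kern_prod_def
  by (rule real_radial_prod_outside[of n \<rho>]) (use assms kern_support in auto)

lemma kern_prod_integral:
  assumes "\<tau> > 0"
  shows "integrable (vol {..<n}) (kern_prod n \<tau> \<zeta>)" "(LINT w|vol {..<n}. kern_prod n \<tau> \<zeta> w) = pi ^ n"
proof -
  have 1: "integrable lborel (\<lambda>z. kern \<tau> ((cmod (z - c))\<^sup>2))" for c
    by (rule integrable_radial[of _ "sqrt \<tau>"]) (use assms continuous_kern kern_support in auto)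
  show "integrable (vol {..<n}) (kern_prod n \<tau> \<zeta>)"
    unfolding kern_prod_def real_radial_prod_def[abs_def] vol_def
    by (rule vol.product_integrable_prod) (use 1 in auto)
  show "(LINT w|vol {..<n}. kern_prod n \<tau> \<zeta> w) = pi ^ n"
    unfolding kern_prod_def real_radial_prod_def vol_def
    by (subst vol.product_integral_prod[of _ "\<lambda>j z. kern \<tau> ((cmod (z - \<zeta> j))\<^sup>2)"])
       (use 1 assms in \<open>auto simp: kern_integral\<close>)
qed

lemma integrable_kern_prod_times:
  assumes "integrable (vol {..<n}) (\<lambda>w. indicator P w * u w)" "cpolydisc n \<zeta> \<rho> \<subseteq> P" "0 < \<tau>" "\<tau> \<le> \<rho>\<^sup>2" "\<rho> > 0"
  shows "integrable (vol {..<n}) (\<lambda>w. u w * kern_prod n \<tau> \<zeta> w)"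
  unfolding kern_prod_def
  by (rule integrable_times_radial_prod[OF assms(1), of _ \<rho>]) (use assms continuous_kern kern_support in auto)

text \<open>The product kernel is nonnegative of mass \<open>pi ^ n\<close> and vanishes off the
  polydisc of radius \<open>sqrt \<tau>\<close>, on which the bound is assumed.\<close>

lemma kern_average_mono:
  assumes u: "integrable (vol {..<n}) (\<lambda>w. indicator P w * u w)" and P: "cpolydisc n \<zeta> \<rho> \<subseteq> P"
    and \<tau>: "0 < \<tau>" "\<tau> \<le> \<rho>\<^sup>2" "\<rho> > 0"
  shows "(AE w in vol {..<n}. w \<in> cpolydisc n \<zeta> (sqrt \<tau>) \<longrightarrow> u w \<le> L) \<Longrightarrow> (LINT w|vol {..<n}. u w * kern_prod n \<tau> \<zeta> w) \<le> L * pi ^ n"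
    and "(AE w in vol {..<n}. w \<in> cpolydisc n \<zeta> (sqrt \<tau>) \<longrightarrow> L \<le> u w) \<Longrightarrow> L * pi ^ n \<le> (LINT w|vol {..<n}. u w * kern_prod n \<tau> \<zeta> w)"
proof -
  have out: "kern_prod n \<tau> \<zeta> w = 0" if "w \<in> space (vol {..<n})" "w \<notin> cpolydisc n \<zeta> (sqrt \<tau>)" for w
    using that \<tau> by (intro kern_prod_outside[of _ "sqrt \<tau>"]) (auto simp: space_vol)
  have i1: "integrable (vol {..<n}) (\<lambda>w. u w * kern_prod n \<tau> \<zeta> w)"
    by (rule integrable_kern_prod_times[OF u P \<tau>])
  have i2: "integrable (vol {..<n}) (\<lambda>w. L * kern_prod n \<tau> \<zeta> w)"
    using kern_prod_integral(1)[OF \<tau>(1)] by (rule integrable_mult_right)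
  have L: "(LINT w|vol {..<n}. L * kern_prod n \<tau> \<zeta> w) = L * pi ^ n"
    using kern_prod_integral(2)[OF \<tau>(1)] by simp
  show "(LINT w|vol {..<n}. u w * kern_prod n \<tau> \<zeta> w) \<le> L * pi ^ n"
    if "AE w in vol {..<n}. w \<in> cpolydisc n \<zeta> (sqrt \<tau>) \<longrightarrow> u w \<le> L"
    unfolding L[symmetric]
  proof (rule integral_mono_AE[OF i1 i2])
    show "AE w in vol {..<n}. u w * kern_prod n \<tau> \<zeta> w \<le> L * kern_prod n \<tau> \<zeta> w"
      using that AE_space
    proof eventually_elim
      case (elim w)
      then show ?case using out kern_prod_nonneg[OF \<tau>(1)]
        by (cases "w \<in> cpolydisc n \<zeta> (sqrt \<tau>)") (auto intro: mult_right_mono)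
    qed
  qed
  show "L * pi ^ n \<le> (LINT w|vol {..<n}. u w * kern_prod n \<tau> \<zeta> w)"
    if "AE w in vol {..<n}. w \<in> cpolydisc n \<zeta> (sqrt \<tau>) \<longrightarrow> L \<le> u w"
    unfolding L[symmetric]
  proof (rule integral_mono_AE[OF i2 i1])
    show "AE w in vol {..<n}. L * kern_prod n \<tau> \<zeta> w \<le> u w * kern_prod n \<tau> \<zeta> w"
      using that AE_space
    proof eventually_elim
      case (elim w)
      then show ?case using out kern_prod_nonneg[OF \<tau>(1)]
        by (cases "w \<in> cpolydisc n \<zeta> (sqrt \<tau>)") (auto intro: mult_right_mono)
    qed
  qed
qed

text \<open>The mean inequality comes as one between nonnegative integrals of C - \<psi>;
  integrability and finiteness almost everywhere convert it back to real integrals of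
  \<psi>.\<close>

lemma psh_kern_average:
  assumes \<psi>: "psh n U \<psi>" and U: "cpolydisc n \<zeta> \<rho> \<subseteq> P" "P \<subseteq> U" and \<tau>: "0 < \<tau>" "\<tau> \<le> \<rho>\<^sup>2" "\<rho> > 0"
    and \<zeta>: "\<zeta> \<in> extensional {..<n}" "\<psi> \<zeta> \<noteq> -\<infinity>"
    and C: "\<And>w. w \<in> P \<Longrightarrow> \<psi> w \<le> ereal C"
    and int: "integrable (vol {..<n}) (\<lambda>w. indicator P w * real_of_ereal (\<psi> w))"
    and AE: "AE w in vol {..<n}. w \<in> P \<longrightarrow> \<psi> w \<noteq> -\<infinity>"
  shows "pi ^ n * real_of_ereal (\<psi> \<zeta>) \<le> (LINT w|vol {..<n}. real_of_ereal (\<psi> w) * kern_prod n \<tau> \<zeta> w)"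
proof -
  let ?A = "LINT w|vol {..<n}. real_of_ereal (\<psi> w) * kern_prod n \<tau> \<zeta> w"
  have "\<zeta> \<in> P" using U \<zeta> \<tau> by (auto simp: cpolydisc_iff subset_iff)
  then obtain x where x: "\<psi> \<zeta> = ereal x" "x \<le> C" using C[of \<zeta>] \<zeta> by (cases "\<psi> \<zeta>") auto
  have i1: "integrable (vol {..<n}) (\<lambda>w. real_of_ereal (\<psi> w) * kern_prod n \<tau> \<zeta> w)"
    by (rule integrable_kern_prod_times[OF int U(1) \<tau>])
  have i2: "integrable (vol {..<n}) (\<lambda>w. C * kern_prod n \<tau> \<zeta> w)"
    using kern_prod_integral(1)[OF \<tau>(1)] by (rule integrable_mult_right)
  have pt: "AE w in vol {..<n}. (\<Prod>j<n. ennreal (kern \<tau> ((cmod (w j - \<zeta> j))\<^sup>2))) * e2ennreal (ereal C - \<psi> w)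
     = ennreal (C * kern_prod n \<tau> \<zeta> w - real_of_ereal (\<psi> w) * kern_prod n \<tau> \<zeta> w)"
    and nn: "AE w in vol {..<n}. 0 \<le> C * kern_prod n \<tau> \<zeta> w - real_of_ereal (\<psi> w) * kern_prod n \<tau> \<zeta> w"
  proof -
    have "AE w in vol {..<n}. (\<Prod>j<n. ennreal (kern \<tau> ((cmod (w j - \<zeta> j))\<^sup>2))) * e2ennreal (ereal C - \<psi> w)
     = ennreal (C * kern_prod n \<tau> \<zeta> w - real_of_ereal (\<psi> w) * kern_prod n \<tau> \<zeta> w) \<and>
      0 \<le> C * kern_prod n \<tau> \<zeta> w - real_of_ereal (\<psi> w) * kern_prod n \<tau> \<zeta> w"
      using AE AE_space
    proof eventually_elim
      case (elim w)
      have pe: "(\<Prod>j<n. ennreal (kern \<tau> ((cmod (w j - \<zeta> j))\<^sup>2))) = ennreal (kern_prod n \<tau> \<zeta> w)"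
        unfolding kern_prod_def real_radial_prod_def by (intro prod_ennreal kern_nonneg \<tau>)
      show ?case
      proof (cases "w \<in> P")
        case True
        then obtain y where y: "\<psi> w = ereal y" "y \<le> C" using C[of w] elim by (cases "\<psi> w") auto
        then have "0 \<le> (C - y) * kern_prod n \<tau> \<zeta> w" using kern_prod_nonneg[OF \<tau>(1)] by simp
        then show ?thesis unfolding pe using y kern_prod_nonneg[OF \<tau>(1)]
          by (simp add: ennreal_mult'[symmetric] algebra_simps)
      next
        case False
        then have "kern_prod n \<tau> \<zeta> w = 0"
          using U elim by (intro kern_prod_outside[OF \<tau>(1,3,2)]) (auto simp: space_vol)
        then show ?thesis unfolding pe by simp
      qed
    qed
    then show "AE w in vol {..<n}. (\<Prod>j<n. ennreal (kern \<tau> ((cmod (w j - \<zeta> j))\<^sup>2))) * e2ennreal (ereal C - \<psi> w)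
     = ennreal (C * kern_prod n \<tau> \<zeta> w - real_of_ereal (\<psi> w) * kern_prod n \<tau> \<zeta> w)"
      "AE w in vol {..<n}. 0 \<le> C * kern_prod n \<tau> \<zeta> w - real_of_ereal (\<psi> w) * kern_prod n \<tau> \<zeta> w"
      by auto
  qed
  have "ennreal (C * pi ^ n - ?A) = ennreal (LINT w|vol {..<n}. C * kern_prod n \<tau> \<zeta> w - real_of_ereal (\<psi> w) * kern_prod n \<tau> \<zeta> w)"
    using Bochner_Integration.integral_diff[OF i2 i1] kern_prod_integral(2)[OF \<tau>(1)] by simp
  also have "\<dots> = (\<integral>\<^sup>+w. ennreal (C * kern_prod n \<tau> \<zeta> w - real_of_ereal (\<psi> w) * kern_prod n \<tau> \<zeta> w) \<partial>vol {..<n})"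
    using nn by (intro nn_integral_eq_integral[symmetric] Bochner_Integration.integrable_diff i1 i2)
  also have "\<dots> = (\<integral>\<^sup>+w. (\<Prod>j<n. ennreal (kern \<tau> ((cmod (w j - \<zeta> j))\<^sup>2))) * e2ennreal (ereal C - \<psi> w) \<partial>vol {..<n})"
    using pt by (intro nn_integral_cong_AE) (auto elim: eventually_mono)
  also have "\<dots> \<le> (\<integral>\<^sup>+z. ennreal (kern \<tau> ((cmod z)\<^sup>2)) \<partial>lborel) ^ n * e2ennreal (ereal C - \<psi> \<zeta>)"
  proof (rule psh_polydisc[OF \<psi> _ _ _ \<tau>(3) \<zeta>(1)])
    have [measurable]: "kern \<tau> \<in> borel_measurable borel"
      using continuous_kern by (rule borel_measurable_continuous_onI)
    show "(\<lambda>t. ennreal (kern \<tau> t)) \<in> borel_measurable borel" by measurable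
  qed (use U C kern_support \<tau> in auto)
  also have "\<dots> = ennreal (pi ^ n * (C - x))"
    using x by (simp add: kern_mass[OF \<tau>(1)] ennreal_power ennreal_mult'[symmetric])
  finally have "C * pi ^ n - ?A \<le> pi ^ n * (C - x)"
    using x by (subst (asm) ennreal_le_iff) auto
  then show ?thesis using x by (simp add: algebra_simps)
qed

end

section \<open>Comparison of the weight and the potential near the hypersurface\<close>

lemma cpolydisc_subset_polydisc:
  assumes "p \<in> polydisc n a r" "s + r \<le> t"
  shows "cpolydisc n p s \<subseteq> polydisc n a t"
proof
  fix w assume w: "w \<in> cpolydisc n p s"
  have "cmod (w j - a j) < t" if "j < n" for j
  proof -
    have "cmod (w j - a j) \<le> cmod (w j - p j) + cmod (p j - a j)"
      using norm_triangle_ineq[of "w j - p j" "p j - a j"] by simp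
    moreover have "cmod (w j - p j) \<le> s" "cmod (p j - a j) < r" using w assms(1) that by (auto simp: polydisc_iff cpolydisc_iff)
    ultimately show ?thesis using assms(2) by linarith
  qed
  then show "w \<in> polydisc n a t" using w by (auto simp: polydisc_iff cpolydisc_iff)
qed

text \<open>One chart around a point a of M. The weight \<phi> enters through its local
  integrability and the diagonal coefficients of the equation of currents, \<psi> as a
  plurisubharmonic function bounded above by C.\<close>

locale local_potential = log_kernel +
  fixes n :: nat and U Z :: "(nat \<Rightarrow> complex) set" and a :: "nat \<Rightarrow> complex" and R \<eta> C :: real
    and \<phi> \<psi> :: "(nat \<Rightarrow> complex) \<Rightarrow> ereal"
  assumes n: "1 \<le> n" and U: "openin (Cn n) U" and Z: "Z = {w \<in> U. w (n - 1) = 0}"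
    and R: "R > 0" and aU: "cpolydisc n a (4 * R) \<subseteq> U" and a: "a \<in> extensional {..<n}" "a (n - 1) = 0"
    and \<psi>: "psh n U \<psi>" and C: "\<And>w. w \<in> cpolydisc n a (4 * R) \<Longrightarrow> \<psi> w \<le> ereal C"
    and int\<phi>: "integrable (vol {..<n}) (\<lambda>w. indicator (polydisc n a R) w * real_of_ereal (\<phi> w))"
    and cur: "\<And>f j. f \<in> test_functions n U \<Longrightarrow> j < n \<Longrightarrow>
      ddc n \<phi> j j f - of_real \<eta> * integration_current n Z j j f = ddc n \<psi> j j f"
    and \<eta>: "\<eta> > 0"
begin

abbreviation "P \<equiv> polydisc n a R"
abbreviation "V \<equiv> \<lambda>w. real_of_ereal (\<phi> w) - real_of_ereal (\<psi> w)"

lemma P_sub: "P \<subseteq> cpolydisc n a (4 * R)" "P \<subseteq> U"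
proof -
  show 1: "P \<subseteq> cpolydisc n a (4 * R)" using R by (fastforce simp: polydisc_iff cpolydisc_iff)
  then show "P \<subseteq> U" using aU by blast
qed

lemma int\<psi>: "integrable (vol {..<n}) (\<lambda>w. indicator P w * real_of_ereal (\<psi> w))"
  and AE\<psi>: "AE w in vol {..<n}. w \<in> P \<longrightarrow> \<psi> w \<noteq> -\<infinity>"
  using psh_locally_integrable[OF \<psi> aU R a(1) C] by auto

text \<open>The reference scale: a kernel of radius R / 2 about a point of the polydisc of radius R
  / 2 stays inside P.\<close>

definition "\<mu> = (R / 2)\<^sup>2"

lemma \<mu>: "\<mu> > 0" "\<mu> \<le> (R / 2)\<^sup>2" "R / 2 > 0"
  using R by (auto simp: \<mu>_def)

lemma sub: "\<zeta> \<in> polydisc n a (R / 2) \<Longrightarrow> cpolydisc n \<zeta> (R / 2) \<subseteq> P"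
  by (rule cpolydisc_subset_polydisc) auto

lemma intV: "integrable (vol {..<n}) (\<lambda>w. indicator P w * V w)"
  using Bochner_Integration.integrable_diff[OF int\<phi> int\<psi>] by (simp add: algebra_simps)

text \<open>At the fixed scale \<mu> the kernel is bounded and V is integrable on P, so these
  averages contribute no more than a constant to the bounds for \<phi> and \<psi>.\<close>

lemma average_bounded:
  obtains B where "\<And>\<zeta>. \<zeta> \<in> polydisc n a (R / 2) \<Longrightarrow> \<bar>LINT w|vol {..<n}. V w * kern_prod n \<mu> \<zeta> w\<bar> \<le> B"
proof -
  obtain b where b: "\<And>\<zeta> w. \<bar>real_radial_prod n (\<lambda>_. kern \<mu>) \<zeta> w\<bar> \<le> b"
    by (rule real_radial_prod_bounded[of n "\<lambda>_. kern \<mu>" "R / 2"])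
       (use continuous_kern kern_support[OF \<mu>(1)] \<mu> in auto)
  have "\<bar>LINT w|vol {..<n}. V w * kern_prod n \<mu> \<zeta> w\<bar> \<le> (LINT w|vol {..<n}. b * \<bar>indicator P w * V w\<bar>)"
    if \<zeta>: "\<zeta> \<in> polydisc n a (R / 2)" for \<zeta>
  proof -
    have "norm (LINT w|vol {..<n}. V w * kern_prod n \<mu> \<zeta> w) \<le> (LINT w|vol {..<n}. norm (V w * kern_prod n \<mu> \<zeta> w))"
      by (rule integral_norm_bound)
    also have "\<dots> \<le> (LINT w|vol {..<n}. b * \<bar>indicator P w * V w\<bar>)"
    proof (rule integral_mono)
      show "integrable (vol {..<n}) (\<lambda>w. norm (V w * kern_prod n \<mu> \<zeta> w))"
        by (intro integrable_norm integrable_kern_prod_times[OF intV sub[OF \<zeta>]] \<mu>)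
      show "integrable (vol {..<n}) (\<lambda>w. b * \<bar>indicator P w * V w\<bar>)"
        by (intro integrable_mult_right integrable_abs intV)
      fix w assume w: "w \<in> space (vol {..<n})"
      show "norm (V w * kern_prod n \<mu> \<zeta> w) \<le> b * \<bar>indicator P w * V w\<bar>"
      proof (cases "w \<in> P")
        case True
        then show ?thesis using b[of \<zeta> w] mult_left_mono[OF b[of \<zeta> w], of "\<bar>V w\<bar>"]
          by (simp add: kern_prod_def abs_mult mult.commute)
      next
        case False
        then have "kern_prod n \<mu> \<zeta> w = 0"
          using sub[OF \<zeta>] w by (intro kern_prod_outside[OF \<mu>(1,3,2)]) (auto simp: space_vol)
        then show ?thesis using False by simp
      qed
    qed
    finally show ?thesis by simp
  qed
  then show ?thesis using that by blast
qed

lemma average_identity':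
  assumes "\<zeta> \<in> polydisc n a (R / 2)" "0 < \<tau>" "\<tau> \<le> \<mu>"
  shows "(LINT w|vol {..<n}. V w * kern_prod n \<tau> \<zeta> w) = (LINT w|vol {..<n}. V w * kern_prod n \<mu> \<zeta> w)
     + pi ^ n * \<eta> * (reg \<tau> ((cmod (\<zeta> (n - 1)))\<^sup>2) - reg \<mu> ((cmod (\<zeta> (n - 1)))\<^sup>2))"
  by (rule average_identity[OF n U Z int\<phi> int\<psi> cur sub[OF assms(1)] P_sub(2) assms(2,3) \<mu>(2,3)])

lemma V_average_split:
  assumes "\<zeta> \<in> polydisc n a (R / 2)" "0 < \<tau>" "\<tau> \<le> \<mu>"
  shows "(LINT w|vol {..<n}. V w * kern_prod n \<tau> \<zeta> w) =
    (LINT w|vol {..<n}. real_of_ereal (\<phi> w) * kern_prod n \<tau> \<zeta> w) - (LINT w|vol {..<n}. real_of_ereal (\<psi> w) * kern_prod n \<tau> \<zeta> w)"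
proof -
  have \<tau>: "\<tau> \<le> (R / 2)\<^sup>2" using assms \<mu> by linarith
  show ?thesis
    unfolding left_diff_distrib
    by (intro Bochner_Integration.integral_diff integrable_kern_prod_times[OF int\<phi> sub] integrable_kern_prod_times[OF int\<psi> sub] assms \<tau> \<mu>)
qed

text \<open>Off the hyperplane \<open>\<phi> \<le> \<eta> ln \<bar>z\<^sub>n\<bar>\<^sup>2 + O(1)\<close>, since \<open>\<psi>\<close> is bounded above.\<close>

lemma upper_bound:
  obtains K where "\<And>\<zeta> L \<delta>. \<lbrakk>\<zeta> \<in> polydisc n a (R / 2); \<zeta> (n - 1) \<noteq> 0; \<delta> > 0; \<And>w. w \<in> cpolydisc n \<zeta> \<delta> \<Longrightarrow> L \<le> real_of_ereal (\<phi> w)\<rbrakk>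
     \<Longrightarrow> L \<le> K + \<eta> * ln ((cmod (\<zeta> (n - 1)))\<^sup>2)"
proof -
  obtain B where B: "\<And>\<zeta>. \<zeta> \<in> polydisc n a (R / 2) \<Longrightarrow> \<bar>LINT w|vol {..<n}. V w * kern_prod n \<mu> \<zeta> w\<bar> \<le> B"
    using average_bounded by blast
  have "L \<le> (\<bar>C\<bar> + B / pi ^ n - \<eta> * reg \<mu> 0) + \<eta> * ln ((cmod (\<zeta> (n - 1)))\<^sup>2)"
    if \<zeta>: "\<zeta> \<in> polydisc n a (R / 2)" "\<zeta> (n - 1) \<noteq> 0" "\<delta> > 0" and L: "\<And>w. w \<in> cpolydisc n \<zeta> \<delta> \<Longrightarrow> L \<le> real_of_ereal (\<phi> w)" for \<zeta> L \<delta>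
  proof -
    let ?t = "(cmod (\<zeta> (n - 1)))\<^sup>2"
    \<comment> \<open>Three constraints: \<tau> \<le> \<mu> permits the exchange of scales, \<tau>
      \<le> ?t makes \<open>reg \<tau>\<close> equal to the logarithm at \<zeta>, and \<tau> \<le>
      \<delta>^2 keeps the kernel where L is a lower bound.\<close>
    define \<tau> where "\<tau> = min \<mu> (min ?t (\<delta>\<^sup>2))"
    have \<tau>: "0 < \<tau>" "\<tau> \<le> \<mu>" "\<tau> \<le> ?t" "\<tau> \<le> \<delta>\<^sup>2" using \<zeta> \<mu> by (auto simp: \<tau>_def)
    have \<tau>R: "\<tau> \<le> (R / 2)\<^sup>2" using \<tau> \<mu> by linarith
    have sq: "sqrt \<tau> \<le> \<delta>" using \<tau>(4) \<zeta>(3) real_le_lsqrt[of \<delta> \<tau>] by simp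
    have sq2: "sqrt \<tau> \<le> R / 2" using \<tau>R \<mu> real_le_lsqrt[of "R / 2" \<tau>] by simp
    have "L * pi ^ n \<le> (LINT w|vol {..<n}. real_of_ereal (\<phi> w) * kern_prod n \<tau> \<zeta> w)"
      using L sq by (intro kern_average_mono(2)[OF int\<phi> sub[OF \<zeta>(1)] \<tau>(1) \<tau>R \<mu>(3)] AE_I2)
        (force simp: cpolydisc_iff)
    also have "\<dots> = (LINT w|vol {..<n}. V w * kern_prod n \<tau> \<zeta> w) + (LINT w|vol {..<n}. real_of_ereal (\<psi> w) * kern_prod n \<tau> \<zeta> w)"
      using V_average_split[OF \<zeta>(1) \<tau>(1,2)] by simp
    also have "(LINT w|vol {..<n}. real_of_ereal (\<psi> w) * kern_prod n \<tau> \<zeta> w) \<le> \<bar>C\<bar> * pi ^ n"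
    proof (intro kern_average_mono(1)[OF int\<psi> sub[OF \<zeta>(1)] \<tau>(1) \<tau>R \<mu>(3)] AE_I2 impI)
      fix w assume "w \<in> cpolydisc n \<zeta> (sqrt \<tau>)"
      then have "w \<in> cpolydisc n \<zeta> (R / 2)" using sq2 by (force simp: cpolydisc_iff)
      then have "\<psi> w \<le> ereal C" using sub[OF \<zeta>(1)] P_sub(1) C by blast
      then show "real_of_ereal (\<psi> w) \<le> \<bar>C\<bar>" by (cases "\<psi> w") auto
    qed
    also have "(LINT w|vol {..<n}. V w * kern_prod n \<tau> \<zeta> w) \<le> B + pi ^ n * \<eta> * (reg \<tau> ?t - reg \<mu> ?t)"
      using average_identity'[OF \<zeta>(1) \<tau>(1,2)] B[OF \<zeta>(1)] by (simp add: abs_le_iff)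
    also have "pi ^ n * \<eta> * (reg \<tau> ?t - reg \<mu> ?t) \<le> pi ^ n * \<eta> * (ln ?t - reg \<mu> 0)"
    proof -
      have "reg \<tau> ?t = ln ?t" using reg_eq_ln \<tau> by blast
      \<comment> \<open>E attains its minimum on the half line at 0, so the reference term is
        replaced by a constant.\<close>
      moreover have "reg \<mu> 0 \<le> reg \<mu> ?t" using E_min[of "?t / \<mu>"] \<mu> by (simp add: reg_def)
      ultimately show ?thesis using \<eta> by (intro mult_left_mono) auto
    qed
    finally have "L * pi ^ n \<le> ((\<bar>C\<bar> + B / pi ^ n - \<eta> * reg \<mu> 0) + \<eta> * ln ?t) * pi ^ n"
      by (simp add: algebra_simps)
    then show ?thesis by simp
  qed
  then show ?thesis using that by blast
qed

text \<open>On the hyperplane the kernel average of \<open>\<eta> ln \<bar>z\<^sub>n\<bar>\<^sup>2\<close> at scale \<open>\<tau>\<close> is \<open>\<eta> ln \<tau> + O(1)\<close>.\<close>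

lemma lower_bound:
  obtains K where "\<And>\<zeta> L \<tau>. \<lbrakk>\<zeta> \<in> polydisc n a (R / 2); \<zeta> (n - 1) = 0; \<psi> \<zeta> \<noteq> -\<infinity>; 0 < \<tau>; \<tau> \<le> \<mu>;
      AE w in vol {..<n}. w \<in> cpolydisc n \<zeta> (sqrt \<tau>) \<longrightarrow> real_of_ereal (\<phi> w) \<le> L\<rbrakk>
     \<Longrightarrow> real_of_ereal (\<psi> \<zeta>) \<le> K + L - \<eta> * ln \<tau>"
proof -
  obtain B where B: "\<And>\<zeta>. \<zeta> \<in> polydisc n a (R / 2) \<Longrightarrow> \<bar>LINT w|vol {..<n}. V w * kern_prod n \<mu> \<zeta> w\<bar> \<le> B"
    using average_bounded by blast
  have "real_of_ereal (\<psi> \<zeta>) \<le> (B / pi ^ n + \<eta> * ln \<mu>) + L - \<eta> * ln \<tau>"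
    if \<zeta>: "\<zeta> \<in> polydisc n a (R / 2)" "\<zeta> (n - 1) = 0" "\<psi> \<zeta> \<noteq> -\<infinity>" and \<tau>: "0 < \<tau>" "\<tau> \<le> \<mu>"
      and L: "AE w in vol {..<n}. w \<in> cpolydisc n \<zeta> (sqrt \<tau>) \<longrightarrow> real_of_ereal (\<phi> w) \<le> L" for \<zeta> L \<tau>
  proof -
    have \<tau>R: "\<tau> \<le> (R / 2)\<^sup>2" using \<tau> \<mu> by linarith
    have "pi ^ n * real_of_ereal (\<psi> \<zeta>) \<le> (LINT w|vol {..<n}. real_of_ereal (\<psi> w) * kern_prod n \<tau> \<zeta> w)"
      using \<zeta>(1)
      by (intro psh_kern_average[OF \<psi> sub[OF \<zeta>(1)] P_sub(2) \<tau>(1) \<tau>R \<mu>(3) _ \<zeta>(3) C[OF subsetD[OF P_sub(1)]] int\<psi> AE\<psi>])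
         (auto simp: polydisc_iff)
    also have "\<dots> = (LINT w|vol {..<n}. real_of_ereal (\<phi> w) * kern_prod n \<tau> \<zeta> w) - (LINT w|vol {..<n}. V w * kern_prod n \<tau> \<zeta> w)"
      using V_average_split[OF \<zeta>(1) \<tau>] by simp
    also have "(LINT w|vol {..<n}. real_of_ereal (\<phi> w) * kern_prod n \<tau> \<zeta> w) \<le> L * pi ^ n"
      by (rule kern_average_mono(1)[OF int\<phi> sub[OF \<zeta>(1)] \<tau>(1) \<tau>R \<mu>(3) L])
    finally have "pi ^ n * real_of_ereal (\<psi> \<zeta>) \<le> L * pi ^ n - (LINT w|vol {..<n}. V w * kern_prod n \<tau> \<zeta> w)" by simp
    \<comment> \<open>At a point of the hyperplane both regularizations are evaluated at 0; the
      values E 0 cancel and ln \<tau> - ln \<mu> is left.\<close>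
    also have "(LINT w|vol {..<n}. V w * kern_prod n \<tau> \<zeta> w) = (LINT w|vol {..<n}. V w * kern_prod n \<mu> \<zeta> w)
       + pi ^ n * \<eta> * (ln \<tau> - ln \<mu>)"
      using average_identity'[OF \<zeta>(1) \<tau>] \<zeta>(2) by (simp add: reg_def)
    also have "L * pi ^ n - \<dots> \<le> L * pi ^ n + B - pi ^ n * \<eta> * (ln \<tau> - ln \<mu>)"
      using B[OF \<zeta>(1)] by (simp add: abs_le_iff)
    also have "\<dots> = pi ^ n * ((B / pi ^ n + \<eta> * ln \<mu>) + L - \<eta> * ln \<tau>)"
      by (simp add: algebra_simps)
    finally show ?thesis by simp
  qed
  then show ?thesis using that by blast
qed

end

section \<open>Series of powers of holomorphic functions\<close>

text \<open>Near a maximum point z1 other than 0, branches of the powers of those f i that do not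
  vanish at z1 add up to a holomorphic function whose modulus is at most the quotient, with equality
  at z1. The maximum modulus principle makes the quotient constant near z1, so the set where a
  maximum larger than the boundary bound is attained is clopen in the disc. It would contain 0,
  where the quotient is 0.\<close>

lemma maximum_principle_powers:
  fixes f :: "'i \<Rightarrow> complex \<Rightarrow> complex" and c p :: "'i \<Rightarrow> real" and e r \<delta> :: real and I :: "'i set"
  defines "T \<equiv> \<lambda>z. \<Sum>i\<in>I. c i * cmod (f i z) powr p i"
  assumes I: "finite I" and f: "\<And>i. i \<in> I \<Longrightarrow> f i holomorphic_on S" and S: "open S" "cball 0 r \<subseteq> S"
    and p: "\<And>i. i \<in> I \<Longrightarrow> p i > 0" and c: "\<And>i. i \<in> I \<Longrightarrow> c i \<ge> 0" and r: "r > 0"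
    and lim: "((\<lambda>z. T z / cmod z powr e) \<longlongrightarrow> 0) (at 0)" and \<delta>: "\<And>z. cmod z = r \<Longrightarrow> T z \<le> \<delta>"
    and z: "z \<noteq> 0" "cmod z \<le> r"
  shows "T z \<le> \<delta> / r powr e * cmod z powr e"
proof -
  define t where "t i z = c i * cmod (f i z) powr p i / cmod z powr e" for i z
  \<comment> \<open>By \<open>lim\<close> the value 0 at the origin extends the quotient
    continuously, so it has a maximum on the closed disc.\<close>
  define s where "s z = (if z = 0 then 0 else T z / cmod z powr e)" for z
  have s_sum: "s z = (\<Sum>i\<in>I. t i z)" if "z \<noteq> 0" for z
    using that by (simp add: s_def t_def T_def sum_divide_distrib)
  have tnn: "t i z \<ge> 0" if "i \<in> I" for i z using c[OF that] by (simp add: t_def)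
  have contf: "continuous_on (cball 0 r) (f i)" if "i \<in> I" for i
    using f[OF that] S by (meson holomorphic_on_imp_continuous_on holomorphic_on_subset)
  have contT: "continuous_on (cball 0 r) T"
    unfolding T_def using p by (intro continuous_intros continuous_on_powr' contf) (auto simp: less_imp_le)
  have conts: "continuous_on (cball 0 r) s"
    unfolding continuous_on_def
  proof
    fix x :: complex assume x: "x \<in> cball 0 r"
    show "(s \<longlongrightarrow> s x) (at x within cball 0 r)"
    proof (cases "x = 0")
      case True
      have "(s \<longlongrightarrow> 0) (at 0)"
        by (rule Lim_transform_eventually[OF lim]) (auto simp: s_def eventually_at_filter)
      then show ?thesis using True by (auto simp: s_def intro: tendsto_within_subset)
    next
      case False
      have "((\<lambda>z. T z / cmod z powr e) \<longlongrightarrow> T x / cmod x powr e) (at x within cball 0 r)"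
        using contT x False unfolding continuous_on_def by (intro tendsto_intros) auto
      moreover have "eventually (\<lambda>z. z \<noteq> 0) (at x within cball 0 r)"
        using False by (auto simp: eventually_at intro!: exI[of _ "cmod x"])
      then have "eventually (\<lambda>z. T z / cmod z powr e = s z) (at x within cball 0 r)"
        by eventually_elim (simp add: s_def)
      ultimately have "(s \<longlongrightarrow> T x / cmod x powr e) (at x within cball 0 r)"
        by (rule Lim_transform_eventually)
      then show ?thesis using False by (simp add: s_def)
    qed
  qed
  obtain z0 where z0: "z0 \<in> cball 0 r" "\<And>z. z \<in> cball 0 r \<Longrightarrow> s z \<le> s z0"
    using continuous_attains_sup[OF compact_cball _ conts] r by (metis cball_eq_empty not_less order.strict_implies_order)
  have "s z0 \<le> \<delta> / r powr e"
  proof (rule ccontr)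
    assume neg: "\<not> s z0 \<le> \<delta> / r powr e"
    have "0 \<le> T (of_real r)" unfolding T_def using c by (intro sum_nonneg) auto
    then have "0 \<le> \<delta>" using \<delta>[of "of_real r"] r by simp
    then have "0 \<le> \<delta> / r powr e" by simp
    then have pos: "s z0 > 0" using neg by linarith
    have z0r: "cmod z0 < r"
    proof (rule ccontr)
      assume "\<not> cmod z0 < r"
      then have "cmod z0 = r" using z0(1) by simp
      then have "s z0 \<le> \<delta> / r powr e" using \<delta>[of z0] r by (auto simp: s_def intro: divide_right_mono)
      then show False using neg by simp
    qed
    define A where "A = {z \<in> ball 0 r. s z = s z0}"
    have "openin (top_of_set (ball 0 r)) A"
    proof -
      have "\<exists>d>0. ball z1 d \<subseteq> A" if z1: "z1 \<in> A" for z1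
      proof -
        have z1': "s z1 = s z0" "cmod z1 < r" "z1 \<noteq> 0" using z1 pos by (auto simp: A_def s_def)
        define I' where "I' = {i \<in> I. f i z1 \<noteq> 0}"
        have fI': "finite I'" using I by (simp add: I'_def)
        \<comment> \<open>Here z / z1 stays in the disc of radius 1 about 1, on which the principal
          logarithm is holomorphic; the same is arranged for the quotients f i z / f i z1.\<close>
        define O' where "O' = (ball 0 r - {0}) \<inter> {z. cmod (z / z1 - 1) < 1}"
        have opO: "open O'" unfolding O'_def
          by (intro open_Int open_Diff open_ball finite_imp_closed open_Collect_less continuous_intros) (use z1' in auto)
        have "eventually (\<lambda>z. z \<in> O') (nhds z1)"
          using opO z1' by (intro eventually_nhds_in_open) (auto simp: O'_def)
        moreover have "eventually (\<lambda>z. \<forall>i\<in>I'. cmod (f i z / f i z1 - 1) < 1) (nhds z1)"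
        proof (rule eventually_ball_finite[OF fI'], rule ballI)
          fix i assume i: "i \<in> I'"
          have "z1 \<in> S" using z1' S by auto
          moreover have "continuous_on S (f i)" using f i by (auto simp: I'_def intro: holomorphic_on_imp_continuous_on)
          ultimately have "isCont (f i) z1" using S by (simp add: continuous_on_eq_continuous_at)
          then have "((\<lambda>z. cmod (f i z / f i z1 - 1)) \<longlongrightarrow> cmod (f i z1 / f i z1 - 1)) (nhds z1)"
            using i by (intro tendsto_intros) (auto simp: isCont_def tendsto_nhds_iff I'_def)
          then show "eventually (\<lambda>z. cmod (f i z / f i z1 - 1) < 1) (nhds z1)"
            using i by (intro order_tendstoD(2)) (auto simp: I'_def)
        qed
        ultimately have "eventually (\<lambda>z. z \<in> O' \<and> (\<forall>i\<in>I'. cmod (f i z / f i z1 - 1) < 1)) (nhds z1)"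
          by eventually_elim auto
        then obtain d where d: "d > 0" "\<And>z. z \<in> ball z1 d \<Longrightarrow> z \<in> O' \<and> (\<forall>i\<in>I'. cmod (f i z / f i z1 - 1) < 1)"
          unfolding eventually_nhds_metric by (auto simp: dist_commute)
        have slit: "w \<notin> \<real>\<^sub>\<le>\<^sub>0" if "cmod (w - 1) < 1" for w
        proof
          assume "w \<in> \<real>\<^sub>\<le>\<^sub>0"
          then have "Re w \<le> 0" by (auto simp: complex_nonpos_Reals_iff)
          then show False using that abs_Re_le_cmod[of "w - 1"] by simp
        qed
        \<comment> \<open>The branches are normalized to 1 at z1, so the summands there are the
          nonnegative numbers \<open>t i z1\<close> and add up to s z1 without cancellation.\<close>
        define \<Phi> where "\<Phi> z = (\<Sum>i\<in>I'. of_real (t i z1) * exp (of_real (p i) * Ln (f i z / f i z1) - of_real e * Ln (z / z1)))" for z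
        have dS: "ball z1 d \<subseteq> S" using d(2) S(2) by (force simp: O'_def subset_iff)
        have hol: "\<Phi> holomorphic_on ball z1 d"
          unfolding \<Phi>_def using d(2) slit z1' dS
          by (intro holomorphic_intros holomorphic_on_subset[OF f dS]) (auto simp: I'_def O'_def)
        have nterm: "cmod (of_real (t i z1) * exp (of_real (p i) * Ln (f i z / f i z1) - of_real e * Ln (z / z1))) = t i z"
          if i: "i \<in> I'" and zz: "z \<in> ball z1 d" for i z
        proof -
          have q: "cmod (f i z / f i z1 - 1) < 1" "cmod (z / z1 - 1) < 1" "z \<noteq> 0"
            using d(2)[OF zz] i by (auto simp: O'_def)
          then have nz: "f i z \<noteq> 0" by (intro notI) simp
          have fz1: "f i z1 \<noteq> 0" "i \<in> I" using i by (auto simp: I'_def)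
          have "cmod (exp (of_real (p i) * Ln (f i z / f i z1) - of_real e * Ln (z / z1)))
             = exp (p i * ln (cmod (f i z / f i z1)) - e * ln (cmod (z / z1)))"
            using nz fz1 q z1' by simp
          also have "\<dots> = (cmod (f i z) / cmod (f i z1)) powr p i / (cmod z / cmod z1) powr e"
            using nz fz1 q z1' by (simp add: exp_diff powr_def norm_divide)
          also have "\<dots> = (cmod (f i z) powr p i / cmod z powr e) * (cmod z1 powr e / cmod (f i z1) powr p i)"
            by (simp add: powr_divide)
          finally have ne: "cmod (exp (of_real (p i) * Ln (f i z / f i z1) - of_real e * Ln (z / z1)))
             = (cmod (f i z) powr p i / cmod z powr e) * (cmod z1 powr e / cmod (f i z1) powr p i)" .
          have nt: "cmod (of_real (t i z1)) = t i z1" using tnn[OF fz1(2), of z1] by simp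
          show ?thesis unfolding norm_mult ne nt using fz1 z1' by (simp add: t_def)
        qed
        have \<Phi>z1: "\<Phi> z1 = of_real (s z1)"
        proof -
          have "\<Phi> z1 = (\<Sum>i\<in>I'. of_real (t i z1))" unfolding \<Phi>_def
            using z1' by (intro sum.cong) (auto simp: I'_def)
          also have "\<dots> = (\<Sum>i\<in>I. of_real (t i z1))"
            using I by (intro sum.mono_neutral_left) (auto simp: I'_def t_def)
          finally show ?thesis unfolding s_sum[OF z1'(3)] of_real_sum .
        qed
        have le: "cmod (\<Phi> z) \<le> s z" if zz: "z \<in> ball z1 d" for z
        proof -
          have "cmod (\<Phi> z) \<le> (\<Sum>i\<in>I'. t i z)" unfolding \<Phi>_def
            using nterm[OF _ zz] by (intro sum_norm_le) auto
          also have "\<dots> \<le> (\<Sum>i\<in>I. t i z)" using I tnn by (intro sum_mono2) (auto simp: I'_def)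
          also have "\<dots> = s z" using s_sum d(2)[OF zz] by (simp add: O'_def)
          finally show ?thesis .
        qed
        have ball_r: "z \<in> ball 0 r" if "z \<in> ball z1 d" for z using d(2)[OF that] by (simp add: O'_def)
        have max: "cmod (\<Phi> z) \<le> cmod (\<Phi> z1)" if zz: "z \<in> ball z1 d" for z
          using le[OF zz] z0(2)[of z] ball_r[OF zz] pos z1' by (simp add: \<Phi>z1)
        have "\<Phi> constant_on ball z1 d"
          using maximum_modulus_principle[OF hol open_ball connected_ball open_ball order.refl, of z1] max d(1) by simp
        then have const: "\<Phi> z = \<Phi> z1" if "z \<in> ball z1 d" for z
          using that d(1) unfolding constant_on_def by (metis centre_in_ball)
        have "z \<in> A" if zz: "z \<in> ball z1 d" for z
        proof -
          have "s z0 \<le> s z" using le[OF zz] const[OF zz] \<Phi>z1 z1' pos by simp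
          then show ?thesis using z0(2)[of z] ball_r[OF zz] by (simp add: A_def)
        qed
        then show ?thesis using d(1) by blast
      qed
      then have "open A" by (subst open_contains_ball) blast
      then show ?thesis by (intro open_subset) (auto simp: A_def)
    qed
    moreover have "closedin (top_of_set (ball 0 r)) A"
    proof -
      have "continuous_on (ball 0 r) s" using conts by (rule continuous_on_subset) auto
      then show ?thesis using continuous_closedin_preimage_constant[of "ball 0 r" s "s z0"] by (simp add: A_def)
    qed
    moreover have "z0 \<in> A" using z0r by (simp add: A_def)
    ultimately have "A = ball 0 r"
      using connected_ball[of "0::complex" r] unfolding connected_clopen by blast
    then have "(0::complex) \<in> A" using r by simp
    then show False using pos by (simp add: A_def s_def)
  qed
  then have "s z \<le> \<delta> / r powr e" using z0(2)[of z] z by simp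
  then show ?thesis using z by (simp add: s_def divide_le_eq)
qed

text \<open>By upper semicontinuity the sets where \<psi> is below k form an increasing open cover
  of K.\<close>

lemma open_cover_usc_bounded:
  assumes \<psi>: "psh n U \<psi>" and K: "compactin (Cn n) K" "K \<subseteq> U"
  obtains C where "\<And>w. w \<in> K \<Longrightarrow> \<psi> w \<le> ereal C"
proof -
  define \<U> where "\<U> = range (\<lambda>k::nat. {w \<in> U. \<psi> w < ereal (real k)})"
  have "openin (Cn n) T" if "T \<in> \<U>" for T using that \<psi> by (auto simp: \<U>_def psh_def)
  moreover have "K \<subseteq> \<Union>\<U>"
  proof
    fix w assume "w \<in> K"
    then have "w \<in> U" "\<psi> w < \<infinity>" using K \<psi> by (auto simp: psh_def)
    then obtain k :: nat where "\<psi> w < ereal (real k)" using less_PInf_Ex_of_nat by auto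
    then show "w \<in> \<Union>\<U>" using \<open>w \<in> U\<close> by (auto simp: \<U>_def)
  qed
  ultimately obtain \<F> where \<F>: "finite \<F>" "\<F> \<subseteq> \<U>" "K \<subseteq> \<Union>\<F>"
    using K(1) unfolding compactin_def by metis
  then obtain N where N: "finite N" "\<F> = (\<lambda>k::nat. {w \<in> U. \<psi> w < ereal (real k)}) ` N"
    unfolding \<U>_def by (meson finite_subset_image)
  have "\<psi> w \<le> ereal (real (Max N))" if "w \<in> K" for w
  proof -
    from that \<F>(3) N(2) obtain k where "k \<in> N" "\<psi> w < ereal (real k)" by auto
    then show ?thesis using N(1) Max_ge[of N k] by (meson ereal_less_eq(3) less_imp_le of_nat_mono order.trans)
  qed
  then show ?thesis using that by blast
qed

section \<open>The series defining the metric in one chart\<close>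

locale weight_series =
  fixes n :: nat and U :: "(nat \<Rightarrow> complex) set" and \<epsilon> :: "nat \<Rightarrow> real" and q :: "nat \<Rightarrow> nat"
    and f :: "nat \<Rightarrow> nat \<Rightarrow> (nat \<Rightarrow> complex) \<Rightarrow> complex" and summand :: "nat \<Rightarrow> (nat \<Rightarrow> complex) \<Rightarrow> real"
    and G :: "(nat \<Rightarrow> complex) \<Rightarrow> real" and \<phi> :: "(nat \<Rightarrow> complex) \<Rightarrow> ereal"
  assumes openU: "openin (Cn n) U"
    and f: "\<And>m j. 1 \<le> m \<Longrightarrow> j < q m \<Longrightarrow> holo n U (f m j)"
    and \<epsilon>: "\<And>m. 1 \<le> m \<Longrightarrow> 0 < \<epsilon> m"
    and summand: "\<And>m w. summand m w = \<epsilon> m * (\<Sum>j<q m. cmod (f m j w) powr (2 / real m))"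
    and conv: "\<And>K. compactin (Cn n) K \<Longrightarrow> K \<subseteq> U \<Longrightarrow> uniformly_convergent_on K (\<lambda>N w. \<Sum>m=1..N. summand m w)"
    and G: "\<And>w. G w = (\<Sum>m. summand (Suc m) w)"
    and \<phi>: "\<And>w. \<phi> w = (if G w = 0 then -\<infinity> else ereal (ln (G w)))"
begin

lemma summand_nonneg: "1 \<le> m \<Longrightarrow> 0 \<le> summand m w"
  using \<epsilon>[of m] by (simp add: summand sum_nonneg)

lemma summand_ge: "1 \<le> m \<Longrightarrow> j < q m \<Longrightarrow> \<epsilon> m * cmod (f m j w) powr (2 / real m) \<le> summand m w"
  using \<epsilon>[of m] unfolding summand by (intro mult_left_mono member_le_sum) auto

lemma summable_summand:
  assumes "w \<in> U"
  shows "summable (\<lambda>m. summand (Suc m) w)"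
proof -
  have "w \<in> topspace (Cn n)" using assms openU openin_subset by blast
  then have "compactin (Cn n) {w}" by (simp add: compactin_sing)
  then have "uniformly_convergent_on {w} (\<lambda>N w. \<Sum>m=1..N. summand m w)" using conv assms by blast
  then have "convergent (\<lambda>N. \<Sum>m=1..N. summand m w)" by (rule uniformly_convergent_imp_convergent) simp
  then show ?thesis by (simp add: summable_iff_convergent sum.atLeast1_atMost_eq)
qed

lemma summand_le_G: "w \<in> U \<Longrightarrow> 1 \<le> m \<Longrightarrow> summand m w \<le> G w"
  using sum_le_suminf[OF summable_summand, of w "{m - 1}"] summand_nonneg by (simp add: G)

lemma G_nonneg: "w \<in> U \<Longrightarrow> 0 \<le> G w"
  using suminf_nonneg[OF summable_summand] summand_nonneg by (simp add: G)

lemma G_le: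
  assumes "w \<in> U" "\<And>N. (\<Sum>m=1..N. summand m w) \<le> B"
  shows "G w \<le> B"
  using suminf_le_const[OF summable_summand[OF assms(1)], of B] assms(2) by (simp add: G sum.atLeast1_atMost_eq)

lemma uniform_tail:
  assumes "compactin (Cn n) K" "K \<subseteq> U" "\<delta> > 0"
  obtains N where "\<And>w N'. w \<in> K \<Longrightarrow> N \<le> N' \<Longrightarrow> (\<Sum>m\<in>{N<..N'}. summand m w) \<le> \<delta>"
proof -
  have "uniformly_Cauchy_on K (\<lambda>N w. \<Sum>m=1..N. summand m w)"
    using conv[OF assms(1,2)] by (rule uniformly_convergent_Cauchy)
  then obtain N where N: "\<And>w N'. w \<in> K \<Longrightarrow> N \<le> N' \<Longrightarrow> dist (\<Sum>m=1..N'. summand m w) (\<Sum>m=1..N. summand m w) < \<delta>"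
    using \<open>\<delta> > 0\<close> unfolding uniformly_Cauchy_on_def by (metis order.refl)
  have "(\<Sum>m\<in>{N<..N'}. summand m w) \<le> \<delta>" if "w \<in> K" "N \<le> N'" for w N'
  proof -
    have "{1..N'} = {1..N} \<union> {N<..N'}" using that by auto
    then have "(\<Sum>m=1..N'. summand m w) = (\<Sum>m=1..N. summand m w) + (\<Sum>m\<in>{N<..N'}. summand m w)"
      by (simp only:) (rule sum.union_disjoint, auto)
    then show ?thesis using N[OF that] by (simp add: dist_real_def)
  qed
  then show ?thesis using that by blast
qed

text \<open>The finite head and the tail will be bounded for different reasons; for the tail it is
  enough to control finite pieces, to which the maximum principle applies.\<close>

lemma G_split:
  assumes "w \<in> U" "\<And>N'. N \<le> N' \<Longrightarrow> (\<Sum>m\<in>{N<..N'}. summand m w) \<le> B"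
  shows "G w \<le> (\<Sum>m=1..N. summand m w) + B"
proof (rule G_le[OF assms(1)])
  fix M
  have "(\<Sum>m=1..M. summand m w) \<le> (\<Sum>m=1..max N M. summand m w)"
    using summand_nonneg by (intro sum_mono2) auto
  also have "{1..max N M} = {1..N} \<union> {N<..max N M}" by auto
  also have "(\<Sum>m\<in>{1..N} \<union> {N<..max N M}. summand m w) = (\<Sum>m=1..N. summand m w) + (\<Sum>m\<in>{N<..max N M}. summand m w)"
    by (rule sum.union_disjoint) auto
  finally show "(\<Sum>m=1..M. summand m w) \<le> (\<Sum>m=1..N. summand m w) + B" using assms(2)[of "max N M"] by simp
qed

lemma G_bounded:
  assumes "cpolydisc n a r \<subseteq> U"
  obtains C where "\<And>w. w \<in> cpolydisc n a r \<Longrightarrow> G w \<le> exp C"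
proof -
  obtain N where N: "\<And>w N'. w \<in> cpolydisc n a r \<Longrightarrow> N \<le> N' \<Longrightarrow> (\<Sum>m\<in>{N<..N'}. summand m w) \<le> 1"
    by (rule uniform_tail[OF compactin_cpolydisc assms, of 1]) auto
  have "\<exists>B. \<forall>w\<in>cpolydisc n a r. cmod (f m j w) \<le> B" if "1 \<le> m" "j < q m" for m j
    by (rule holo_bounded_on_cpolydisc[OF f[OF that] assms]) blast
  then obtain B where B: "\<And>m j w. 1 \<le> m \<Longrightarrow> j < q m \<Longrightarrow> w \<in> cpolydisc n a r \<Longrightarrow> cmod (f m j w) \<le> B m j" by metis
  define D where "D = (\<Sum>m=1..N. \<epsilon> m * (\<Sum>j<q m. B m j powr (2 / real m))) + 1"
  have "G w \<le> exp D" if w: "w \<in> cpolydisc n a r" for w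
  proof -
    have "G w \<le> (\<Sum>m=1..N. summand m w) + 1" using w assms N by (intro G_split) auto
    also have "\<dots> \<le> D" unfolding D_def summand using B[OF _ _ w] \<epsilon>
      by (intro add_right_mono sum_mono mult_left_mono powr_mono2) (auto simp: less_imp_le)
    also have "D \<le> exp D" using exp_ge_add_one_self[of D] by linarith
    finally show ?thesis .
  qed
  then show ?thesis using that by blast
qed

lemma G_measurable: "(\<lambda>w. if w \<in> U then G w else 0) \<in> borel_measurable (vol {..<n})"
proof -
  define f' where "f' m j w = (if w \<in> U then f m j w else 0)" for m j w
  have f'm: "f' m j \<in> borel_measurable (vol {..<n})" if "1 \<le> m" "j < q m" for m j
    unfolding f'_def using f[OF that] openU
    by (intro borel_measurable_on_open[where g = "\<lambda>x. x"]) (auto simp: holo_def)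
  have mm: "(\<lambda>w. \<epsilon> m * (\<Sum>j<q m. cmod (f' m j w) powr (2 / real m))) \<in> borel_measurable (vol {..<n})" if "1 \<le> m" for m
  proof (intro borel_measurable_times borel_measurable_const borel_measurable_sum)
    fix j assume "j \<in> {..<q m}"
    then have [measurable]: "f' m j \<in> borel_measurable (vol {..<n})" using f'm[OF that] by simp
    show "(\<lambda>w. cmod (f' m j w) powr (2 / real m)) \<in> borel_measurable (vol {..<n})" by measurable
  qed
  have "(\<lambda>w. \<Sum>m. \<epsilon> (Suc m) * (\<Sum>j<q (Suc m). cmod (f' (Suc m) j w) powr (2 / real (Suc m)))) \<in> borel_measurable (vol {..<n})"
    by (rule borel_measurable_suminf) (rule mm, simp)
  moreover have "(\<Sum>m. \<epsilon> (Suc m) * (\<Sum>j<q (Suc m). cmod (f' (Suc m) j w) powr (2 / real (Suc m)))) = (if w \<in> U then G w else 0)" for w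
    by (auto simp: G summand f'_def)
  ultimately show ?thesis by simp
qed

text \<open>The weight is at least the logarithm of a single term: \<phi> \<ge> ln (\<epsilon> m) +
  (2 / m) ln \<bar>f\<bar> for a section f that is nonzero at p, and Jensen's inequality integrates
  ln \<bar>f\<bar>. If G vanishes on the whole polydisc, the real value of \<phi> is 0 there by the
  convention for -\<infinity>.\<close>

lemma weight_locally_integrable:
  assumes aU: "cpolydisc n a (4 * R) \<subseteq> U" and R: "R > 0"
  shows "integrable (vol {..<n}) (\<lambda>w. indicator (polydisc n a R) w * real_of_ereal (\<phi> w))"
    and "\<exists>p\<in>polydisc n a R. G p \<noteq> 0 \<Longrightarrow> AE w in vol {..<n}. w \<in> polydisc n a R \<longrightarrow> G w \<noteq> 0"
proof -
  let ?P = "polydisc n a R"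
  have PK: "?P \<subseteq> cpolydisc n a (4 * R)" using R by (fastforce simp: polydisc_iff cpolydisc_iff)
  obtain C where C: "\<And>w. w \<in> cpolydisc n a (4 * R) \<Longrightarrow> G w \<le> exp C" using G_bounded[OF aU] by blast
  have main: "integrable (vol {..<n}) (\<lambda>w. indicator ?P w * real_of_ereal (\<phi> w)) \<and> (AE w in vol {..<n}. w \<in> ?P \<longrightarrow> \<phi> w \<noteq> -\<infinity>)"
    if p: "p \<in> ?P" "G p \<noteq> 0" for p
  proof -
    have "\<exists>m j. 1 \<le> m \<and> j < q m \<and> f m j p \<noteq> 0"
    proof (rule ccontr)
      assume "\<not> ?thesis"
      then have "summand (Suc m) p = 0" for m by (simp add: summand)
      then show False using p by (simp add: G)
    qed
    then obtain m j where mj: "1 \<le> m" "j < q m" "f m j p \<noteq> 0" by blast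
    obtain B where B: "B > 0" "\<And>w. w \<in> cpolydisc n a (4 * R) \<Longrightarrow> cmod (f m j w) \<le> B"
      by (rule holo_bounded_on_cpolydisc[OF f[OF mj(1,2)] aU]) blast
    define D where "D = ln B"
    have D: "cmod (f m j w) \<le> exp D" if "w \<in> cpolydisc n a (4 * R)" for w using B that by (simp add: D_def)
    \<comment> \<open>Collects the constants of the pointwise comparison; the absolute value makes
      it a nonnegative summand that survives the passage to \<open>ennreal\<close>.\<close>
    define K where "K = \<bar>C - ln (\<epsilon> m) - 2 / real m * D\<bar>"
    have pt: "e2ennreal (ereal C - \<phi> w) \<le> ennreal K + ennreal (2 / real m) * neg_log D (f m j w)" if w: "w \<in> ?P" for w
    proof (cases "f m j w = 0")
      case True
      then show ?thesis using mj by (simp add: neg_log_def ennreal_mult_top)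
    next
      case False
      have w4: "w \<in> cpolydisc n a (4 * R)" "w \<in> U" using w PK aU by auto
      have "0 < \<epsilon> m * cmod (f m j w) powr (2 / real m)" using \<epsilon> mj False by simp
      also have le: "\<dots> \<le> G w" using summand_ge[OF mj(1,2)] summand_le_G[OF w4(2) mj(1)] by (rule order.trans)
      finally have Gpos: "0 < G w" .
      have "ln (\<epsilon> m) + 2 / real m * ln (cmod (f m j w)) = ln (\<epsilon> m * cmod (f m j w) powr (2 / real m))"
        using \<epsilon>[OF mj(1)] False by (simp add: ln_mult ln_powr)
      also have "\<dots> \<le> ln (G w)" using \<epsilon>[OF mj(1)] False le by (intro ln_mono) auto
      finally have 1: "ln (\<epsilon> m) + 2 / real m * ln (cmod (f m j w)) \<le> ln (G w)" .
      have "ln (cmod (f m j w)) \<le> ln (exp D)" using D[OF w4(1)] False by (intro ln_mono) auto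
      then have 2: "0 \<le> D - ln (cmod (f m j w))" by simp
      have "C - ln (G w) \<le> K + 2 / real m * (D - ln (cmod (f m j w)))"
        using 1 unfolding K_def right_diff_distrib by linarith
      then have "ennreal (C - ln (G w)) \<le> ennreal (K + 2 / real m * (D - ln (cmod (f m j w))))" by (rule ennreal_leI)
      also have "\<dots> = ennreal K + ennreal (2 / real m) * ennreal (D - ln (cmod (f m j w)))"
      proof -
        have "ennreal (2 / real m * (D - ln (cmod (f m j w)))) = ennreal (2 / real m) * ennreal (D - ln (cmod (f m j w)))"
          by (rule ennreal_mult) (use 2 in auto)
        moreover have "0 \<le> 2 / real m * (D - ln (cmod (f m j w)))" using 2 by (intro mult_nonneg_nonneg) auto
        ultimately show ?thesis by (subst ennreal_plus) (auto simp: K_def)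
      qed
      finally show ?thesis using Gpos False by (simp add: \<phi> neg_log_def)
    qed
    have p4: "cpolydisc n p (2 * R) \<subseteq> cpolydisc n a (4 * R)"
      using cpolydisc_subset_polydisc[OF p(1), of "2 * R" "4 * R"] R polydisc_subset_cpolydisc by fastforce
    have fin: "(\<integral>\<^sup>+w\<in>?P. neg_log D (f m j w) \<partial>vol {..<n}) < \<infinity>"
    proof (rule finite_from_supermean[OF _ _ p(1) R])
      show "(\<integral>\<^sup>+w. (\<Prod>k<n. indicator {..(2 * R)\<^sup>2} ((cmod (w k - p k))\<^sup>2)) * neg_log D (f m j w) \<partial>vol {..<n})
        \<le> (\<integral>\<^sup>+z. indicator {..(2 * R)\<^sup>2} ((cmod z)\<^sup>2) \<partial>lborel) ^ n * neg_log D (f m j p)"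
      proof (rule neg_log_polydisc[OF f[OF mj(1,2)] _ indicator_atMost_kernel, where \<rho> = "2 * R"])
        show "cpolydisc n p (2 * R) \<subseteq> U" using p4 aU by blast
        show "cmod (f m j w) \<le> exp D" if "w \<in> cpolydisc n p (2 * R)" for w using that p4 D by blast
      qed (use R p in \<open>auto simp: polydisc_iff\<close>)
      show "neg_log D (f m j p) < \<infinity>" using mj by (simp add: neg_log_def)
    qed
    have "(\<lambda>w. if w \<in> U then neg_log D (f m j w) else 0) \<in> borel_measurable (vol {..<n})"
      using f[OF mj(1,2)] openU by (intro borel_measurable_on_open) (auto simp: holo_def)
    then have "(\<lambda>w. (if w \<in> U then neg_log D (f m j w) else 0) * indicator ?P w) \<in> borel_measurable (vol {..<n})"
      by measurable
    moreover have "(if w \<in> U then neg_log D (f m j w) else 0) * indicator ?P w = neg_log D (f m j w) * indicator ?P w" for w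
      using PK aU by (auto simp: indicator_def)
    ultimately have nlm: "(\<lambda>w. neg_log D (f m j w) * indicator ?P w) \<in> borel_measurable (vol {..<n})" by simp
    have "(\<integral>\<^sup>+w\<in>?P. e2ennreal (ereal C - \<phi> w) \<partial>vol {..<n})
       \<le> (\<integral>\<^sup>+w. ennreal K * indicator ?P w + ennreal (2 / real m) * (neg_log D (f m j w) * indicator ?P w) \<partial>vol {..<n})"
      using pt by (intro nn_integral_mono) (auto simp: indicator_def)
    also have "\<dots> = ennreal K * emeasure (vol {..<n}) ?P + ennreal (2 / real m) * (\<integral>\<^sup>+w\<in>?P. neg_log D (f m j w) \<partial>vol {..<n})"
    proof -
      have "(\<lambda>w. ennreal K * indicator ?P w) \<in> borel_measurable (vol {..<n})" by measurable
      moreover have "(\<lambda>w. ennreal (2 / real m) * (neg_log D (f m j w) * indicator ?P w)) \<in> borel_measurable (vol {..<n})"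
        using nlm by (rule borel_measurable_times_ennreal[rotated]) simp
      ultimately show ?thesis
        by (subst nn_integral_add) (simp_all only: nn_integral_cmult_indicator[OF polydisc_sets] nn_integral_cmult[OF nlm])
    qed
    also have "\<dots> < \<infinity>"
      using fin emeasure_polydisc_finite[of n a R] unfolding infinity_ennreal_def
      by (simp only: ennreal_add_less_top ennreal_mult_less_top ennreal_less_top simp_thms)
    finally have fin2: "(\<integral>\<^sup>+w\<in>?P. e2ennreal (ereal C - \<phi> w) \<partial>vol {..<n}) < \<infinity>" .
    have meas: "(\<lambda>w. if w \<in> ?P then \<phi> w else 0) \<in> borel_measurable (vol {..<n})"
    proof -
      define G' where "G' w = (if w \<in> U then G w else 0)" for w
      have [measurable]: "G' \<in> borel_measurable (vol {..<n})" using G_measurable by (simp add: G'_def[abs_def])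
      have "(\<lambda>w. if w \<in> ?P then (if G' w = 0 then -\<infinity> else ereal (ln (G' w))) else 0) \<in> borel_measurable (vol {..<n})"
        by measurable
      moreover have "(\<lambda>w. if w \<in> ?P then (if G' w = 0 then -\<infinity> else ereal (ln (G' w))) else 0) = (\<lambda>w. if w \<in> ?P then \<phi> w else 0)"
        using PK aU by (auto simp: fun_eq_iff G'_def \<phi>)
      ultimately show ?thesis by simp
    qed
    have \<phi>C: "\<phi> w \<le> ereal C" if "w \<in> ?P" for w
    proof (cases "G w = 0")
      case False
      then have "0 < G w" using G_nonneg[of w] that PK aU by fastforce
      then have "ln (G w) \<le> ln (exp C)" using C[of w] that PK by (intro ln_mono) auto
      then show ?thesis using False by (simp add: \<phi>)
    qed (simp add: \<phi>)
    show ?thesis using finite_nn_integral_imp_integrable[OF meas refl \<phi>C fin2] by blast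
  qed
  show "integrable (vol {..<n}) (\<lambda>w. indicator ?P w * real_of_ereal (\<phi> w))"
  proof (cases "\<exists>p\<in>?P. G p \<noteq> 0")
    case False
    then have "(\<lambda>w. indicator ?P w * real_of_ereal (\<phi> w)) = (\<lambda>w. 0)" by (auto simp: fun_eq_iff \<phi> indicator_def)
    then show ?thesis by simp
  qed (use main in blast)
  show "AE w in vol {..<n}. w \<in> ?P \<longrightarrow> G w \<noteq> 0" if "\<exists>p\<in>?P. G p \<noteq> 0"
  proof -
    have "AE w in vol {..<n}. w \<in> ?P \<longrightarrow> \<phi> w \<noteq> -\<infinity>" using that main by blast
    then show ?thesis by (rule AE_mp) (auto simp: \<phi>)
  qed
qed

text \<open>An average of \<phi> sees a neighbourhood of \<zeta> and not its value there. Continuity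
  of one term yields a lower bound on a neighbourhood at the price of a factor below 1, taken as exp
  (-1) so that it costs 1 in the logarithm.\<close>

lemma summand_lower_nbhd:
  assumes \<zeta>: "\<zeta> \<in> U" and m: "1 \<le> m" and pos: "summand m \<zeta> > 0"
  obtains \<delta> where "\<delta> > 0" "cpolydisc n \<zeta> \<delta> \<subseteq> U" "\<And>w. w \<in> cpolydisc n \<zeta> \<delta> \<Longrightarrow> exp (-1) * summand m \<zeta> < summand m w"
proof -
  have "continuous_map (subtopology (Cn n) U) euclidean (summand m)"
    unfolding summand[abs_def] continuous_map_atin
  proof (intro ballI, simp only: limitin_canonical_iff, intro tendsto_intros tendsto_powr')
    fix x j assume "x \<in> topspace (subtopology (Cn n) U)" "j \<in> {..<q m}"
    then show "(f m j \<longlongrightarrow> f m j x) (atin (subtopology (Cn n) U) x)"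
      using f[OF m, of j] by (auto simp: holo_def continuous_map_atin)
  qed (use m in auto)
  then have op: "openin (Cn n) {w \<in> U. summand m w \<in> {exp (-1) * summand m \<zeta><..}}"
    by (rule openin_Cn_preimage[OF openU]) simp
  have "exp (-1::real) < 1" by simp
  then have "exp (-1) * summand m \<zeta> < summand m \<zeta>" using pos mult_strict_right_mono[of "exp (-1::real)" 1 "summand m \<zeta>"] by simp
  then have in_: "\<zeta> \<in> {w \<in> U. summand m w \<in> {exp (-1) * summand m \<zeta><..}}"
    using \<zeta> by simp
  obtain \<delta> where "\<delta> > 0" "cpolydisc n \<zeta> \<delta> \<subseteq> {w \<in> U. summand m w \<in> {exp (-1) * summand m \<zeta><..}}"
    by (rule cpolydisc_in_open[OF op in_])
  then show ?thesis using that[of \<delta>] by auto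
qed

end

section \<open>Growth of the sections along the hypersurface\<close>

locale weight_potential = weight_series n U \<epsilon> q f summand G \<phi> + local_potential E E1 E2 \<beta> n U Z a R \<eta> C \<phi> \<psi>
  for n U \<epsilon> q f summand G \<phi> E E1 E2 \<beta> Z a R \<eta> C \<psi>
begin

lemma half_sub: "polydisc n a (R / 2) \<subseteq> U"
  using P_sub(2) R by (force simp: polydisc_iff)

text \<open>Each term bounds G from below, so the upper bound for \<phi> passes to it. The constant
  is the same for all m, and the 1 added to it pays for the factor exp (-1).\<close>

lemma summand_bound:
  obtains K where "\<And>m \<zeta>. 1 \<le> m \<Longrightarrow> \<zeta> \<in> polydisc n a (R / 2) \<Longrightarrow> \<zeta> (n - 1) \<noteq> 0 \<Longrightarrow>
    summand m \<zeta> \<le> exp K * cmod (\<zeta> (n - 1)) powr (2 * \<eta>)"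
proof -
  obtain K where K: "\<And>\<zeta> L \<delta>. \<lbrakk>\<zeta> \<in> polydisc n a (R / 2); \<zeta> (n - 1) \<noteq> 0; \<delta> > 0; \<And>w. w \<in> cpolydisc n \<zeta> \<delta> \<Longrightarrow> L \<le> real_of_ereal (\<phi> w)\<rbrakk>
     \<Longrightarrow> L \<le> K + \<eta> * ln ((cmod (\<zeta> (n - 1)))\<^sup>2)"
    using upper_bound by blast
  have "summand m \<zeta> \<le> exp (K + 1) * cmod (\<zeta> (n - 1)) powr (2 * \<eta>)"
    if m: "1 \<le> m" and \<zeta>: "\<zeta> \<in> polydisc n a (R / 2)" "\<zeta> (n - 1) \<noteq> 0" for m \<zeta>
  proof (cases "summand m \<zeta> > 0")
    case pos: True
    have \<zeta>U: "\<zeta> \<in> U" using \<zeta> half_sub by blast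
    obtain \<delta> where \<delta>: "\<delta> > 0" "cpolydisc n \<zeta> \<delta> \<subseteq> U" "\<And>w. w \<in> cpolydisc n \<zeta> \<delta> \<Longrightarrow> exp (-1) * summand m \<zeta> < summand m w"
      using summand_lower_nbhd[OF \<zeta>U m pos] by blast
    have "ln (summand m \<zeta>) - 1 \<le> K + \<eta> * ln ((cmod (\<zeta> (n - 1)))\<^sup>2)"
    proof (rule K[OF \<zeta> \<delta>(1)])
      fix w assume w: "w \<in> cpolydisc n \<zeta> \<delta>"
      have le: "exp (-1) * summand m \<zeta> \<le> G w"
        using \<delta>(3)[OF w] summand_le_G[of w m] w \<delta>(2) m by fastforce
      have p: "0 < exp (-1) * summand m \<zeta>" using pos by simp
      have "ln (summand m \<zeta>) - 1 = ln (exp (-1) * summand m \<zeta>)" using pos by (simp add: ln_mult)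
      also have "\<dots> \<le> ln (G w)" by (rule ln_mono[OF le p])
      finally show "ln (summand m \<zeta>) - 1 \<le> real_of_ereal (\<phi> w)" using le p by (simp add: \<phi>)
    qed
    then have "ln (summand m \<zeta>) \<le> (K + 1) + 2 * \<eta> * ln (cmod (\<zeta> (n - 1)))"
      using \<zeta> by (simp add: ln_realpow)
    then have "exp (ln (summand m \<zeta>)) \<le> exp ((K + 1) + 2 * \<eta> * ln (cmod (\<zeta> (n - 1))))" by (simp only: exp_le_cancel_iff)
    then show ?thesis using pos \<zeta> by (simp add: exp_add powr_def)
  next
    case False
    then have "summand m \<zeta> \<le> 0" by simp
    also have "0 \<le> exp (K + 1) * cmod (\<zeta> (n - 1)) powr (2 * \<eta>)" by simp
    finally show ?thesis .
  qed
  then show ?thesis using that by blast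
qed

text \<open>The real value of -\<infinity> is 0. If G vanished on P, then 0 would be a lower bound
  for the real values of \<phi> near every point, against the upper bound, which tends to
  -\<infinity> at the hyperplane.\<close>

lemma G_not_identically_zero: "\<exists>p\<in>polydisc n a R. G p \<noteq> 0"
proof (rule ccontr)
  assume neg: "\<not> ?thesis"
  obtain K where K: "\<And>\<zeta> L \<delta>. \<lbrakk>\<zeta> \<in> polydisc n a (R / 2); \<zeta> (n - 1) \<noteq> 0; \<delta> > 0; \<And>w. w \<in> cpolydisc n \<zeta> \<delta> \<Longrightarrow> L \<le> real_of_ereal (\<phi> w)\<rbrakk>
     \<Longrightarrow> L \<le> K + \<eta> * ln ((cmod (\<zeta> (n - 1)))\<^sup>2)"
    using upper_bound by blast
  \<comment> \<open>Small enough for K + 2 \<eta> ln t \<le> -1.\<close>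
  define t where "t = min (R / 4) (exp (- (K + 1) / (2 * \<eta>)))"
  have t: "0 < t" "t < R / 2" "t \<le> exp (- (K + 1) / (2 * \<eta>))" using R by (auto simp: t_def)
  have "ln t \<le> ln (exp (- (K + 1) / (2 * \<eta>)))" using t by (intro ln_mono) auto
  then have lt: "2 * \<eta> * ln t \<le> - (K + 1)" using \<eta> by (simp add: field_simps)
  let ?\<zeta> = "a(n - 1 := complex_of_real t)"
  have \<zeta>: "?\<zeta> \<in> polydisc n a (R / 2)"
    using t n a R by (auto simp: polydisc_iff extensional_def)
  have "0 \<le> K + \<eta> * ln ((cmod (?\<zeta> (n - 1)))\<^sup>2)"
  proof (rule K[OF \<zeta>])
    show "0 \<le> real_of_ereal (\<phi> w)" if "w \<in> cpolydisc n ?\<zeta> (R / 2)" for w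
      using that sub[OF \<zeta>] neg by (auto simp: \<phi>)
  qed (use t R in auto)
  also have "ln ((cmod (?\<zeta> (n - 1)))\<^sup>2) = 2 * ln t" using t by (simp add: ln_realpow)
  finally show False using lt by (simp add: algebra_simps)
qed

text \<open>If every section vanishes to higher order than \<open>\<eta>\<close> along the hyperplane, so does the whole
  series: its tails obey the maximum principle in the normal direction after division by
  \<open>\<bar>z\<^sub>n\<bar>\<close> to the power \<open>2 \<eta>\<close>.\<close>

lemma potential_eq_minus_infinity:
  assumes small: "\<And>m j y \<delta>. \<lbrakk>1 \<le> m; j < q m; y \<in> polydisc n a (R / 3); y (n - 1) = 0; \<delta> > 0\<rbrakk> \<Longrightarrow>
      \<exists>r>0. \<forall>w\<in>polydisc n y r. cmod (f m j w) powr (2 / real m) \<le> \<delta> * cmod (w (n - 1)) powr (2 * \<eta>)"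
    and \<zeta>: "\<zeta> \<in> polydisc n a (R / 4)" "\<zeta> (n - 1) = 0"
  shows "\<psi> \<zeta> = -\<infinity>"
proof (rule ccontr)
  assume \<psi>\<zeta>: "\<psi> \<zeta> \<noteq> -\<infinity>"
  let ?r = "R / 4" and ?K = "cpolydisc n a (R / 4)"
  have r: "?r > 0" using R by simp
  have n1: "n - 1 < n" using n by simp
  have \<zeta>2: "\<zeta> \<in> polydisc n a (R / 2)" using \<zeta> R by (force simp: polydisc_iff)
  have \<zeta>3: "\<zeta> \<in> polydisc n a (R / 3)" using \<zeta> R by (force simp: polydisc_iff)
  have KP3: "?K \<subseteq> polydisc n a (R / 3)" using R by (force simp: polydisc_iff cpolydisc_iff)
  have KP: "?K \<subseteq> polydisc n a (R / 2)" using R by (force simp: polydisc_iff cpolydisc_iff)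
  then have KU: "?K \<subseteq> U" using half_sub by blast
  \<comment> \<open>The bound \<delta> holds in particular on the circle \<bar>t\<bar> = R / 4 of
    the normal line through w. The maximum principle adds the factor of order 2\<eta> in the last
    coordinate, with a constant that does not depend on N'.\<close>
  have tail_small: "(\<Sum>m\<in>{N<..N'}. summand m w) \<le> \<delta> / ?r powr (2 * \<eta>) * cmod (w (n - 1)) powr (2 * \<eta>)"
    if tail: "\<And>w. w \<in> ?K \<Longrightarrow> (\<Sum>m\<in>{N<..N'}. summand m w) \<le> \<delta>" and w: "w \<in> ?K" "w (n - 1) \<noteq> 0" for N N' \<delta> w
  proof -
    define v where "v t = w(n - 1 := t)" for t
    have v: "v t \<in> ?K" if "cmod t \<le> ?r" for t
      using w that n1 a by (auto simp: v_def cpolydisc_iff extensional_def)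
    have wext: "w \<in> extensional {..<n}" using w by (simp add: cpolydisc_iff)
    define I where "I = Sigma {N<..N'} (\<lambda>m. {..<q m})"
    have sum_eq: "(\<Sum>i\<in>I. \<epsilon> (fst i) * cmod (f (fst i) (snd i) (v t)) powr (2 / real (fst i))) = (\<Sum>m\<in>{N<..N'}. summand m (v t))" for t
      unfolding I_def summand sum_distrib_left by (subst sum.Sigma) (auto simp: split_beta)
    let ?S = "{t. v t \<in> U}"
    have S: "open ?S" "cball 0 ?r \<subseteq> ?S"
    proof -
      show "open ?S" unfolding v_def by (rule open_slice_Cn[OF openU wext n1])
      show "cball 0 ?r \<subseteq> ?S" using v KU by auto
    qed
    have "(\<Sum>i\<in>I. \<epsilon> (fst i) * cmod (f (fst i) (snd i) (v (w (n - 1)))) powr (2 / real (fst i)))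
      \<le> \<delta> / ?r powr (2 * \<eta>) * cmod (w (n - 1)) powr (2 * \<eta>)"
    proof (rule maximum_principle_powers[where S = ?S])
      show "finite I" by (simp add: I_def)
      fix i assume i: "i \<in> I"
      then have mj: "1 \<le> fst i" "snd i < q (fst i)" by (auto simp: I_def)
      show "(\<lambda>t. f (fst i) (snd i) (v t)) holomorphic_on ?S"
        unfolding v_def by (rule holo_slice(2)[OF f[OF mj] wext n1])
      show "2 / real (fst i) > 0" using mj by simp
      show "\<epsilon> (fst i) \<ge> 0" using \<epsilon>[OF mj(1)] by simp
    next
      \<comment> \<open>The smallness assumption at the foot of the normal line makes each of the
        finitely many quotients tend to 0.\<close>
      show "((\<lambda>z. (\<Sum>i\<in>I. \<epsilon> (fst i) * cmod (f (fst i) (snd i) (v z)) powr (2 / real (fst i))) / cmod z powr (2 * \<eta>)) \<longlongrightarrow> 0) (at 0)"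
        unfolding sum_divide_distrib
      proof (rule tendsto_null_sum)
        fix i assume i: "i \<in> I"
        then have mj: "1 \<le> fst i" "snd i < q (fst i)" by (auto simp: I_def)
        show "((\<lambda>z. \<epsilon> (fst i) * cmod (f (fst i) (snd i) (v z)) powr (2 / real (fst i)) / cmod z powr (2 * \<eta>)) \<longlongrightarrow> 0) (at 0)"
        proof (rule tendstoI)
          fix e :: real assume e: "e > 0"
          define d where "d = e / 2 / \<epsilon> (fst i)"
          have d: "d > 0" using e \<epsilon>[OF mj(1)] by (simp add: d_def)
          have "v 0 \<in> polydisc n a (R / 3)" using v[of 0] r KP3 by auto
          then obtain s where s: "s > 0" "\<And>w. w \<in> polydisc n (v 0) s \<Longrightarrow> cmod (f (fst i) (snd i) w) powr (2 / real (fst i)) \<le> d * cmod (w (n - 1)) powr (2 * \<eta>)"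
            using small[OF mj _ _ d, of "v 0"] by (auto simp: v_def)
          have "eventually (\<lambda>z. z \<in> ball 0 s) (at (0::complex))" using s by (intro eventually_at_in_open') auto
          moreover have "eventually (\<lambda>z. z \<noteq> 0) (at (0::complex))" by (simp add: eventually_at_filter)
          ultimately show "eventually (\<lambda>z. dist (\<epsilon> (fst i) * cmod (f (fst i) (snd i) (v z)) powr (2 / real (fst i)) / cmod z powr (2 * \<eta>)) 0 < e) (at 0)"
          proof eventually_elim
            case (elim z)
            then have "v z \<in> polydisc n (v 0) s" using wext n1 s by (auto simp: v_def polydisc_iff extensional_def)
            from s(2)[OF this] have "cmod (f (fst i) (snd i) (v z)) powr (2 / real (fst i)) \<le> d * cmod z powr (2 * \<eta>)"
              by (simp add: v_def)
            then have "\<epsilon> (fst i) * cmod (f (fst i) (snd i) (v z)) powr (2 / real (fst i)) / cmod z powr (2 * \<eta>)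
               \<le> \<epsilon> (fst i) * (d * cmod z powr (2 * \<eta>)) / cmod z powr (2 * \<eta>)"
              using \<epsilon>[OF mj(1)] by (intro divide_right_mono mult_left_mono) auto
            also have "\<dots> = e / 2" using elim \<epsilon>[OF mj(1)] by (simp add: d_def)
            also have "\<dots> < e" using e by simp
            finally show ?case using \<epsilon>[OF mj(1)] by (simp add: abs_of_nonneg)
          qed
        qed
      qed
      fix z assume "cmod z = ?r"
      then show "(\<Sum>i\<in>I. \<epsilon> (fst i) * cmod (f (fst i) (snd i) (v z)) powr (2 / real (fst i))) \<le> \<delta>"
        unfolding sum_eq by (intro tail v) simp
    qed (use r S w n1 a in \<open>auto simp: cpolydisc_iff\<close>)
    then show ?thesis unfolding sum_eq by (simp add: v_def)
  qed
  obtain K where K: "\<And>\<zeta> L \<tau>. \<lbrakk>\<zeta> \<in> polydisc n a (R / 2); \<zeta> (n - 1) = 0; \<psi> \<zeta> \<noteq> -\<infinity>; 0 < \<tau>; \<tau> \<le> \<mu>;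
      AE w in vol {..<n}. w \<in> cpolydisc n \<zeta> (sqrt \<tau>) \<longrightarrow> real_of_ereal (\<phi> w) \<le> L\<rbrakk>
     \<Longrightarrow> real_of_ereal (\<psi> \<zeta>) \<le> K + L - \<eta> * ln \<tau>"
    using lower_bound by blast
  \<comment> \<open>The summand 1 accounts for the head of the series, the other one for the
    tail.\<close>
  define D where "D = 1 + 1 / ?r powr (2 * \<eta>)"
  have D: "D > 0" unfolding D_def by (intro add_pos_nonneg) auto
  \<comment> \<open>Chosen so that ln (\<delta> D) = \<psi> \<zeta> - K - 1, in contradiction to the
    inequality \<psi> \<zeta> \<le> K + ln (\<delta> D) reached at the end.\<close>
  define \<delta> where "\<delta> = exp (real_of_ereal (\<psi> \<zeta>) - K - 1) / D"
  have \<delta>: "\<delta> > 0" using D by (simp add: \<delta>_def)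
  obtain N where N: "\<And>w N'. w \<in> ?K \<Longrightarrow> N \<le> N' \<Longrightarrow> (\<Sum>m\<in>{N<..N'}. summand m w) \<le> \<delta>"
    by (rule uniform_tail[OF compactin_cpolydisc KU \<delta>]) blast
  \<comment> \<open>Distributes \<delta> over the finitely many sections of the head; the added 1
    keeps the denominator positive when there are none.\<close>
  define \<sigma> where "\<sigma> = \<delta> / (1 + (\<Sum>m=1..N. \<epsilon> m * real (q m)))"
  have \<sigma>nn: "0 \<le> (\<Sum>m=1..N. \<epsilon> m * real (q m))" using \<epsilon> by (intro sum_nonneg) (auto simp: less_imp_le)
  have \<sigma>: "\<sigma> > 0" using \<delta> \<sigma>nn by (simp add: \<sigma>_def)
  have "\<forall>m\<in>{1..N}. \<forall>j\<in>{..<q m}. \<exists>s>0. \<forall>w\<in>polydisc n \<zeta> s. cmod (f m j w) powr (2 / real m) \<le> \<sigma> * cmod (w (n - 1)) powr (2 * \<eta>)"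
    using small[OF _ _ \<zeta>3 \<zeta>(2) \<sigma>] by auto
  then obtain s where s: "\<And>m j. m \<in> {1..N} \<Longrightarrow> j < q m \<Longrightarrow> s m j > 0 \<and>
      (\<forall>w\<in>polydisc n \<zeta> (s m j). cmod (f m j w) powr (2 / real m) \<le> \<sigma> * cmod (w (n - 1)) powr (2 * \<eta>))"
    unfolding Ball_def by (metis lessThan_iff)
  \<comment> \<open>All radii on which the estimates for the head hold; R / 4 keeps the set
    nonempty.\<close>
  define S where "S = insert (R / 4) ((\<lambda>i. s (fst i) (snd i)) ` Sigma {1..N} (\<lambda>m. {..<q m}))"
  have S: "finite S" "S \<noteq> {}" "\<And>x. x \<in> S \<Longrightarrow> x > 0" using s R by (auto simp: S_def)
  obtain \<rho> where \<rho>: "\<rho> > 0" "\<rho> < Min S" "cpolydisc n \<zeta> \<rho> \<subseteq> polydisc n a (R / 4)"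
  proof -
    obtain \<rho>0 where \<rho>0: "\<rho>0 > 0" "cpolydisc n \<zeta> \<rho>0 \<subseteq> polydisc n a (R / 4)"
      by (rule cpolydisc_in_open[OF openin_polydisc \<zeta>(1)])
    have MinS: "Min S > 0" using S by simp
    define \<rho> where "\<rho> = min \<rho>0 (Min S / 2)"
    have "\<rho> > 0" "\<rho> < Min S" "\<rho> \<le> \<rho>0" using MinS \<rho>0 by (auto simp: \<rho>_def)
    moreover have "cpolydisc n \<zeta> \<rho> \<subseteq> cpolydisc n \<zeta> \<rho>0" using \<open>\<rho> \<le> \<rho>0\<close> by (force simp: cpolydisc_iff)
    ultimately show ?thesis using that \<rho>0(2) by blast
  qed
  have fin_small: "cmod (f m j w) powr (2 / real m) \<le> \<sigma> * cmod (w (n - 1)) powr (2 * \<eta>)"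
    if "m \<in> {1..N}" "j < q m" "w \<in> cpolydisc n \<zeta> \<rho>" for m j w
  proof -
    have "s m j \<in> S" using that by (force simp: S_def)
    then have "\<rho> < s m j" using \<rho>(2) Min_le[OF S(1)] by (blast intro: order.strict_trans2)
    then have "w \<in> polydisc n \<zeta> (s m j)" using that(3) by (force simp: polydisc_iff cpolydisc_iff)
    then show ?thesis using s that by blast
  qed
  have G_small: "G w \<le> \<delta> * D * cmod (w (n - 1)) powr (2 * \<eta>)" if w: "w \<in> cpolydisc n \<zeta> \<rho>" "w (n - 1) \<noteq> 0" for w
  proof -
    let ?x = "cmod (w (n - 1)) powr (2 * \<eta>)"
    have wK: "w \<in> ?K" using w \<rho>(3) polydisc_subset_cpolydisc by blast
    have "G w \<le> (\<Sum>m=1..N. summand m w) + \<delta> / ?r powr (2 * \<eta>) * ?x"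
      using wK KU N w(2) by (intro G_split tail_small) auto
    also have "(\<Sum>m=1..N. summand m w) \<le> (\<Sum>m=1..N. \<epsilon> m * real (q m)) * (\<sigma> * ?x)"
    proof -
      have "summand m w \<le> \<epsilon> m * real (q m) * (\<sigma> * ?x)" if m: "m \<in> {1..N}" for m
      proof -
        have "(\<Sum>j<q m. cmod (f m j w) powr (2 / real m)) \<le> (\<Sum>j<q m. \<sigma> * ?x)"
          using fin_small[OF m _ w(1)] by (intro sum_mono) auto
        then show ?thesis unfolding summand using \<epsilon>[of m] m mult_left_mono[of _ "real (q m) * (\<sigma> * ?x)" "\<epsilon> m"]
          by (simp add: mult.assoc)
      qed
      then show ?thesis unfolding sum_distrib_right by (intro sum_mono)
    qed
    also have "(\<Sum>m=1..N. \<epsilon> m * real (q m)) * (\<sigma> * ?x) \<le> \<delta> * ?x"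
    proof -
      have "(\<Sum>m=1..N. \<epsilon> m * real (q m)) * \<sigma> \<le> (1 + (\<Sum>m=1..N. \<epsilon> m * real (q m))) * \<sigma>" using \<sigma> by simp
      also have "\<dots> = \<delta>" using \<sigma>nn by (simp add: \<sigma>_def)
      finally show ?thesis unfolding mult.assoc[symmetric] by (rule mult_right_mono) simp
    qed
    finally show ?thesis by (simp add: D_def algebra_simps)
  qed
  define \<tau> where "\<tau> = min \<mu> (\<rho>\<^sup>2)"
  have \<tau>: "0 < \<tau>" "\<tau> \<le> \<mu>" "\<tau> \<le> \<rho>\<^sup>2" using \<mu>(1) \<rho>(1) by (auto simp: \<tau>_def)
  have sq: "sqrt \<tau> \<le> \<rho>" using \<tau>(3) \<rho>(1) real_le_lsqrt[of \<rho> \<tau>] by simp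
  have sqR: "cpolydisc n \<zeta> (sqrt \<tau>) \<subseteq> cpolydisc n \<zeta> \<rho>" using sq by (force simp: cpolydisc_iff)
  have "AE w in vol {..<n}. w \<in> polydisc n a R \<longrightarrow> G w \<noteq> 0"
    by (rule weight_locally_integrable(2)[OF aU R G_not_identically_zero])
  moreover have "AE w in vol {..<n}. w (n - 1) \<noteq> 0" by (rule AE_vol_component_nonzero) (use n in auto)
  ultimately have "AE w in vol {..<n}. w \<in> cpolydisc n \<zeta> (sqrt \<tau>) \<longrightarrow> real_of_ereal (\<phi> w) \<le> ln (\<delta> * D) + \<eta> * ln \<tau>"
  proof eventually_elim
    case (elim w)
    show ?case
    proof
      assume w: "w \<in> cpolydisc n \<zeta> (sqrt \<tau>)"
      then have w\<rho>: "w \<in> cpolydisc n \<zeta> \<rho>" using sqR by blast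
      have wK: "w \<in> ?K" using w\<rho> \<rho>(3) polydisc_subset_cpolydisc by blast
      then have wU: "w \<in> U" using KU by blast
      have "w \<in> polydisc n a R" using wK R by (force simp: polydisc_iff cpolydisc_iff)
      then have Gne: "G w \<noteq> 0" using elim by blast
      then have Gpos: "0 < G w" using G_nonneg[OF wU] by simp
      \<comment> \<open>On the support of the kernel the factor of order 2\<eta> is at most
        \<tau>^\<eta>; its logarithm cancels the term - \<eta> ln \<tau> of the lower bound, so the
        scale disappears from the result.\<close>
      have "cmod (w (n - 1)) \<le> sqrt \<tau>" using w n1 \<zeta>(2) by (auto simp: cpolydisc_iff)
      then have "cmod (w (n - 1)) powr (2 * \<eta>) \<le> sqrt \<tau> powr (2 * \<eta>)" using \<eta> by (intro powr_mono2) auto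
      also have "sqrt \<tau> powr (2 * \<eta>) = \<tau> powr \<eta>" using \<tau> by (simp add: powr_half_sqrt[symmetric] powr_powr)
      finally have "G w \<le> \<delta> * D * \<tau> powr \<eta>"
        using G_small[OF w\<rho> elim(2)] \<delta> D by (meson mult_left_mono mult_nonneg_nonneg less_imp_le order.trans)
      then have "ln (G w) \<le> ln (\<delta> * D * \<tau> powr \<eta>)" using Gpos by (intro ln_mono) auto
      also have "\<dots> = ln (\<delta> * D) + \<eta> * ln \<tau>" using \<delta> D \<tau> by (simp add: ln_mult ln_powr)
      finally show "real_of_ereal (\<phi> w) \<le> ln (\<delta> * D) + \<eta> * ln \<tau>" using Gne by (simp add: \<phi>)
    qed
  qed
  from K[OF \<zeta>2 \<zeta>(2) \<psi>\<zeta> \<tau>(1,2) this] have "real_of_ereal (\<psi> \<zeta>) \<le> K + ln (\<delta> * D)" by simp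
  also have "\<delta> * D = exp (real_of_ereal (\<psi> \<zeta>) - K - 1)" using D by (simp add: \<delta>_def)
  finally show False by simp
qed

end

section \<open>Charts and vanishing orders\<close>

text \<open>The growth of the term gives \<bar>f\<bar> = O(\<bar>z_n\<bar>^(m\<eta>)). Admitting
  every k < m\<eta> + 1 covers the exact order k = m\<eta> as well as the next integer when m\<eta>
  is not one.\<close>

lemma (in weight_potential) section_divisible:
  assumes m: "1 \<le> m" "j < q m" and k: "real k < real m * \<eta> + 1"
  obtains g where "holo n (polydisc n a (R / 3)) g" "\<And>w. w \<in> polydisc n a (R / 3) \<Longrightarrow> f m j w = w (n - 1) ^ k * g w"
proof -
  obtain K where K: "\<And>m \<zeta>. 1 \<le> m \<Longrightarrow> \<zeta> \<in> polydisc n a (R / 2) \<Longrightarrow> \<zeta> (n - 1) \<noteq> 0 \<Longrightarrow>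
    summand m \<zeta> \<le> exp K * cmod (\<zeta> (n - 1)) powr (2 * \<eta>)"
    using summand_bound by blast
  have sub: "cpolydisc n a (2 * (R / 6)) \<subseteq> polydisc n a (R / 2)" using R by (force simp: polydisc_iff cpolydisc_iff)
  have bound: "cmod (f m j w) \<le> (exp K / \<epsilon> m) powr (real m / 2) * cmod (w (n - 1)) powr (real m * \<eta>)"
    if w: "w \<in> cpolydisc n a (2 * (R / 6))" "w (n - 1) \<noteq> 0" for w
  proof -
    have "\<epsilon> m * cmod (f m j w) powr (2 / real m) \<le> exp K * cmod (w (n - 1)) powr (2 * \<eta>)"
      using summand_ge[OF m, of w] K[OF m(1), of w] w sub by fastforce
    then have "cmod (f m j w) powr (2 / real m) \<le> exp K / \<epsilon> m * cmod (w (n - 1)) powr (2 * \<eta>)"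
      using \<epsilon>[OF m(1)] by (simp add: field_simps)
    then have "(cmod (f m j w) powr (2 / real m)) powr (real m / 2) \<le> (exp K / \<epsilon> m * cmod (w (n - 1)) powr (2 * \<eta>)) powr (real m / 2)"
      by (intro powr_mono2) auto
    also have "(cmod (f m j w) powr (2 / real m)) powr (real m / 2) = cmod (f m j w)"
      using m by (simp add: powr_powr)
    also have "(exp K / \<epsilon> m * cmod (w (n - 1)) powr (2 * \<eta>)) powr (real m / 2) = (exp K / \<epsilon> m) powr (real m / 2) * cmod (w (n - 1)) powr (real m * \<eta>)"
      unfolding powr_mult by (simp add: powr_powr mult.commute)
    finally show ?thesis .
  qed
  show ?thesis
  proof (rule holo_divide_power[OF f[OF m] n _ _ a bound k])
    show "cpolydisc n a (2 * (R / 6)) \<subseteq> U" using sub half_sub by blast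
  qed (use R that in auto)
qed

section \<open>Independence of the vanishing order from the chart\<close>

lemma cderiv_bound:
  assumes f: "holo n W f" and W: "polydisc n b (2 * \<rho>) \<subseteq> W" and B: "\<And>w. w \<in> polydisc n b (2 * \<rho>) \<Longrightarrow> cmod (f w) \<le> B"
    and "\<rho> > 0" and v: "v \<in> polydisc n b \<rho>" and j: "j < n"
  shows "cmod (cderiv j f v) \<le> B / \<rho>"
proof -
  have vext: "v \<in> extensional {..<n}" using v by (simp add: polydisc_iff)
  have upd: "v(j := y) \<in> polydisc n b (2 * \<rho>)" if "cmod (y - v j) \<le> \<rho>" for y
  proof -
    have "cmod (y - b j) \<le> cmod (y - v j) + cmod (v j - b j)" using norm_triangle_ineq[of "y - v j" "v j - b j"] by simp
    then have "cmod (y - b j) < 2 * \<rho>" using v j that by (fastforce simp: polydisc_iff)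
    moreover have "cmod (v i - b i) < 2 * \<rho>" if "i < n" for i using v that \<open>\<rho> > 0\<close> by (fastforce simp: polydisc_iff)
    ultimately show ?thesis using vext j by (auto simp: polydisc_iff extensional_def)
  qed
  have sub: "cball (v j) \<rho> \<subseteq> {y. v(j := y) \<in> W}" using upd W by (auto simp: dist_norm norm_minus_commute)
  have "cmod ((deriv ^^ 1) (\<lambda>t. f (v(j := t))) (v j)) \<le> fact 1 * B / \<rho> ^ 1"
  proof (rule Cauchy_inequality)
    show "(\<lambda>t. f (v(j := t))) holomorphic_on ball (v j) \<rho>"
      using sub ball_subset_cball by (intro holomorphic_on_subset[OF holo_slice(2)[OF f vext j]]) blast
    show "continuous_on (cball (v j) \<rho>) (\<lambda>t. f (v(j := t)))"
      by (rule holomorphic_on_imp_continuous_on[OF holomorphic_on_subset[OF holo_slice(2)[OF f vext j] sub]])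
    show "cmod (f (v(j := y))) \<le> B" if "cmod (v j - y) = \<rho>" for y
      using that by (intro B upd) (simp add: norm_minus_commute)
  qed (use \<open>\<rho> > 0\<close> in auto)
  then show ?thesis by (simp add: cderiv_def)
qed

text \<open>Counts the n! products of the Leibniz formula. It serves to bound the Jacobian of a
  transition map near a point.\<close>

lemma det_bound:
  fixes A :: "complex mat"
  assumes "A \<in> carrier_mat n n" "\<And>i j. i < n \<Longrightarrow> j < n \<Longrightarrow> cmod (A $$ (i, j)) \<le> D"
  shows "cmod (Determinant.det A) \<le> fact n * D ^ n"
proof -
  have "cmod (Determinant.det A) \<le> (\<Sum>p\<in>{p. p permutes {0..<n}}. cmod (signof p * (\<Prod>i = 0..<n. A $$ (i, p i))))"
    using assms(1) by (simp add: Determinant.det_def norm_sum)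
  also have "\<dots> \<le> (\<Sum>p\<in>{p. p permutes {0..<n}}. D ^ n)"
  proof (rule sum_mono)
    fix p assume "p \<in> {p. p permutes {0..<n}}"
    then have p: "p i < n" if "i < n" for i using permutes_in_image[of p "{0..<n}" i] that by simp
    have "cmod (signof p * (\<Prod>i = 0..<n. A $$ (i, p i))) = (\<Prod>i = 0..<n. cmod (A $$ (i, p i)))"
      by (simp add: norm_mult prod_norm sign_def)
    also have "\<dots> \<le> (\<Prod>i = 0..<n. D)" by (intro prod_mono) (use assms(2) p in auto)
    finally show "cmod (signof p * (\<Prod>i = 0..<n. A $$ (i, p i))) \<le> D ^ n" by simp
  qed
  also have "\<dots> = fact n * D ^ n" by (simp add: card_permutations)
  finally show ?thesis .
qed

lemma img_chart_open:
  assumes "complex_manifold n X A" "c \<in> A"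
  shows "openin (Cn n) (img c)"
  using assms unfolding complex_manifold_def is_chart_def by blast

lemma chart_inj:
  assumes "complex_manifold n X A" "c \<in> A"
  shows "inj_on (snd c) (fst c)"
proof -
  have h: "homeomorphic_map (subtopology X (fst c)) (subtopology (Cn n) (img c)) (snd c)" "openin X (fst c)"
    using assms unfolding complex_manifold_def is_chart_def by blast+
  then have "inj_on (snd c) (topspace (subtopology X (fst c)))" by (intro homeomorphic_imp_injective_map)
  moreover have "topspace (subtopology X (fst c)) = fst c" using openin_subset[OF h(2)] by auto
  ultimately show ?thesis by simp
qed

lemma adapted_image:
  assumes "c \<in> adapted_charts n A M"
  shows "snd c ` (M \<inter> fst c) = {w \<in> img c. w (n - 1) = 0}"
  using assms by (auto simp: adapted_charts_def)

text \<open>A section that is divisible by the \<open>k\<close>-th power of the defining coordinate in two adapted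
  charts has quotients vanishing at the same points of \<open>M\<close>: along the normal line the transition map is
  Lipschitz and its Jacobian is bounded.\<close>

lemma vanishing_quotient_chart_independent:
  assumes mf: "complex_manifold n X A" and n: "1 \<le> n"
    and c: "c \<in> adapted_charts n A M" and d: "d \<in> adapted_charts n A M" and y: "y \<in> M" "y \<in> fst c" "y \<in> fst d"
    and \<sigma>: "\<sigma> \<in> plurican n A m"
    and W: "snd c y \<in> W" "W \<subseteq> img c" "holo n W g" "\<And>w. w \<in> W \<Longrightarrow> \<sigma> c w = w (n - 1) ^ k * g w"
    and W': "snd d y \<in> W'" "W' \<subseteq> img d" "holo n W' g'" "\<And>w. w \<in> W' \<Longrightarrow> \<sigma> d w = w (n - 1) ^ k * g' w"
    and g0: "g (snd c y) = 0"
  shows "g' (snd d y) = 0"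
proof -
  have cA: "c \<in> A" "d \<in> A" using c d by (auto simp: adapted_charts_def)
  have compat: "compatible n d c" using mf cA unfolding complex_manifold_def by blast
  have injd: "inj_on (snd d) (fst d)" by (rule chart_inj[OF mf cA(2)])
  define b where "b = snd d y"
  define T where "T = transition d c"
  define O' where "O' = snd d ` (fst d \<inter> fst c)"
  have T_val: "T (snd d z) = snd c z" if "z \<in> fst d" for z
    using that injd by (simp add: T_def transition_def)
  have T_holo: "holo n O' (\<lambda>w. T w i)" if "i < n" for i
    using compat that by (simp add: compatible_def T_def O'_def)
  have n1: "n - 1 < n" using n by simp
  have opO: "openin (Cn n) O'" using T_holo[OF n1] by (simp add: holo_def)
  have opW': "openin (Cn n) W'" using W' by (simp add: holo_def)
  have bO: "b \<in> O' \<inter> W'" using y W' by (auto simp: b_def O'_def)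
  have bn: "b (n - 1) = 0" using d y by (simp add: adapted_charts_def b_def)
  obtain r where r: "r > 0" "cpolydisc n b r \<subseteq> O' \<inter> W'"
    by (rule cpolydisc_in_open[OF openin_Int[OF opO opW'] bO])
  define \<rho> where "\<rho> = r / 2"
  have \<rho>: "\<rho> > 0" "2 * \<rho> = r" using r by (auto simp: \<rho>_def)
  have bext: "b \<in> extensional {..<n}" using openin_Cn_extensional[OF opO] bO by blast
  have "\<exists>B>0. \<forall>w\<in>cpolydisc n b r. cmod (T w i) \<le> B" if i: "i < n" for i
    by (rule holo_bounded_on_cpolydisc[OF T_holo[OF i], of b r]) (use r in auto)
  then obtain B0 where B0: "\<And>i w. i < n \<Longrightarrow> w \<in> cpolydisc n b r \<Longrightarrow> cmod (T w i) \<le> B0 i" "\<And>i. i < n \<Longrightarrow> B0 i > 0" by metis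
  define B where "B = Max (B0 ` {..<n})"
  have B: "cmod (T w i) \<le> B" if "i < n" "w \<in> cpolydisc n b r" for i w
    unfolding B_def by (rule order.trans[OF B0(1)[OF that] Max_ge]) (use that in auto)
  have pc: "polydisc n b (2 * \<rho>) \<subseteq> cpolydisc n b r" using \<rho> polydisc_subset_cpolydisc by metis
  define J where "J = fact n * (B / \<rho>) ^ n"
  have jac: "cmod (jacobian n d c v) \<le> J" if v: "v \<in> polydisc n b \<rho>" for v
    unfolding jacobian_def J_def
  proof (rule det_bound)
    fix i j assume ij: "i < n" "j < n"
    have "cmod (cderiv j (\<lambda>w. T w i) v) \<le> B / \<rho>"
      using pc r(2) B[OF ij(1)] by (intro cderiv_bound[OF T_holo[OF ij(1)] _ _ \<rho>(1) v ij(2)]) blast+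
    then show "cmod (Matrix.mat n n (\<lambda>(i, j). cderiv j (\<lambda>v. transition d c v i) v) $$ (i, j)) \<le> B / \<rho>"
      using ij by (simp add: T_def)
  qed simp
  \<comment> \<open>The normal line of M through the point, in the chart d.\<close>
  define v where "v t = b(n - 1 := t)" for t
  have v_in: "v t \<in> polydisc n b \<rho>" if "cmod t < \<rho>" for t
    using that n1 bn bext \<rho> by (auto simp: v_def polydisc_iff extensional_def)
  have v_in2: "v t \<in> polydisc n b (2 * \<rho>)" if "cmod t < 2 * \<rho>" for t
    using that n1 bn bext \<rho> by (auto simp: v_def polydisc_iff extensional_def)
  have v0: "v 0 = b" using bn by (auto simp: v_def)
  have Tb: "T b = snd c y" using y by (simp add: b_def T_val)
  have Tb0: "T b (n - 1) = 0" using Tb c y by (simp add: adapted_charts_def)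
  \<comment> \<open>The transition maps the point of M to a point of M, so its last component is 0
    at t = 0 and is bounded by a multiple of \<bar>t\<bar> along the normal line.\<close>
  have Lip: "cmod (T (v t) (n - 1)) \<le> B / \<rho> * cmod t" if t: "cmod t < \<rho>" for t
  proof -
    have "(\<lambda>t. T (v t) (n - 1)) holomorphic_on ball 0 (2 * \<rho>)"
      unfolding v_def using v_in2 pc r(2)
      by (intro holomorphic_on_subset[OF holo_slice(2)[OF T_holo[OF n1] bext n1]]) (force simp: v_def)
    then have "cmod (T (v t) (n - 1) - T (v 0) (n - 1)) \<le> B / \<rho> * cmod (t - 0)"
      using v_in2 pc B[OF n1] \<rho> t by (intro holomorphic_slice_lipschitz[of "\<lambda>t. T (v t) (n - 1)" 0 \<rho> B]) auto
    then show ?thesis by (simp only: v0 Tb0 diff_0_right)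
  qed
  have Tcont: "((\<lambda>t. T (v t) i) \<longlongrightarrow> snd c y i) (at 0)" if i: "i < n" for i
  proof -
    have "(\<lambda>t. T (v t) i) holomorphic_on ball 0 (2 * \<rho>)"
      unfolding v_def using v_in2 pc r(2)
      by (intro holomorphic_on_subset[OF holo_slice(2)[OF T_holo[OF i] bext n1]]) (force simp: v_def)
    then have "isCont (\<lambda>t. T (v t) i) 0" using \<rho> 
      by (meson centre_in_ball continuous_on_eq_continuous_at holomorphic_on_imp_continuous_on mult_pos_pos open_ball zero_less_numeral)
    then show ?thesis by (simp add: isCont_def v0 Tb)
  qed
  have Text: "T (v t) \<in> extensional {..<n}" if "cmod t < \<rho>" for t
  proof -
    have "v t \<in> O'" using v_in2[of t] that \<rho> pc r(2) by force
    then obtain z where z: "z \<in> fst d" "z \<in> fst c" "v t = snd d z" by (auto simp: O'_def)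
    have "img c \<subseteq> extensional {..<n}" by (rule openin_Cn_extensional[OF img_chart_open[OF mf cA(1)]])
    then show ?thesis using z T_val by auto
  qed
  have near: "eventually (\<lambda>t. t \<in> ball 0 \<rho>) (at (0::complex))" using \<rho> by (intro eventually_at_in_open') auto
  have g_lim: "((\<lambda>t. g (T (v t))) \<longlongrightarrow> 0) (at 0)" and T_W: "eventually (\<lambda>t. T (v t) \<in> W) (at 0)"
  proof -
    have opW: "openin (Cn n) W" using W by (simp add: holo_def)
    have ev: "eventually (\<lambda>t. T (v t) \<in> S) (at 0)" if S: "openin (Cn n) S" "snd c y \<in> S" for S
    proof -
      obtain s where s: "s > 0" "cpolydisc n (snd c y) s \<subseteq> S" by (rule cpolydisc_in_open[OF S])
      have "eventually (\<lambda>t. \<forall>i\<in>{..<n}. dist (T (v t) i) (snd c y i) < s) (at 0)"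
        by (intro eventually_ball_finite ballI tendstoD[OF Tcont]) (use s in auto)
      with near show ?thesis
      proof eventually_elim
        case (elim t)
        then have "T (v t) \<in> cpolydisc n (snd c y) s" using Text[of t] by (auto simp: cpolydisc_iff dist_norm less_imp_le)
        then show ?case using s by blast
      qed
    qed
    show "eventually (\<lambda>t. T (v t) \<in> W) (at 0)" by (rule ev[OF opW W(1)])
    show "((\<lambda>t. g (T (v t))) \<longlongrightarrow> 0) (at 0)"
    proof (rule tendstoI)
      fix e :: real assume e: "e > 0"
      have "openin (Cn n) {w \<in> W. g w \<in> ball 0 e}"
        using W(3) by (intro openin_Cn_preimage) (auto simp: holo_def)
      moreover have "snd c y \<in> {w \<in> W. g w \<in> ball 0 e}"
        using W(1) g0 e by simp
      ultimately have "eventually (\<lambda>t. T (v t) \<in> {w \<in> W. g w \<in> ball 0 e}) (at 0)" by (rule ev)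
      then show "eventually (\<lambda>t. dist (g (T (v t))) 0 < e) (at 0)" by eventually_elim simp
    qed
  qed
  have "((\<lambda>t. g' (v t)) \<longlongrightarrow> 0) (at 0)"
  proof (rule Lim_null_comparison)
    have "((\<lambda>t. (B / \<rho>) ^ k * J ^ m * cmod (g (T (v t)))) \<longlongrightarrow> (B / \<rho>) ^ k * J ^ m * cmod 0) (at 0)"
      by (intro tendsto_intros g_lim)
    then show "((\<lambda>t. (B / \<rho>) ^ k * J ^ m * cmod (g (T (v t)))) \<longlongrightarrow> 0) (at 0)" by simp
    have "eventually (\<lambda>t. t \<noteq> 0) (at (0::complex))" by (simp add: eventually_at_filter)
    with near T_W show "eventually (\<lambda>t. cmod (g' (v t)) \<le> (B / \<rho>) ^ k * J ^ m * cmod (g (T (v t)))) (at 0)"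
    proof eventually_elim
      case (elim t)
      have tr: "cmod t < \<rho>" using elim by simp
      have vP: "v t \<in> cpolydisc n b r" using v_in2[of t] tr \<rho> pc by force
      then have vO: "v t \<in> O'" "v t \<in> W'" using r(2) by auto
      have "\<sigma> d (v t) = \<sigma> c (T (v t)) * jacobian n d c (v t) ^ m"
        using \<sigma> cA vO(1) unfolding plurican_def T_def O'_def by blast
      \<comment> \<open>The transformation rule of a section of mK. By \<open>Lip\<close> the k-th
        power on the right is at most a constant times \<bar>t\<bar>^k, so t^k cancels and g' is
        dominated by g along the image of the normal line.\<close>
      then have eq: "t ^ k * g' (v t) = T (v t) (n - 1) ^ k * g (T (v t)) * jacobian n d c (v t) ^ m"
        using W'(4)[OF vO(2)] W(4)[OF elim(2)] by (simp add: v_def)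
      have "cmod t ^ k * cmod (g' (v t)) = cmod (T (v t) (n - 1)) ^ k * cmod (g (T (v t))) * cmod (jacobian n d c (v t)) ^ m"
        using arg_cong[OF eq, of cmod] by (simp add: norm_mult norm_power)
      also have "\<dots> \<le> (B / \<rho> * cmod t) ^ k * cmod (g (T (v t))) * J ^ m"
        by (intro mult_mono' power_mono Lip[OF tr] jac[OF v_in[OF tr]] order.refl) auto
      also have "\<dots> = cmod t ^ k * ((B / \<rho>) ^ k * J ^ m * cmod (g (T (v t))))"
        unfolding power_mult_distrib by (simp only: ac_simps)
      finally show ?case using elim by simp
    qed
  qed
  moreover have "((\<lambda>t. g' (v t)) \<longlongrightarrow> g' b) (at 0)"
  proof -
    have "(\<lambda>t. g' (v t)) holomorphic_on ball 0 (2 * \<rho>)"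
      unfolding v_def using v_in2 pc r(2)
      by (intro holomorphic_on_subset[OF holo_slice(2)[OF W'(3) bext n1]]) (force simp: v_def)
    then have "isCont (\<lambda>t. g' (v t)) 0" using \<rho>
      by (meson centre_in_ball continuous_on_eq_continuous_at holomorphic_on_imp_continuous_on mult_pos_pos open_ball zero_less_numeral)
    then show ?thesis by (simp add: isCont_def v0)
  qed
  ultimately have "g' b = 0" using tendsto_unique trivial_limit_at by blast
  then show ?thesis by (simp add: b_def)
qed

text \<open>Off the hyperplane, \<bar>f\<bar>^(2/m) is \<bar>w_n\<bar>^(2\<eta>) times
  \<bar>w_n\<bar>^(2k/m - 2\<eta>) \<bar>g\<bar>^(2/m). The second factor is small near y either
  because its exponent of \<bar>w_n\<bar> is positive or because that exponent is 0 and g vanishes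
  at y.\<close>

lemma divisible_small:
  assumes g: "holo n W g" and f: "\<And>w. w \<in> W \<Longrightarrow> f w = w (n - 1) ^ k * g w" and n: "1 \<le> n"
    and k: "real m * \<eta> \<le> real k" "real k = real m * \<eta> \<Longrightarrow> g y = 0" and m: "1 \<le> m" and \<eta>: "\<eta> > 0"
    and y: "y \<in> W" "y (n - 1) = 0" and \<delta>: "\<delta> > 0"
  shows "\<exists>r>0. \<forall>w\<in>polydisc n y r. cmod (f w) powr (2 / real m) \<le> \<delta> * cmod (w (n - 1)) powr (2 * \<eta>)"
proof -
  have opW: "openin (Cn n) W" using g by (simp add: holo_def)
  have k1: "k > 0" using k(1) m \<eta> by (intro gr0I) (auto simp: mult_le_0_iff)
  have n1: "n - 1 < n" using n by simp
  have red: "cmod (f w) powr (2 / real m) \<le> \<delta> * cmod (w (n - 1)) powr (2 * \<eta>)"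
    if w: "w \<in> W" and le: "w (n - 1) \<noteq> 0 \<Longrightarrow> cmod (w (n - 1)) powr (2 * real k / real m - 2 * \<eta>) * cmod (g w) powr (2 / real m) \<le> \<delta>" for w
  proof (cases "w (n - 1) = 0")
    case True
    then show ?thesis using f[OF w] k1 by simp
  next
    case False
    have "cmod (f w) powr (2 / real m) = (cmod (w (n - 1)) powr real k * cmod (g w)) powr (2 / real m)"
      using False by (simp add: f[OF w] norm_mult norm_power powr_realpow)
    also have "\<dots> = cmod (w (n - 1)) powr (2 * real k / real m) * cmod (g w) powr (2 / real m)"
      by (subst powr_mult) (auto simp: powr_powr mult.commute)
    also have "cmod (w (n - 1)) powr (2 * real k / real m) = cmod (w (n - 1)) powr (2 * \<eta>) * cmod (w (n - 1)) powr (2 * real k / real m - 2 * \<eta>)"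
      by (simp flip: powr_add)
    also have "\<dots> * cmod (g w) powr (2 / real m) \<le> cmod (w (n - 1)) powr (2 * \<eta>) * \<delta>"
      unfolding mult.assoc by (intro mult_left_mono le False) simp
    finally show ?thesis by (simp add: mult.commute)
  qed
  show ?thesis
  proof (cases "real k = real m * \<eta>")
    case True
    have op: "openin (Cn n) {w \<in> W. g w \<in> ball 0 (\<delta> powr (real m / 2))}"
      using g by (intro openin_Cn_preimage) (auto simp: holo_def)
    have in_: "y \<in> {w \<in> W. g w \<in> ball 0 (\<delta> powr (real m / 2))}"
      using y k(2)[OF True] \<delta> by simp
    obtain r where r: "r > 0" "cpolydisc n y r \<subseteq> {w \<in> W. g w \<in> ball 0 (\<delta> powr (real m / 2))}"
      by (rule cpolydisc_in_open[OF op in_])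
    have ex0: "2 * real k / real m - 2 * \<eta> = 0" using True m by simp
    have "cmod (f w) powr (2 / real m) \<le> \<delta> * cmod (w (n - 1)) powr (2 * \<eta>)" if "w \<in> polydisc n y r" for w
    proof (rule red)
      have w: "w \<in> {w \<in> W. g w \<in> ball 0 (\<delta> powr (real m / 2))}"
        using that r(2) polydisc_subset_cpolydisc by blast
      then show "w \<in> W" by simp
      assume "w (n - 1) \<noteq> 0"
      have "cmod (g w) powr (2 / real m) \<le> (\<delta> powr (real m / 2)) powr (2 / real m)"
        using w by (intro powr_mono2) auto
      also have "\<dots> = \<delta>" using m \<delta> by (simp add: powr_powr)
      finally show "cmod (w (n - 1)) powr (2 * real k / real m - 2 * \<eta>) * cmod (g w) powr (2 / real m) \<le> \<delta>"
        using \<open>w (n - 1) \<noteq> 0\<close> unfolding ex0 by simp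
    qed
    then show ?thesis using r(1) by blast
  next
    case False
    define e where "e = 2 * real k / real m - 2 * \<eta>"
    have "2 * \<eta> < 2 * real k / real m" using k(1) False m by (simp add: field_simps)
    then have e: "e > 0" by (simp add: e_def)
    obtain r1 where r1: "r1 > 0" "cpolydisc n y r1 \<subseteq> W" by (rule cpolydisc_in_open[OF opW y(1)])
    obtain B where B: "B > 0" "\<And>w. w \<in> cpolydisc n y r1 \<Longrightarrow> cmod (g w) \<le> B"
      by (rule holo_bounded_on_cpolydisc[OF g r1(2)]) blast
    \<comment> \<open>Solves r^e B^(2/m) = \<delta>, capped by the radius on which g is bounded by
      B.\<close>
    define r where "r = min r1 ((\<delta> / B powr (2 / real m)) powr (1 / e))"
    have r: "r > 0" "r \<le> r1" "r \<le> (\<delta> / B powr (2 / real m)) powr (1 / e)" using r1 B \<delta> by (auto simp: r_def)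
    have "cmod (f w) powr (2 / real m) \<le> \<delta> * cmod (w (n - 1)) powr (2 * \<eta>)" if w: "w \<in> polydisc n y r" for w
    proof (rule red)
      have w1: "w \<in> cpolydisc n y r1" using w r(2) by (force simp: polydisc_iff cpolydisc_iff)
      then show "w \<in> W" using r1 by blast
      have "cmod (w (n - 1)) \<le> (\<delta> / B powr (2 / real m)) powr (1 / e)"
        using w n1 y(2) r(3) by (force simp: polydisc_iff)
      then have "cmod (w (n - 1)) powr e \<le> ((\<delta> / B powr (2 / real m)) powr (1 / e)) powr e"
        using e by (intro powr_mono2) auto
      also have "\<dots> = \<delta> / B powr (2 / real m)" using e \<delta> B by (simp add: powr_powr)
      finally have "cmod (w (n - 1)) powr e * cmod (g w) powr (2 / real m) \<le> \<delta> / B powr (2 / real m) * B powr (2 / real m)"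
        using B(2)[OF w1] by (intro mult_mono powr_mono2) (use \<delta> in auto)
      then show "cmod (w (n - 1)) powr (2 * real k / real m - 2 * \<eta>) * cmod (g w) powr (2 / real m) \<le> \<delta>"
        using B(1) by (simp add: e_def)
    qed
    then show ?thesis using r(1) by blast
  qed
qed

section \<open>Passage to coordinates on the hypersurface\<close>

lemma extend_hyperplane:
  fixes n :: nat
  assumes "1 \<le> n" "v \<in> extensional {..<n - 1}"
  shows "v(n - 1 := 0) \<in> extensional {..<n}" "restrict (v(n - 1 := 0)) {..<n - 1} = v"
proof -
  obtain k where "n = Suc k" using assms(1) by (cases n) auto
  then show "v(n - 1 := 0) \<in> extensional {..<n}" "restrict (v(n - 1 := 0)) {..<n - 1} = v"
    using assms(2) by (auto simp: extensional_def fun_eq_iff)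
qed

lemma restrict_hyperplane:
  fixes n :: nat
  assumes "1 \<le> n" "w \<in> extensional {..<n}" "w (n - 1) = 0"
  shows "(restrict w {..<n - 1})(n - 1 := 0) = w"
  using assms by (cases n) (auto simp: extensional_def fun_eq_iff)

lemma polydisc_hyperplane:
  assumes "1 \<le> n" "a (n - 1) = 0" "r > 0" "v \<in> extensional {..<n - 1}"
  shows "v(n - 1 := 0) \<in> polydisc n a r \<longleftrightarrow> v \<in> polydisc (n - 1) (restrict a {..<n - 1}) r"
proof -
  have "cmod ((v(n - 1 := 0)) j - a j) < r \<longleftrightarrow> j = n - 1 \<or> cmod (v j - a j) < r" if "j < n" for j
    using that assms by auto
  moreover have "j < n - 1 \<longleftrightarrow> j < n \<and> j \<noteq> n - 1" for j using assms(1) by auto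
  ultimately show ?thesis
    using extend_hyperplane(1)[OF assms(1,4)] assms(4) by (auto simp: polydisc_iff)
qed

text \<open>Points of the smaller space are \<open>undefined\<close> at n - 1; overwriting this
  value by 0 embeds the space as the hyperplane, with restriction as the inverse.\<close>

lemma img_restrict_chart:
  assumes c: "c \<in> adapted_charts n A M" and n: "1 \<le> n" and ext: "img c \<subseteq> extensional {..<n}"
  shows "img (restrict_chart n M c) = {v \<in> extensional {..<n - 1}. v(n - 1 := 0) \<in> img c}"
proof -
  have "img (restrict_chart n M c) = (\<lambda>x. restrict (snd c x) {..<n - 1}) ` (fst c \<inter> M)"
    by (auto simp: restrict_chart_def)
  also have "\<dots> = {v \<in> extensional {..<n - 1}. v(n - 1 := 0) \<in> img c}"
  proof (intro equalityI subsetI)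
    fix v assume "v \<in> (\<lambda>x. restrict (snd c x) {..<n - 1}) ` (fst c \<inter> M)"
    then obtain x where x: "x \<in> fst c" "x \<in> M" "v = restrict (snd c x) {..<n - 1}" by auto
    have "snd c x (n - 1) = 0" using c x by (simp add: adapted_charts_def)
    then have "v(n - 1 := 0) = snd c x" unfolding x(3) using n ext x by (intro restrict_hyperplane) auto
    then show "v \<in> {v \<in> extensional {..<n - 1}. v(n - 1 := 0) \<in> img c}" using x by auto
  next
    fix v assume v: "v \<in> {v \<in> extensional {..<n - 1}. v(n - 1 := 0) \<in> img c}"
    then obtain x where x: "x \<in> fst c" "v(n - 1 := 0) = snd c x" by auto
    have "snd c x (n - 1) = 0" by (simp flip: x(2))
    then have "x \<in> M" using c x by (simp add: adapted_charts_def)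
    moreover have "restrict (v(n - 1 := 0)) {..<n - 1} = v" using v by (intro extend_hyperplane(2)[OF n]) simp
    then have "v = restrict (snd c x) {..<n - 1}" unfolding x(2) by (rule sym)
    ultimately show "v \<in> (\<lambda>x. restrict (snd c x) {..<n - 1}) ` (fst c \<inter> M)" using x by blast
  qed
  finally show ?thesis .
qed

lemma holo_restrict_hyperplane:
  assumes g: "holo n (polydisc n a r) g" and n: "1 \<le> n" "a (n - 1) = 0" "r > 0"
  shows "holo (n - 1) (polydisc (n - 1) (restrict a {..<n - 1}) r) (\<lambda>v. g (v(n - 1 := 0)))"
proof -
  let ?W = "polydisc n a r" and ?V = "polydisc (n - 1) (restrict a {..<n - 1}) r"
  have VW: "v(n - 1 := 0) \<in> ?W" if "v \<in> ?V" for v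
    using polydisc_hyperplane[of n a r v] n that by (simp add: polydisc_iff)
  have top: "topspace (subtopology (Cn (n - 1)) ?V) = ?V"
    using openin_subset[OF openin_polydisc] by (simp add: Int_absorb1)
  have "continuous_map (Cn (n - 1)) euclidean (\<lambda>v. (v(n - 1 := 0)) i)" if "i < n" for i
    using that continuous_map_component_Cn[of i "n - 1"] by (cases "i = n - 1") auto
  then have "continuous_map (subtopology (Cn (n - 1)) ?V) (Cn n) (\<lambda>v. v(n - 1 := 0))"
    unfolding Cn_def[of n] continuous_map_componentwise top
  proof (intro conjI ballI)
    show "(\<lambda>v. v(n - 1 := 0)) ` ?V \<subseteq> extensional {..<n}" using VW by (auto simp only: polydisc_iff)
  qed (use continuous_map_from_subtopology in \<open>blast\<close>)
  then have "continuous_map (subtopology (Cn (n - 1)) ?V) (subtopology (Cn n) ?W) (\<lambda>v. v(n - 1 := 0))"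
    using VW by (auto simp: continuous_map_in_subtopology top)
  then have "continuous_map (subtopology (Cn (n - 1)) ?V) euclidean (g \<circ> (\<lambda>v. v(n - 1 := 0)))"
    using g by (intro continuous_map_compose) (auto simp: holo_def)
  moreover have "(\<lambda>t. g ((v(j := t))(n - 1 := 0))) field_differentiable (at (v j))" if "v \<in> ?V" "j < n - 1" for v j
  proof -
    have "(\<lambda>t. g ((v(n - 1 := 0))(j := t))) field_differentiable (at ((v(n - 1 := 0)) j))"
    proof -
      have "j < n" using that(2) by simp
      then show ?thesis using g VW[OF that(1)] unfolding holo_def by blast
    qed
    moreover have "(v(n - 1 := 0))(j := t) = (v(j := t))(n - 1 := 0)" for t using that by (auto simp: fun_eq_iff)
    ultimately show ?thesis using that by simp
  qed
  ultimately show ?thesis by (simp add: holo_def openin_polydisc o_def)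
qed

text \<open>In a chart with \<sigma> = w_n^k g the points of non-exact order are the zeros of g on
  M. Exactness may be witnessed in any adapted chart, so the independence of these zeros from the
  chart is what makes the description correct.\<close>

lemma analytic_non_exact_vanishing:
  assumes mf: "complex_manifold n X A" and n: "1 \<le> n" and MX: "M \<subseteq> topspace X" and \<sigma>: "\<sigma> \<in> plurican n A m"
    and loc: "\<And>x. x \<in> M \<Longrightarrow> \<exists>c\<in>adapted_charts n A M. x \<in> fst c \<and> (\<exists>r>0. \<exists>g. polydisc n (snd c x) r \<subseteq> img c \<and>
      holo n (polydisc n (snd c x) r) g \<and> (\<forall>w\<in>polydisc n (snd c x) r. \<sigma> c w = w (n - 1) ^ k * g w))"
  shows "analytic_subset (n - 1) (subtopology X M) (induced_atlas n A M) {y \<in> M. \<not> vanishing_order_at n A M \<sigma> k y}"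
    (is "analytic_subset _ _ _ ?Z")
  unfolding analytic_subset_def
proof (intro conjI ballI)
  show "?Z \<subseteq> topspace (subtopology X M)" using MX by auto
  fix x assume "x \<in> topspace (subtopology X M)"
  then have x: "x \<in> M" by simp
  obtain c r g where c: "c \<in> adapted_charts n A M" "x \<in> fst c" and r: "r > 0"
    and W: "polydisc n (snd c x) r \<subseteq> img c" "holo n (polydisc n (snd c x) r) g"
      "\<And>w. w \<in> polydisc n (snd c x) r \<Longrightarrow> \<sigma> c w = w (n - 1) ^ k * g w"
    using loc[OF x] by blast
  let ?W = "polydisc n (snd c x) r" and ?c = "restrict_chart n M c"
  let ?V = "polydisc (n - 1) (snd ?c x) r"
  have cA: "c \<in> A" using c by (simp add: adapted_charts_def)
  have x0: "snd c x (n - 1) = 0" using c x by (simp add: adapted_charts_def)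
  have ext: "img c \<subseteq> extensional {..<n}" using openin_Cn_extensional[OF img_chart_open[OF mf cA]] .
  have cx: "snd ?c x = restrict (snd c x) {..<n - 1}" using c x by (simp add: restrict_chart_def)
  have VW: "v(n - 1 := 0) \<in> ?W \<longleftrightarrow> v \<in> ?V" if "v \<in> extensional {..<n - 1}" for v
    unfolding cx by (rule polydisc_hyperplane[of n "snd c x", OF n x0 r that])
  have van: "vanishing_order_at n A M \<sigma> k y \<longleftrightarrow> g (snd c y) \<noteq> 0" if y: "y \<in> M" "y \<in> fst c" "snd c y \<in> ?W" for y
  proof
    assume "g (snd c y) \<noteq> 0"
    then show "vanishing_order_at n A M \<sigma> k y" unfolding vanishing_order_at_def using c y W by blast
  next
    assume "vanishing_order_at n A M \<sigma> k y"
    then obtain d W' g' where d: "d \<in> adapted_charts n A M" "y \<in> fst d" "snd d y \<in> W'" "W' \<subseteq> img d" "holo n W' g'"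
      "\<And>w. w \<in> W' \<Longrightarrow> \<sigma> d w = w (n - 1) ^ k * g' w" "g' (snd d y) \<noteq> 0"
      unfolding vanishing_order_at_def by blast
    show "g (snd c y) \<noteq> 0"
    proof
      assume g0: "g (snd c y) = 0"
      have "g' (snd d y) = 0"
        by (rule vanishing_quotient_chart_independent[OF mf n c(1) d(1) y(1,2) d(2) \<sigma> y(3) W d(3-6) g0])
      then show False using d(7) by simp
    qed
  qed
  have Zeq: "snd ?c ` (?Z \<inter> fst ?c) \<inter> ?V = {v \<in> ?V. \<forall>F\<in>{\<lambda>v. g (v(n - 1 := 0))}. F v = 0}"
  proof (intro equalityI subsetI)
    fix v assume v: "v \<in> snd ?c ` (?Z \<inter> fst ?c) \<inter> ?V"
    then obtain y where y: "y \<in> M" "y \<in> fst c" "\<not> vanishing_order_at n A M \<sigma> k y" "v = restrict (snd c y) {..<n - 1}"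
      by (auto simp: restrict_chart_def)
    have y0: "snd c y (n - 1) = 0" using c y by (simp add: adapted_charts_def)
    have eq: "v(n - 1 := 0) = snd c y" unfolding y(4) using n ext y(2) y0 by (intro restrict_hyperplane) auto
    have vV: "v \<in> ?V" using v by blast
    then have "v \<in> extensional {..<n - 1}" by (simp add: polydisc_iff)
    from VW[OF this] vV have "snd c y \<in> ?W" unfolding eq by blast
    then have "g (snd c y) = 0" using van y by blast
    then show "v \<in> {v \<in> ?V. \<forall>F\<in>{\<lambda>v. g (v(n - 1 := 0))}. F v = 0}" using v eq by simp
  next
    fix v assume v: "v \<in> {v \<in> ?V. \<forall>F\<in>{\<lambda>v. g (v(n - 1 := 0))}. F v = 0}"
    then have vext: "v \<in> extensional {..<n - 1}" by (simp add: polydisc_iff)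
    have vW: "v(n - 1 := 0) \<in> ?W" using VW[OF vext] v by simp
    then obtain y where y: "y \<in> fst c" "v(n - 1 := 0) = snd c y" using W(1) by auto
    have "snd c y (n - 1) = 0" by (simp flip: y(2))
    then have yM: "y \<in> M" using c y by (simp add: adapted_charts_def)
    have "\<not> vanishing_order_at n A M \<sigma> k y" using van[OF yM y(1)] vW v y(2) by simp
    moreover have "v = snd ?c y" using extend_hyperplane(2)[OF n vext, unfolded y(2)] y(1) yM by (simp add: restrict_chart_def)
    ultimately show "v \<in> snd ?c ` (?Z \<inter> fst ?c) \<inter> ?V" using v y yM by (auto simp: restrict_chart_def)
  qed
  show "\<exists>c\<in>induced_atlas n A M. x \<in> fst c \<and> (\<exists>W Fs. openin (Cn (n - 1)) W \<and> snd c x \<in> W \<and> W \<subseteq> img c \<and>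
      finite Fs \<and> (\<forall>F\<in>Fs. holo (n - 1) W F) \<and> snd c ` (?Z \<inter> fst c) \<inter> W = {w \<in> W. \<forall>F\<in>Fs. F w = 0})"
  proof (intro bexI[of _ ?c] conjI exI[of _ ?V] exI[of _ "{\<lambda>v. g (v(n - 1 := 0))}"])
    show "?c \<in> induced_atlas n A M" using c by (simp add: induced_atlas_def)
    show "x \<in> fst ?c" using c x by (simp add: restrict_chart_def)
    show "snd ?c x \<in> ?V" unfolding cx using r by (auto simp: polydisc_iff)
    show "?V \<subseteq> img ?c" unfolding img_restrict_chart[OF c(1) n ext]
      using VW W(1) by (auto simp: polydisc_iff)
    show "\<forall>F\<in>{\<lambda>v. g (v(n - 1 := 0))}. holo (n - 1) ?V F"
      unfolding cx using holo_restrict_hyperplane[OF W(2) n x0 r] by simp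
    show "snd ?c ` (?Z \<inter> fst ?c) \<inter> ?V = {v \<in> ?V. \<forall>F\<in>{\<lambda>v. g (v(n - 1 := 0))}. F v = 0}" by (rule Zeq)
  qed (auto intro: openin_polydisc)
qed

section \<open>Charts supplied by the restricted current, and the conclusion\<close>

lemma module_section_scale: "Modules.module section_scale"
  by (unfold_locales) (auto simp: section_scale_def fun_eq_iff algebra_simps)

lemma basis_in_plurican:
  assumes "min_singularity_data n A \<epsilon> q s" "1 \<le> m" "j < q m"
  shows "s m j \<in> plurican n A m"
proof -
  have "module.span section_scale (s m ` {..<q m}) = plurican n A m"
    using assms by (simp add: min_singularity_data_def)
  moreover have "s m j \<in> module.span section_scale (s m ` {..<q m})"
    using assms(3) by (intro Modules.module.span_base[OF module_section_scale]) auto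
  ultimately show ?thesis by simp
qed

text \<open>The restriction hypothesis yields a chart with a potential on its whole image. A closed
  polydisc in it, of radius r = 4 R, is compact, so the potential is bounded above there, and it has
  the room required by the integrability estimates. The last conclusion retains that \<psi> is not
  identically -\<infinity> on an open piece of M.\<close>

lemma restriction_weight_potential:
  assumes mf: "complex_manifold n X A" and msd: "min_singularity_data n A \<epsilon> q s" and n: "1 \<le> n" and \<eta>: "\<eta> > 0"
    and restr: "is_restriction n A M
      (\<lambda>c j k f. curvature_current n (min_singularity_weight \<epsilon> q s) c j k f - of_real \<eta> * hypersurface_current n M c j k f) S"
    and x: "x \<in> M" and lk: "log_kernel E E1 E2 \<beta>"
  obtains c R C \<psi> where "c \<in> adapted_charts n A M" "x \<in> fst c"
    "weight_potential n (img c) \<epsilon> q (\<lambda>m j. s m j c) (\<lambda>m. metric_term \<epsilon> q s m c)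
      (\<lambda>w. \<Sum>m. metric_term \<epsilon> q s (Suc m) c w) (min_singularity_weight \<epsilon> q s c) E E1 E2 \<beta>
      {w \<in> img c. w (n - 1) = 0} (snd c x) R \<eta> C \<psi>"
    "psh (n - 1) (img (restrict_chart n M c)) (\<lambda>v. \<psi> (v(n - 1 := 0)))"
proof -
  obtain c \<psi> where c: "c \<in> adapted_charts n A M" "x \<in> fst c" and \<psi>: "psh n (img c) \<psi>"
    and cur: "current_eq n (img c) (\<lambda>j k f. curvature_current n (min_singularity_weight \<epsilon> q s) c j k f - of_real \<eta> * hypersurface_current n M c j k f) (ddc n \<psi>)"
    and \<psi>': "psh (n - 1) (img (restrict_chart n M c)) (\<lambda>v. \<psi> (v(n - 1 := 0)))"
    using restr[unfolded is_restriction_def, rule_format, OF x] unfolding Let_def by blast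
  have cA: "c \<in> A" using c by (simp add: adapted_charts_def)
  have op: "openin (Cn n) (img c)" by (rule img_chart_open[OF mf cA])
  have sec: "holo n (img c) (s m j c)" if "1 \<le> m" "j < q m" for m j
    using basis_in_plurican[OF msd that] cA by (simp add: plurican_def)
  interpret ws: weight_series n "img c" \<epsilon> q "\<lambda>m j. s m j c" "\<lambda>m. metric_term \<epsilon> q s m c"
    "\<lambda>w. \<Sum>m. metric_term \<epsilon> q s (Suc m) c w" "min_singularity_weight \<epsilon> q s c"
  proof
    show "0 < \<epsilon> m" if "1 \<le> m" for m using msd that by (simp add: min_singularity_data_def)
    show "uniformly_convergent_on K (\<lambda>N w. \<Sum>m = 1..N. metric_term \<epsilon> q s m c w)"
      if "compactin (Cn n) K" "K \<subseteq> img c" for K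
      using msd that cA unfolding min_singularity_data_def by blast
  qed (auto simp: op sec metric_term_def min_singularity_weight_def Let_def)
  have xin: "snd c x \<in> img c" using c by simp
  obtain r where r: "r > 0" "cpolydisc n (snd c x) r \<subseteq> img c" by (rule cpolydisc_in_open[OF op xin])
  define R where "R = r / 4"
  have R: "R > 0" "4 * R = r" using r by (auto simp: R_def)
  obtain C where C: "\<And>w. w \<in> cpolydisc n (snd c x) r \<Longrightarrow> \<psi> w \<le> ereal C"
    using open_cover_usc_bounded[OF \<psi> compactin_cpolydisc r(2)] by blast
  interpret log_kernel E E1 E2 \<beta> by (rule lk)
  have "weight_potential n (img c) \<epsilon> q (\<lambda>m j. s m j c) (\<lambda>m. metric_term \<epsilon> q s m c)
      (\<lambda>w. \<Sum>m. metric_term \<epsilon> q s (Suc m) c w) (min_singularity_weight \<epsilon> q s c) E E1 E2 \<beta>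
      {w \<in> img c. w (n - 1) = 0} (snd c x) R \<eta> C \<psi>"
  proof
    show "cpolydisc n (snd c x) (4 * R) \<subseteq> img c" using r R by simp
    show "snd c x \<in> extensional {..<n}" using xin openin_Cn_extensional[OF op] by blast
    show "snd c x (n - 1) = 0" using c x by (simp add: adapted_charts_def)
    show "\<psi> w \<le> ereal C" if "w \<in> cpolydisc n (snd c x) (4 * R)" for w using C that R by simp
    show "integrable (vol {..<n}) (\<lambda>w. indicator (polydisc n (snd c x) R) w * real_of_ereal (min_singularity_weight \<epsilon> q s c w))"
      using r R by (intro ws.weight_locally_integrable(1)) auto
    show "ddc n (min_singularity_weight \<epsilon> q s c) j j f - of_real \<eta> * integration_current n {w \<in> img c. w (n - 1) = 0} j j f = ddc n \<psi> j j f"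
      if "f \<in> test_functions n (img c)" "j < n" for f j
      using cur that unfolding current_eq_def curvature_current_def hypersurface_current_def adapted_image[OF c(1)] by blast
  qed (use n op \<psi> R \<eta> in auto)
  then show ?thesis using that c \<psi>' by blast
qed

theorem mainTheorem3:
  fixes n :: nat and X :: "'a topology" and A :: "'a chart set"
    and \<epsilon> :: "nat \<Rightarrow> real" and q :: "nat \<Rightarrow> nat" and s :: "nat \<Rightarrow> nat \<Rightarrow> 'a section_family"
    and \<Theta> :: "'a chart \<Rightarrow> current" and M :: "'a set" and \<eta> :: real
    and J :: nat and \<gamma> :: "nat \<Rightarrow> real" and Y :: "nat \<Rightarrow> 'a set"
  assumes "complex_manifold n X A" and "compact_space X" and "connected_space X"
    and "projective_algebraic n X A" and "general_type n A"
    and "min_singularity_data n A \<epsilon> q s"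
    and "\<Theta> = curvature_current n (min_singularity_weight \<epsilon> q s)"
    and "nonsingular_hypersurface n X A M"
    and "\<eta> = generic_lelong n A \<Theta> M" and "\<eta> > 0" and "\<eta> \<in> \<rat>"
    and "\<And>i. i < J \<Longrightarrow>
      irreducible_hypersurface (n - 1) (subtopology X M) (induced_atlas n A M) (Y i)"
    and "inj_on Y {..<J}"
    and "\<And>i. i < J \<Longrightarrow> \<gamma> i > 0 \<and> \<gamma> i \<in> \<rat>"
    and "is_restriction n A M
      (\<lambda>c j k f. \<Theta> c j k f - of_real \<eta> * hypersurface_current n M c j k f)
      (\<lambda>c j k f. \<Sum>i<J. of_real (\<gamma> i) * hypersurface_current (n - 1) (Y i) c j k f)"
  shows "precisely_achieved n X A M \<eta>"
proof (rule ccontr)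
  note mf = assms(1) and msd = assms(6) and \<eta> = assms(10)
  have n: "1 \<le> n" and Mne: "M \<noteq> {}" and MX: "M \<subseteq> topspace X"
    using assms(8) closedin_subset[of X M] by (auto simp: nonsingular_hypersurface_def)
  note restr = assms(15)[unfolded assms(7)]
  assume "\<not> precisely_achieved n X A M \<eta>"
  then have not_ach: "\<not> vanishing_order_across n X A M \<sigma> k" if "1 \<le> m" "\<sigma> \<in> plurican n A m" "real k = real m * \<eta>" for m \<sigma> k
    using that unfolding precisely_achieved_def by blast
  obtain E E1 E2 \<beta> where lk: "log_kernel E E1 E2 \<beta>" using log_kernel_exists by blast
  \<comment> \<open>The points of non-exact order form an analytic subset, off which the order is
    exact. If it were proper, the order m\<eta> would be attained across M; hence it is all of
    M.\<close>
  have never_exact: "\<not> vanishing_order_at n A M (s m j) k y"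
    if mj: "1 \<le> m" "j < q m" and k: "real k = real m * \<eta>" and y: "y \<in> M" for m j k y
  proof -
    let ?Z = "{y \<in> M. \<not> vanishing_order_at n A M (s m j) k y}"
    have sec: "s m j \<in> plurican n A m" by (rule basis_in_plurican[OF msd mj])
    have "analytic_subset (n - 1) (subtopology X M) (induced_atlas n A M) ?Z"
    proof (rule analytic_non_exact_vanishing[OF mf n MX sec])
      fix x assume x: "x \<in> M"
      obtain c R C \<psi> where c: "c \<in> adapted_charts n A M" "x \<in> fst c"
        and wp: "weight_potential n (img c) \<epsilon> q (\<lambda>m j. s m j c) (\<lambda>m. metric_term \<epsilon> q s m c)
          (\<lambda>w. \<Sum>m. metric_term \<epsilon> q s (Suc m) c w) (min_singularity_weight \<epsilon> q s c) E E1 E2 \<beta>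
          {w \<in> img c. w (n - 1) = 0} (snd c x) R \<eta> C \<psi>"
        by (rule restriction_weight_potential[OF mf msd n \<eta> restr x lk]) blast
      interpret weight_potential n "img c" \<epsilon> q "\<lambda>m j. s m j c" "\<lambda>m. metric_term \<epsilon> q s m c"
          "\<lambda>w. \<Sum>m. metric_term \<epsilon> q s (Suc m) c w" "min_singularity_weight \<epsilon> q s c" E E1 E2 \<beta>
          "{w \<in> img c. w (n - 1) = 0}" "snd c x" R \<eta> C \<psi>
        by (rule wp)
      have "real k < real m * \<eta> + 1" using k by simp
      then obtain g where g: "holo n (polydisc n (snd c x) (R / 3)) g"
        "\<And>w. w \<in> polydisc n (snd c x) (R / 3) \<Longrightarrow> s m j c w = w (n - 1) ^ k * g w"
        using section_divisible[OF mj] by blast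
      have "polydisc n (snd c x) (R / 3) \<subseteq> img c" using half_sub R by (force simp: polydisc_iff)
      then show "\<exists>c\<in>adapted_charts n A M. x \<in> fst c \<and> (\<exists>r>0. \<exists>g. polydisc n (snd c x) r \<subseteq> img c \<and>
        holo n (polydisc n (snd c x) r) g \<and> (\<forall>w\<in>polydisc n (snd c x) r. s m j c w = w (n - 1) ^ k * g w))"
        using c g R by (intro bexI[of _ c] conjI exI[of _ "R / 3"] exI[of _ g]) auto
    qed
    then have "?Z = M"
      using not_ach[OF mj(1) sec k] unfolding vanishing_order_across_def by blast
    then show ?thesis using y by blast
  qed
  obtain x where x: "x \<in> M" using Mne by blast
  obtain c R C \<psi> where c: "c \<in> adapted_charts n A M" "x \<in> fst c"
    and wp: "weight_potential n (img c) \<epsilon> q (\<lambda>m j. s m j c) (\<lambda>m. metric_term \<epsilon> q s m c)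
      (\<lambda>w. \<Sum>m. metric_term \<epsilon> q s (Suc m) c w) (min_singularity_weight \<epsilon> q s c) E E1 E2 \<beta>
      {w \<in> img c. w (n - 1) = 0} (snd c x) R \<eta> C \<psi>"
    and \<psi>': "psh (n - 1) (img (restrict_chart n M c)) (\<lambda>v. \<psi> (v(n - 1 := 0)))"
    by (rule restriction_weight_potential[OF mf msd n \<eta> restr x lk]) blast
  interpret weight_potential n "img c" \<epsilon> q "\<lambda>m j. s m j c" "\<lambda>m. metric_term \<epsilon> q s m c"
      "\<lambda>w. \<Sum>m. metric_term \<epsilon> q s (Suc m) c w" "min_singularity_weight \<epsilon> q s c" E E1 E2 \<beta>
      "{w \<in> img c. w (n - 1) = 0}" "snd c x" R \<eta> C \<psi>
    by (rule wp)
  let ?P = "polydisc n (snd c x)"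
  have third_sub: "?P (R / 3) \<subseteq> img c" using half_sub R by (force simp: polydisc_iff)
  have minf: "\<psi> \<zeta> = -\<infinity>" if \<zeta>: "\<zeta> \<in> ?P (R / 4)" "\<zeta> (n - 1) = 0" for \<zeta>
  proof (rule potential_eq_minus_infinity[OF _ \<zeta>])
    fix m j y \<delta>
    assume mj: "1 \<le> m" "j < q m" and y: "y \<in> ?P (R / 3)" "y (n - 1) = 0" and \<delta>: "(\<delta>::real) > 0"
    \<comment> \<open>The least integer not below m\<eta>. If it equals m\<eta>, the quotient g
      vanishes on M by \<open>never_exact\<close>; otherwise the section already vanishes to an
      order higher than m\<eta>.\<close>
    define k where "k = nat \<lceil>real m * \<eta>\<rceil>"
    have "0 \<le> real m * \<eta>" using \<eta> by simp
    then have k: "real m * \<eta> \<le> real k" "real k < real m * \<eta> + 1" unfolding k_def by linarith+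
    obtain g where g: "holo n (?P (R / 3)) g" "\<And>w. w \<in> ?P (R / 3) \<Longrightarrow> s m j c w = w (n - 1) ^ k * g w"
      using section_divisible[OF mj k(2)] by blast
    have "g y = 0" if km: "real k = real m * \<eta>"
    proof (rule ccontr)
      assume gy: "g y \<noteq> 0"
      obtain z where z: "z \<in> fst c" "y = snd c z" using y third_sub by blast
      have zM: "z \<in> M" using c z y(2) by (simp add: adapted_charts_def)
      have "vanishing_order_at n A M (s m j) k z"
        unfolding vanishing_order_at_def using c(1) z y(1) third_sub g gy by blast
      then show False using never_exact[OF mj km zM] by blast
    qed
    then show "\<exists>r>0. \<forall>w\<in>polydisc n y r. cmod (s m j c w) powr (2 / real m) \<le> \<delta> * cmod (w (n - 1)) powr (2 * \<eta>)"
      using divisible_small[OF g n k(1) _ mj(1) \<eta> y \<delta>] by blast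
  qed
  \<comment> \<open>A polydisc in the coordinates of M on which \<psi> is identically -\<infinity>
    by \<open>minf\<close>, contrary to the plurisubharmonicity of its restriction.\<close>
  let ?V = "polydisc (n - 1) (restrict (snd c x) {..<n - 1}) (R / 4)"
  have quarter: "v(n - 1 := 0) \<in> ?P (R / 4)" if "v \<in> ?V" for v
    using that polydisc_hyperplane[of n "snd c x" "R / 4" v, OF n a(2)] R by (simp add: polydisc_iff)
  have "?V \<subseteq> img (restrict_chart n M c)"
    unfolding img_restrict_chart[OF c(1) n openin_Cn_extensional[OF U]]
  proof
    fix v assume v: "v \<in> ?V"
    have "?P (R / 4) \<subseteq> img c" using half_sub R by (force simp: polydisc_iff)
    then show "v \<in> {v \<in> extensional {..<n - 1}. v(n - 1 := 0) \<in> img c}"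
      using quarter[OF v] v by (auto simp only: polydisc_iff)
  qed
  moreover have "restrict (snd c x) {..<n - 1} \<in> ?V" using R by (simp add: polydisc_iff)
  then have "?V \<noteq> {}" by blast
  moreover have "\<forall>V. openin (Cn (n - 1)) V \<and> V \<subseteq> img (restrict_chart n M c) \<and> V \<noteq> {} \<longrightarrow>
      (\<exists>v\<in>V. \<psi> (v(n - 1 := 0)) \<noteq> -\<infinity>)"
    using \<psi>' unfolding psh_def by (elim conjE)
  ultimately obtain v where "v \<in> ?V" "\<psi> (v(n - 1 := 0)) \<noteq> -\<infinity>"
    using openin_polydisc by meson
  then show False using minf[OF quarter] by simp
qed

end
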